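(* There is an absolute constant $c_0>0$ such that the following holds. Let $\lambda=\lambda(d)$ satisfy $\lambda>\frac{c_0\log d}{d^{1/3}}$, and let $I$ be chosen from $\mathcal{I}(Q_d)$ according to ${\rm hc}(\lambda)$. If $u,v\in\mathcal{E}$ and $w\in\mathcal{O}$ are three vertices of $Q_d$, then $$\Pr\left(u\in I\mid w\in I\right)\le(1+\lambda)^{-d(1-o(1))}$$ and $$\Pr\left(u\in I\mid v\in I\right)\ge\frac{\lambda}{1+\lambda}(1-o(1)),$$ where the $o(1)$ terms tend to $0$ as $d\to\infty$.
   Context: $Q_d$ is the discrete hypercube: the graph on vertex set $\{0,1\}^d$ in which two strings are adjacent iff they differ in exactly one coordinate. It is bipartite with classes $\mathcal{E}$ (strings with an even number of $1$'s) and $\mathcal{O}$ (strings with an odd number of $1$'s). $\mathcal{I}(Q_d)$ is the set of independent sets of $Q_d$ (including the empty set). For $\lambda>0$, the hard-core distribution ${\rm hc}(\lambda)$ on $\mathcal{I}(Q_d)$ chooses each $I$ with probability proportional to $\lambda^{|I|}$. The parameter $\lambda$ and the vertices $u,v,w$ may vary with $d$. Logarithms are to base $e$. *)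

theory Defs
  imports "HOL-Probability.Probability"
begin

definition cube_verts :: "nat \<Rightarrow> bool list set" where
  "cube_verts d = {x. length x = d}"

definition cube_adj :: "nat \<Rightarrow> bool list \<Rightarrow> bool list \<Rightarrow> bool" where
  "cube_adj d x y \<longleftrightarrow>
     x \<in> cube_verts d \<and> y \<in> cube_verts d \<and> card {i. i < d \<and> x ! i \<noteq> y ! i} = 1"

definition even_verts :: "nat \<Rightarrow> bool list set" where
  "even_verts d = {x \<in> cube_verts d. even (card {i. i < d \<and> x ! i})}"

definition odd_verts :: "nat \<Rightarrow> bool list set" where
  "odd_verts d = {x \<in> cube_verts d. odd (card {i. i < d \<and> x ! i})}"

definition indep_sets_cube :: "nat \<Rightarrow> bool list set set" where
  "indep_sets_cube d = {I. I \<subseteq> cube_verts d \<and> (\<forall>x\<in>I. \<forall>y\<in>I. \<not> cube_adj d x y)}"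

definition hc_partition :: "nat \<Rightarrow> real \<Rightarrow> real" where
  "hc_partition d l = (\<Sum>I\<in>indep_sets_cube d. l ^ card I)"

text \<open>The embedding into the type of probability mass functions is only meaningful for a
  positive activity \<open>l\<close>; see \<open>pmf_hc\<close> below.\<close>

definition hc :: "nat \<Rightarrow> real \<Rightarrow> bool list set pmf" where
  "hc d l = embed_pmf (\<lambda>I. if I \<in> indep_sets_cube d then l ^ card I / hc_partition d l else 0)"

lemma finite_cube_verts: "finite (cube_verts d)"
  using finite_lists_length_eq[of "UNIV :: bool set" d] by (simp add: cube_verts_def)

lemma finite_indep_sets_cube: "finite (indep_sets_cube d)"
  by (rule finite_subset[of _ "Pow (cube_verts d)"])
     (auto simp: indep_sets_cube_def finite_cube_verts)

lemma hc_partition_pos: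
  assumes "l > 0"
  shows "hc_partition d l > 0"
  unfolding hc_partition_def
proof (rule sum_pos)
  have "{} \<in> indep_sets_cube d" by (simp add: indep_sets_cube_def)
  then show "indep_sets_cube d \<noteq> {}" by blast
qed (use assms finite_indep_sets_cube in auto)

lemma pmf_hc:
  assumes "l > 0"
  shows "pmf (hc d l) I = (if I \<in> indep_sets_cube d then l ^ card I / hc_partition d l else 0)"
  unfolding hc_def
proof (rule pmf_embed_pmf)
  let ?f = "\<lambda>I. if I \<in> indep_sets_cube d then l ^ card I / hc_partition d l else 0"
  show nonneg: "0 \<le> ?f I" for I
    using assms hc_partition_pos[OF assms, of d] by simp
  have "(\<integral>\<^sup>+ I. ennreal (?f I) \<partial>count_space UNIV) = (\<Sum>I\<in>indep_sets_cube d. ennreal (?f I))"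
    by (rule nn_integral_count_space'[OF finite_indep_sets_cube]) auto
  also have "\<dots> = ennreal (\<Sum>I\<in>indep_sets_cube d. ?f I)"
    by (rule sum_ennreal) (rule nonneg)
  also have "(\<Sum>I\<in>indep_sets_cube d. ?f I) = hc_partition d l / hc_partition d l"
    by (simp only: hc_partition_def sum_divide_distrib if_True cong: sum.cong)
  also have "\<dots> = 1"
    using hc_partition_pos[OF assms, of d] by simp
  finally show "(\<integral>\<^sup>+ I. ennreal (?f I) \<partial>count_space UNIV) = 1" by simp
qed

end

theory Submission
  imports Defs "HOL-Real_Asymp.Real_Asymp"
begin

text \<open>
  The lower order terms are controlled by one quantity: the weight of the independent sets that
  contain a given even vertex \<open>v\<close> and whose even part \<open>A\<close> is small (its closure contains at most
  half of the even vertices). In every independent set the even or the odd part is small, and the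
  two events have equal probability, so a bound \<open>\<eta> = (1 + \<lambda>) powr (- d (1 - o(1)))\<close> on the relative
  weight yields both correlation estimates.

  Deleting the 2-linked component \<open>C\<close> of \<open>v\<close> in \<open>A\<close> frees all neighbours of \<open>C\<close>, so the relative
  weight is at most the sum of \<open>\<lambda> ^ |C| / (1 + \<lambda>) ^ |N(C)|\<close> over small 2-linked \<open>C\<close>. If
  \<open>|N(C)| < d ^ 3\<close>, the edge-isoperimetric inequality makes \<open>|N(C)|\<close> exceed \<open>|C|\<close> by a factor of order
  \<open>d / log d\<close> and crude counting suffices. Otherwise \<open>C\<close> is put into a container by Sapozhenko's
  method: a few vertices determine a set \<open>S\<close> that contains \<open>C\<close> and is smaller than \<open>|N(C)|\<close> by a
  definite fraction of \<open>t = |N(C)| - |[C]|\<close>, where \<open>[C]\<close> is the closure. Every auxiliary choice is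
  made among vertices close to \<open>C\<close>, so all choices together are visited by one short lazy walk from
  \<open>v\<close>, which makes counting the containers a matter of counting walks.
\<close>

section \<open>Walks in a regular bipartite graph\<close>

text \<open>Why the exponent 1/3. Write \<open>\<Lambda> = ln d\<close> and
  \<open>\<beta> = ln (1 + \<lambda>)\<close>, and take a degree threshold \<open>\<psi>\<close> and
  a fraction \<open>\<gamma>\<close>. Naming the auxiliary vertices costs about
  \<open>t * \<Lambda> / \<psi>\<close> in the exponent. If the lower approximation of the
  neighbourhood misses at least \<open>\<gamma> * t\<close> vertices, the container saves
  \<open>\<beta> * \<gamma> * t\<close> but its inaccuracy gives back about
  \<open>\<beta> * t * \<psi> / d\<close>. Otherwise listing the missed vertices costs
  \<open>\<gamma> * t * \<Lambda>\<close> against a saving of \<open>\<beta> * t\<close>. Up to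
  constants this asks for \<open>\<Lambda> / \<psi> \<le> \<beta> * \<gamma>\<close>,
  \<open>\<psi> / d \<le> \<gamma>\<close> and \<open>\<gamma> * \<Lambda> \<le> \<beta>\<close>.
  Eliminating \<open>\<gamma>\<close> and \<open>\<psi>\<close> leaves
  \<open>\<Lambda> ^ 3 / d \<le> \<beta> ^ 3\<close>, which is the hypothesis on
  \<open>\<lambda>\<close>. With \<open>q = d powr (1/3)\<close> the choices are
  \<open>\<psi>\<close> about \<open>q ^ 2\<close> and \<open>\<gamma> = 20 / q\<close>. All savings
  are proportional to \<open>t\<close>, so isoperimetry must also bound \<open>t\<close> from below
  by \<open>|N(C)| / (2 * d)\<close>.\<close>

lemma sum_UN_le:
  fixes f :: "'b \<Rightarrow> real"
  assumes "finite K" "\<And>k. k \<in> K \<Longrightarrow> finite (B k)" "\<And>x. f x \<ge> 0"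
  shows "sum f (\<Union>k\<in>K. B k) \<le> (\<Sum>k\<in>K. sum f (B k))"
  using assms(1,2)
proof (induction K rule: finite_induct)
  case (insert k K)
  have "sum f (B k \<union> (\<Union>k\<in>K. B k)) \<le> sum f (B k) + sum f (\<Union>k\<in>K. B k)"
    using insert by (subst sum_Un) (auto intro!: sum_nonneg assms(3))
  then show ?case using insert by fastforce
qed simp

lemma sum_Pow_power_card:
  fixes l :: real
  assumes "finite S"
  shows "(\<Sum>A\<in>Pow S. l ^ card A) = (1 + l) ^ card S"
  using assms
proof (induction S rule: finite_induct)
  case (insert x S)
  have inj: "inj_on (insert x) (Pow S)" using insert(2) by (auto simp: inj_on_def)
  have "(\<Sum>A\<in>insert x ` Pow S. l ^ card A) = (\<Sum>A\<in>Pow S. l * l ^ card A)"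
    using insert by (subst sum.reindex[OF inj], intro sum.cong)
      (auto simp: finite_subset card_insert_if)
  moreover have "Pow S \<inter> insert x ` Pow S = {}" using insert(2) by auto
  ultimately show ?case using insert
    by (simp add: Pow_insert sum.union_disjoint sum_distrib_left[symmetric] algebra_simps)
qed simp

text \<open>The axioms are symmetric in \<open>L\<close> and \<open>R\<close>, so every result
  transfers to the other side through \<open>swap\<close>. Of the geometry of the cube only the
  codegree bound is kept here; isoperimetry and the size of the sides enter later as explicit
  hypotheses.\<close>

locale regular_bipartite =
  fixes L R :: "'a set" and N :: "'a \<Rightarrow> 'a set" and d :: nat
  assumes finite_L: "finite L" and finite_R: "finite R" and disjoint: "L \<inter> R = {}"
    and N_L: "x \<in> L \<Longrightarrow> N x \<subseteq> R" and N_R: "x \<in> R \<Longrightarrow> N x \<subseteq> L"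
    and card_N: "x \<in> L \<union> R \<Longrightarrow> card (N x) = d"
    and N_sym: "x \<in> L \<union> R \<Longrightarrow> y \<in> N x \<Longrightarrow> x \<in> N y"
    and codegree: "x \<in> L \<union> R \<Longrightarrow> y \<in> L \<union> R \<Longrightarrow> x \<noteq> y \<Longrightarrow> card (N x \<inter> N y) \<le> 2"
    and d_pos: "d > 0"
begin

lemma swap: "regular_bipartite R L N d"
  using finite_L finite_R disjoint N_L N_R card_N N_sym codegree d_pos
  by unfold_locales (auto simp: Int_commute Un_commute)

definition NS :: "'a set \<Rightarrow> 'a set" where "NS A = (\<Union>x\<in>A. N x)"

definition cl :: "'a set \<Rightarrow> 'a set" where "cl A = {x \<in> L. N x \<subseteq> NS A}"

text \<open>2-linkedness, phrased through cuts so that no paths have to be handled.\<close>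

definition linked :: "'a set \<Rightarrow> bool" where
  "linked A \<longleftrightarrow> (\<forall>B. B \<subseteq> A \<longrightarrow> B \<noteq> {} \<longrightarrow> B \<noteq> A \<longrightarrow> (\<exists>x\<in>B. \<exists>y\<in>A - B. N x \<inter> N y \<noteq> {}))"

definition small :: "'a set \<Rightarrow> bool" where
  "small A \<longleftrightarrow> 2 * card (cl A) \<le> card L"

text \<open>Steps may stay put, so walks can be padded to any prescribed length. Hence
  \<open>near k\<close> means distance at most \<open>k\<close>, and one exponent counts all
  codes.\<close>

definition walk :: "'a list \<Rightarrow> bool" where
  "walk ws \<longleftrightarrow> successively (\<lambda>x y. y = x \<or> y \<in> N x) ws"

definition near :: "nat \<Rightarrow> 'a \<Rightarrow> 'a \<Rightarrow> bool" where
  "near k x y \<longleftrightarrow> (\<exists>p. walk p \<and> length p = Suc k \<and> hd p = x \<and> last p = y)"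

lemma N_subset: "x \<in> L \<union> R \<Longrightarrow> N x \<subseteq> L \<union> R"
  using N_L N_R by auto

lemma finite_N: "x \<in> L \<union> R \<Longrightarrow> finite (N x)"
  using card_N d_pos card.infinite by fastforce

lemma N_nonempty: "x \<in> L \<union> R \<Longrightarrow> N x \<noteq> {}"
  using card_N d_pos by fastforce

lemma NS_L: "A \<subseteq> L \<Longrightarrow> NS A \<subseteq> R"
  using N_L by (auto simp: NS_def)

lemma NS_R: "A \<subseteq> R \<Longrightarrow> NS A \<subseteq> L"
  using N_R by (auto simp: NS_def)

lemma NS_mono: "A \<subseteq> B \<Longrightarrow> NS A \<subseteq> NS B"
  by (auto simp: NS_def)

lemma cl_subset: "cl A \<subseteq> L" by (auto simp: cl_def)

lemma finite_cl: "finite (cl A)" using cl_subset finite_L finite_subset by blast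

lemma subset_cl: "A \<subseteq> L \<Longrightarrow> A \<subseteq> cl A" by (auto simp: cl_def NS_def)

lemma cl_mono: "A \<subseteq> B \<Longrightarrow> cl A \<subseteq> cl B" using NS_mono[of A B] by (auto simp: cl_def)

lemma NS_cl: "A \<subseteq> L \<Longrightarrow> NS (cl A) = NS A"
  using NS_mono[OF subset_cl] by (auto simp: cl_def NS_def)

lemma double_count:
  assumes "X \<subseteq> L \<union> R" "Y \<subseteq> L \<union> R"
  shows "(\<Sum>x\<in>X. card (N x \<inter> Y)) = (\<Sum>y\<in>Y. card (N y \<inter> X))"
proof -
  have fin: "finite X" "finite Y" using assms finite_L finite_R finite_subset by blast+
  have eq: "card (N x \<inter> Y) = (\<Sum>y\<in>Y. if y \<in> N x then 1 else 0)" if "finite Y" for x Y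
    using that by (simp add: sum.If_cases Int_commute)
  have "(\<Sum>x\<in>X. card (N x \<inter> Y)) = (\<Sum>x\<in>X. \<Sum>y\<in>Y. if y \<in> N x then 1 else 0)"
    using fin by (simp add: eq)
  also have "\<dots> = (\<Sum>y\<in>Y. \<Sum>x\<in>X. if y \<in> N x then 1 else 0)" by (rule sum.swap)
  also have "\<dots> = (\<Sum>y\<in>Y. \<Sum>x\<in>X. if x \<in> N y then 1 else 0)"
    using assms N_sym by (intro sum.cong) (auto simp: subset_iff)
  finally show ?thesis using fin by (simp add: eq)
qed

lemma card_L_eq_R: "card L = card R"
proof -
  have "(\<Sum>x\<in>L. card (N x \<inter> R)) = (\<Sum>y\<in>R. card (N y \<inter> L))"
    by (rule double_count) auto
  moreover have "card (N x \<inter> R) = d" if "x \<in> L" for x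
    using that N_L[of x] card_N[of x] by (simp add: Int_absorb2)
  moreover have "card (N x \<inter> L) = d" if "x \<in> R" for x
    using that N_R[of x] card_N[of x] by (simp add: Int_absorb2)
  ultimately show ?thesis using d_pos by simp
qed

section \<open>Lazy walks and how they cover connected sets\<close>

lemma walk_Cons: "walk (x # ws) \<longleftrightarrow> ws = [] \<or> ((hd ws = x \<or> hd ws \<in> N x) \<and> walk ws)"
  by (cases ws) (auto simp: walk_def)

lemma walk_Nil: "walk []" by (simp add: walk_def)

lemma walk_append:
  "walk (as @ bs) \<longleftrightarrow> walk as \<and> walk bs \<and>
     (as = [] \<or> bs = [] \<or> hd bs = last as \<or> hd bs \<in> N (last as))"
  by (auto simp: walk_def successively_append_iff)

lemma walk_subset: "walk ws \<Longrightarrow> hd ws \<in> L \<union> R \<Longrightarrow> set ws \<subseteq> L \<union> R"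
proof (induction ws)
  case (Cons x ws)
  then show ?case using N_subset[of x] by (cases ws) (auto simp: walk_Cons)
qed simp

lemma walk_rev: "walk ws \<Longrightarrow> hd ws \<in> L \<union> R \<Longrightarrow> walk (rev ws)"
proof (induction ws)
  case (Cons x ws)
  show ?case
  proof (cases "ws = []")
    case False
    have V: "set (x # ws) \<subseteq> L \<union> R" using walk_subset Cons.prems by blast
    have "hd ws \<in> set (x # ws)" using False by auto
    then have "hd ws \<in> L \<union> R" using V by blast
    then have "walk (rev ws)" using Cons False by (auto simp: walk_Cons)
    then show ?thesis using Cons.prems False V N_sym[of x "hd ws"]
      by (auto simp: walk_append walk_Cons last_rev)
  qed (simp add: walk_def)
qed (simp add: walk_def)

lemma near_refl: "near k x x"
proof -
  have "walk (replicate (Suc k) x)" by (induction k) (auto simp: walk_Cons)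
  then show ?thesis unfolding near_def by (intro exI[of _ "replicate (Suc k) x"]) auto
qed

lemma near_sym: assumes "near k x y" "x \<in> L \<union> R" shows "near k y x"
proof -
  note x = assms(2)
  from assms(1) obtain p where "walk p" "length p = Suc k" "hd p = x" "last p = y" unfolding near_def by blast
  then have "walk (rev p)" "length (rev p) = Suc k" "hd (rev p) = y" "last (rev p) = x"
    using walk_rev[of p] x by (auto simp: hd_rev last_rev)
  then show ?thesis unfolding near_def by blast
qed

lemma near_trans:
  assumes "near j x y" "near k y z" shows "near (j + k) x z"
proof -
  from assms obtain p q where p: "walk p" "length p = Suc j" "hd p = x" "last p = y"
    and q: "walk q" "length q = Suc k" "hd q = y" "last q = z" unfolding near_def by auto
  from q obtain q' where q': "q = y # q'" by (cases q) auto
  have "walk (p @ q')" using p q q' by (auto simp: walk_append walk_Cons walk_Nil)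
  then show ?thesis unfolding near_def using p q q'
    by (intro exI[of _ "p @ q'"]) (cases p, auto split: if_splits)
qed

lemma near_mono: "near j x y \<Longrightarrow> j \<le> k \<Longrightarrow> near k x y"
  using near_trans[of j x y "k - j" y] near_refl by simp

lemma near_N: "y \<in> N x \<Longrightarrow> near 1 x y"
  unfolding near_def by (intro exI[of _ "[x, y]"]) (auto simp: walk_Cons)

definition walks :: "'a \<Rightarrow> nat \<Rightarrow> 'a list set" where
  "walks v n = {ws. walk ws \<and> length ws = Suc n \<and> hd ws = v}"

lemma card_walks:
  assumes "v \<in> L \<union> R"
  shows "finite (walks v n) \<and> card (walks v n) \<le> (d + 1) ^ n"
  using assms
proof (induction n arbitrary: v)
  case 0
  have "walks v 0 = {[v]}" by (auto simp: walks_def length_Suc_conv walk_Cons)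
  then show ?case by simp
next
  case (Suc n)
  let ?S = "insert v (N v)"
  have S: "?S \<subseteq> L \<union> R" "finite ?S" using Suc.prems N_subset finite_N by auto
  have eq: "walks v (Suc n) = (\<Union>w\<in>?S. (#) v ` walks w n)"
    by (auto simp: walks_def length_Suc_conv walk_Cons image_iff)
  have IH: "finite (walks w n)" "card (walks w n) \<le> (d + 1) ^ n" if "w \<in> ?S" for w
    using Suc.IH[of w] S that by auto
  have "card (walks v (Suc n)) \<le> (\<Sum>w\<in>?S. card ((#) v ` walks w n))"
    unfolding eq using S by (intro card_UN_le) auto
  also have "\<dots> \<le> (\<Sum>w\<in>?S. (d + 1) ^ n)"
    using IH by (intro sum_mono) (meson card_image_le order_trans)
  also have "\<dots> \<le> (d + 1) * (d + 1) ^ n"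
    using S card_N[OF Suc.prems] card_insert_le_m1[of "d+1" "N v" v]
    by (simp add: card_insert_if)
  finally show ?case using S IH unfolding eq by auto
qed

text \<open>As long as the walk misses part of \<open>X\<close>, some visited \<open>y\<close> is
  within \<open>k\<close> of an unvisited \<open>x\<close>, and a detour from \<open>y\<close> to
  \<open>x\<close> and back adds \<open>2 * k\<close> steps. The start visits \<open>v\<close>, so
  \<open>n\<close> detours suffice for \<open>n + 1\<close> vertices.\<close>

lemma covering_walk:
  assumes v: "v \<in> X" "X \<subseteq> L \<union> R"
    and conn: "\<And>Y. v \<in> Y \<Longrightarrow> Y \<subset> X \<Longrightarrow> \<exists>y\<in>Y. \<exists>x\<in>X - Y. near k y x"
  shows "\<exists>ws\<in>walks v (2 * k * n). card X \<le> Suc n \<longrightarrow> X \<subseteq> set ws"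
proof -
  have finX: "finite X" using v finite_L finite_R finite_subset by blast
  have "\<exists>ws\<in>walks v (2 * k * n). X \<subseteq> set ws \<or> card (X \<inter> set ws) \<ge> Suc n" for n
  proof (induction n)
    case 0
    have "X \<inter> {v} = {v}" using v by auto
    then show ?case by (intro bexI[of _ "[v]"]) (auto simp: walks_def walk_Cons)
  next
    case (Suc n)
    then obtain ws where ws: "walk ws" "length ws = Suc (2 * k * n)" "hd ws = v"
      and or: "X \<subseteq> set ws \<or> card (X \<inter> set ws) \<ge> Suc n" by (auto simp: walks_def)
    have ne: "ws \<noteq> []" using ws by auto
    show ?case
    proof (cases "X \<subseteq> set ws")
      case True
      \<comment> \<open>Everything is visited already; idling at \<open>v\<close> only brings the
        length to the prescribed value.\<close>
      let ?w = "replicate (2 * k) v @ ws"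
      have "walk (replicate m v)" for m
        by (induction m) (auto simp: walk_Cons walk_Nil)
      then have "walk ?w" using ws by (auto simp: walk_append)
      then show ?thesis using ws True ne by (intro bexI[of _ ?w]) (auto simp: walks_def hd_append)
    next
      case False
      have "v \<in> set ws" using ws ne by auto
      then obtain y x where yx: "y \<in> X \<inter> set ws" "x \<in> X" "x \<notin> set ws" "near k y x"
        using conn[of "X \<inter> set ws"] False v by blast
      then obtain p where p: "walk p" "length p = Suc k" "hd p = y" "last p = x"
        unfolding near_def by auto
      then obtain p' where p': "p = y # p'" by (cases p) auto
      have rp: "walk (rev p)" using walk_rev p yx v by auto
      obtain q' where q': "rev p = x # q'"
        using p p' by (cases "rev p") (auto simp: hd_rev[symmetric])
      have lq: "length q' = k" using q' p by (metis Suc_inject length_Cons length_rev)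
      obtain as bs where ab: "ws = as @ y # bs" using yx by (meson IntD2 split_list)
      \<comment> \<open>The detour is spliced in at an occurrence of \<open>y\<close>:
        \<open>p\<close> replaces \<open>y\<close> and leads to \<open>x\<close>, and
        \<open>q'\<close> is the way back without repeating \<open>x\<close>, hence
        \<open>2 * k\<close> additional entries.\<close>
      let ?w = "as @ p @ q' @ bs"
      have lp: "last (rev p) = y" using p' by (simp add: last_rev)
      have lpq: "last (p @ q') = y" using lp q' p by (cases "q' = []") auto
      have "walk (p @ q')" using p rp q' by (auto simp: walk_append walk_Cons walk_Nil)
      moreover have "walk as" "as = [] \<or> y = last as \<or> y \<in> N (last as)"
        "bs = [] \<or> hd bs = y \<or> hd bs \<in> N y" "walk bs"
        using ws(1) unfolding ab by (auto simp: walk_append walk_Cons walk_Nil)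
      moreover have "hd (p @ q') = y" "p @ q' \<noteq> []" using p' by auto
      ultimately have "walk (as @ (p @ q') @ bs)" unfolding walk_append[of as] walk_append[of "p @ q'"] lpq
        by (metis hd_append2)
      then have "walk ?w" by simp
      moreover have "hd ?w = v" using ws ab p' by (cases as) auto
      moreover have "length ?w = Suc (2 * k * Suc n)" using ws p lq ab by simp
      moreover have "insert x (X \<inter> set ws) \<subseteq> X \<inter> set ?w"
        using ab p p' yx last_in_set[of p] by auto
      then have "card (insert x (X \<inter> set ws)) \<le> card (X \<inter> set ?w)"
        using finX by (intro card_mono) auto
      then have "card (X \<inter> set ?w) \<ge> Suc (Suc n)" using or False yx by auto
      ultimately show ?thesis by (intro bexI[of _ ?w]) (auto simp: walks_def)
    qed
  qed
  from this[of n] obtain ws where ws: "ws \<in> walks v (2 * k * n)"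
    "X \<subseteq> set ws \<or> card (X \<inter> set ws) \<ge> Suc n" by auto
  have "X \<subseteq> set ws" if "card X \<le> Suc n"
  proof (rule ccontr)
    assume "\<not> X \<subseteq> set ws"
    then have "X \<inter> set ws \<subset> X" by auto
    then have "card (X \<inter> set ws) < card X" using finX psubset_card_mono by blast
    then show False using ws that \<open>\<not> X \<subseteq> set ws\<close> by auto
  qed
  then show ?thesis using ws by auto
qed

text \<open>Union bound over codes. A code is a walk together with one of \<open>2 ^ 5 = 32\<close>
  label sets for each visited vertex. The container \<open>D Y\<close> depends on the labelled
  vertices alone, and the weights of all subsets of a container of size at most \<open>m\<close> sum
  to at most \<open>(1 + l) ^ m\<close>.\<close>

lemma decoding_bound:
  fixes l :: real and D :: "('a \<times> nat) set \<Rightarrow> 'a set"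
  assumes v: "v \<in> L \<union> R" and l: "l \<ge> 0"
    and code: "\<And>A. A \<in> \<A> \<Longrightarrow> \<exists>ws\<in>walks v n. \<exists>Y. Y \<subseteq> set ws \<times> {..<5} \<and> A \<subseteq> D Y \<and> card (D Y) \<le> m"
    and finD: "\<And>Y. finite (D Y)"
  shows "(\<Sum>A\<in>\<A>. l ^ card A) \<le> (32 * (real d + 1)) ^ (n + 1) * (1 + l) ^ m"
proof -
  define K where "K = (\<Union>ws\<in>walks v n. Pow (set ws \<times> {..<5::nat}))"
  define K' where "K' = {Y \<in> K. card (D Y) \<le> m}"
  have W: "finite (walks v n)" "card (walks v n) \<le> (d + 1) ^ n" using card_walks[OF v] by auto
  have finK: "finite K" unfolding K_def using W by auto
  have "card K \<le> (\<Sum>ws\<in>walks v n. card (Pow (set ws \<times> {..<5::nat})))"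
    unfolding K_def using W by (intro card_UN_le) auto
  also have "\<dots> \<le> (\<Sum>ws\<in>walks v n. 32 ^ (n + 1))"
  proof (intro sum_mono)
    fix ws assume "ws \<in> walks v n"
    then have "card (set ws) \<le> n + 1" using card_length[of ws] by (simp add: walks_def)
    then have "(2::nat) ^ (card (set ws) * 5) \<le> 2 ^ (5 * (n + 1))" by (intro power_increasing) auto
    also have "\<dots> = 32 ^ (n + 1)" by (simp only: power_mult) simp
    finally show "card (Pow (set ws \<times> {..<5::nat})) \<le> 32 ^ (n + 1)"
      by (simp add: card_Pow card_cartesian_product)
  qed
  also have "\<dots> \<le> (d + 1) ^ n * 32 ^ (n + 1)" using W by simp
  also have "\<dots> \<le> (d + 1) ^ (n + 1) * 32 ^ (n + 1)" by (intro mult_mono power_increasing) auto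
  also have "\<dots> = (32 * (d + 1)) ^ (n + 1)" by (simp only: power_mult_distrib mult.commute)
  finally have "real (card K) \<le> real ((32 * (d + 1)) ^ (n + 1))" by (simp only: of_nat_le_iff)
  then have cK: "real (card K) \<le> (32 * (real d + 1)) ^ (n + 1)" by (simp add: algebra_simps)
  have "\<A> \<subseteq> (\<Union>Y\<in>K'. Pow (D Y))" using code unfolding K'_def K_def by blast
  then have "(\<Sum>A\<in>\<A>. l ^ card A) \<le> (\<Sum>A\<in>(\<Union>Y\<in>K'. Pow (D Y)). l ^ card A)"
    using finK finD l by (intro sum_mono2) (auto simp: K'_def)
  also have "\<dots> \<le> (\<Sum>Y\<in>K'. \<Sum>A\<in>Pow (D Y). l ^ card A)"
    using finK finD l by (intro sum_UN_le) (auto simp: K'_def)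
  also have "\<dots> \<le> (\<Sum>Y\<in>K'. (1 + l) ^ m)"
    using finD l by (intro sum_mono) (auto simp: sum_Pow_power_card K'_def intro!: power_increasing)
  also have "\<dots> = real (card K') * (1 + l) ^ m" by simp
  also have "real (card K') \<le> (32 * (real d + 1)) ^ (n + 1)"
    using card_mono[OF finK, of K'] cK by (auto simp: K'_def)
  finally show ?thesis using l by (simp add: mult_right_mono)
qed

text \<open>Let \<open>B\<close> be the part of \<open>A\<close> within distance 3 of
  \<open>Y\<close>. If \<open>B\<close> is a proper part of \<open>A\<close>, linkedness gives
  vertices inside and outside \<open>B\<close> with a common neighbour, and
  \<open>3 + 2 + 3 = 8\<close>. To see that it is proper, take \<open>x\<close> in
  \<open>X - Y\<close>: it is within 3 of the closure, hence within 5 of some \<open>a\<close> in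
  \<open>A\<close>, and \<open>a\<close> in \<open>B\<close> would put \<open>x\<close> within
  \<open>5 + 3 = 8\<close> of \<open>Y\<close>.\<close>

lemma linked_near:
  assumes A: "A \<subseteq> L" "linked A" "v \<in> A" and X: "v \<in> X" "X \<subseteq> L \<union> R"
    and cov: "\<And>u. u \<in> A \<Longrightarrow> \<exists>x\<in>X. near 3 u x"
    and cls: "\<And>x. x \<in> X \<Longrightarrow> \<exists>u\<in>cl A. near 3 x u"
    and Y: "v \<in> Y" "Y \<subset> X"
  shows "\<exists>y\<in>Y. \<exists>x\<in>X - Y. near 8 y x"
proof (rule ccontr)
  assume no: "\<not> ?thesis"
  define B where "B = {u \<in> A. \<exists>y\<in>Y. near 3 u y}"
  have vB: "v \<in> B" using A(3) Y(1) near_refl[of 3 v] unfolding B_def by blast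
  obtain x where x: "x \<in> X" "x \<notin> Y" using Y by auto
  obtain u where u: "u \<in> cl A" "near 3 x u" using cls x by auto
  have uL: "u \<in> L" using u cl_subset by auto
  obtain w where w: "w \<in> N u" using N_nonempty uL by blast
  then obtain a where a: "a \<in> A" "w \<in> N a" using u by (auto simp: cl_def NS_def)
  have "near 1 w a" using a A N_sym[of a w] by (intro near_N) auto
  then have "near (3 + (1 + 1)) x a"
    by (intro near_trans[OF u(2)] near_trans[OF near_N[OF w]])
  then have xa: "near 5 x a" by simp
  have ya: "near 3 y u" if "near 3 u y" "u \<in> A" for u y using near_sym[OF that(1)] that(2) A by auto
  have "a \<notin> B"
  proof
    assume "a \<in> B"
    then obtain y where y: "y \<in> Y" "near 3 a y" unfolding B_def by auto
    have "near (5 + 3) x y" by (rule near_trans[OF xa y(2)])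
    then have "near 8 x y" by simp
    then have "near 8 y x" by (rule near_sym) (use x X in auto)
    then show False using no x y by blast
  qed
  then obtain b a' where ba: "b \<in> B" "a' \<in> A - B" "N b \<inter> N a' \<noteq> {}"
  proof -
    have "B \<subseteq> A" "B \<noteq> {}" "B \<noteq> A" using vB a \<open>a \<notin> B\<close> unfolding B_def by auto
    then have "\<exists>x\<in>B. \<exists>y\<in>A - B. N x \<inter> N y \<noteq> {}" using A(2) unfolding linked_def by blast
    then show ?thesis using that by blast
  qed
  then obtain z where z: "z \<in> N b" "z \<in> N a'" by auto
  obtain y where y: "y \<in> Y" "near 3 y b" "b \<in> A" using ba ya unfolding B_def by blast
  obtain x' where x': "x' \<in> X" "near 3 a' x'" using cov ba by auto
  have "x' \<notin> Y" using x' ba unfolding B_def by auto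
  have "near 1 z a'" using z ba A N_sym[of a' z] by (intro near_N) auto
  then have "near (3 + (1 + (1 + 3))) y x'"
    by (intro near_trans[OF y(2)] near_trans[OF near_N[OF z(1)]] near_trans[OF _ x'(2)])
  then have "near 8 y x'" by simp
  then show False using no y(1) x'(1) \<open>x' \<notin> Y\<close> by blast
qed

end

section \<open>Containers\<close>

lemma sum_card_swap:
  assumes "finite X" "finite Y"
  shows "(\<Sum>x\<in>X. card {y \<in> Y. P x y}) = (\<Sum>y\<in>Y. card {x \<in> X. P x y})"
  unfolding card_eq_sum using assms by (rule sum.swap_restrict)

text \<open>Each chosen \<open>u\<close> covers more than \<open>\<psi>\<close> points of
  \<open>G\<close> that were still uncovered, which bounds the number of choices. The last clause
  later keeps the chosen vertices close to the cluster.\<close>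

lemma greedy_cover:
  assumes "finite G"
  shows "\<exists>U\<subseteq>C. finite U \<and> (\<forall>u\<in>C. card (M u \<inter> G - \<Union>(M ` U)) \<le> \<psi>) \<and> \<psi> * card U \<le> card G \<and>
    (\<forall>u\<in>U. M u \<inter> G \<noteq> {})"
  using assms
proof (induction G rule: finite_psubset_induct)
  case (psubset G)
  show ?case
  proof (cases "\<forall>u\<in>C. card (M u \<inter> G) \<le> \<psi>")
    case True
    then show ?thesis by (intro exI[of _ "{}"]) auto
  next
    case False
    then obtain u where u: "u \<in> C" "card (M u \<inter> G) > \<psi>" by auto
    then have ne: "M u \<inter> G \<noteq> {}" by auto
    then have "G - M u \<subset> G" by auto
    from psubset.IH[OF this] obtain U where U: "U \<subseteq> C" "finite U"
      "\<forall>x\<in>C. card (M x \<inter> (G - M u) - \<Union>(M ` U)) \<le> \<psi>" "\<psi> * card U \<le> card (G - M u)"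
      "\<forall>x\<in>U. M x \<inter> (G - M u) \<noteq> {}" by blast
    have "M x \<inter> (G - M u) - \<Union>(M ` U) = M x \<inter> G - \<Union>(M ` insert u U)" for x by auto
    then have 1: "\<forall>x\<in>C. card (M x \<inter> G - \<Union>(M ` insert u U)) \<le> \<psi>" using U(3) by simp
    have "card (insert u U) \<le> card U + 1" using U(2) by (simp add: card_insert_if)
    then have "\<psi> * card (insert u U) \<le> \<psi> * (card U + 1)" by (rule mult_le_mono2)
    also have "\<dots> \<le> card (G - M u) + card (M u \<inter> G)" using U u by simp
    also have "\<dots> = card G" using psubset.hyps
      by (metis Diff_disjoint Int_commute card_Un_disjoint Un_Diff_Int finite_Diff finite_Int Diff_Int2 Int_Diff inf.idem Diff_Int_distrib)
    finally show ?thesis using U u ne 1 by (intro exI[of _ "insert u U"]) auto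
  qed
qed

text \<open>
  The cost \<open>x w\<close> of a step is at most the fraction of \<open>Q\<close> that the step newly covers; this makes the
  total cost logarithmic and replaces the usual random choice of \<open>T\<close>.
\<close>

lemma weighted_greedy:
  fixes x :: "'b \<Rightarrow> real" and t :: real
  assumes "finite Q" "t > 0" "\<And>w. w \<in> G \<Longrightarrow> x w > 0"
    and "\<And>U. U \<subseteq> Q \<Longrightarrow> real (card U) > t \<Longrightarrow> \<exists>w\<in>G. real (card (U \<inter> M w)) \<ge> card U * x w"
  shows "\<exists>T\<subseteq>G. finite T \<and> card (Q - \<Union>(M ` T)) \<le> t \<and> sum x T \<le> 1 + max 0 (ln (card Q / t))"
  using assms(1,4)
proof (induction Q rule: finite_psubset_induct)
  case (psubset Q)
  show ?case
  proof (cases "card Q \<le> t")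
    case True
    then show ?thesis by (intro exI[of _ "{}"]) auto
  next
    case False
    then obtain w where w: "w \<in> G" "real (card (Q \<inter> M w)) \<ge> card Q * x w"
      using psubset.prems[of Q] by auto
    have cQ: "card Q > 0" using False assms(2) by linarith
    have xw: "x w > 0" using w assms(3) by auto
    have "card Q * x w > 0" using cQ xw by simp
    then have ne: "Q \<inter> M w \<noteq> {}" using w by auto
    have "real (card (Q \<inter> M w)) \<le> card Q" using psubset.hyps by (simp add: card_mono)
    then have "card Q * x w \<le> card Q" using w by simp
    then have x1: "x w \<le> 1" using cQ by (simp add: mult_le_cancel_left1)
    let ?Q = "Q - M w"
    have "card ?Q = card Q - card (Q \<inter> M w)" using psubset.hyps by (simp add: card_Diff_subset_Int)
    moreover have "card (Q \<inter> M w) \<le> card Q" using psubset.hyps by (simp add: card_mono)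
    ultimately have "real (card ?Q) = real (card Q) - real (card (Q \<inter> M w))" by simp
    then have "real (card ?Q) \<le> card Q * (1 - x w)" using w by (simp add: algebra_simps)
    \<comment> \<open>This is the accounting: a choice of cost \<open>x w\<close> lowers
      \<open>ln (card Q / t)\<close> by at least \<open>x w\<close>.\<close>
    also have "\<dots> \<le> card Q * exp (- x w)" using exp_ge_add_one_self[of "- x w"] by (intro mult_left_mono) auto
    finally have le: "real (card ?Q) \<le> card Q * exp (- x w)" .
    show ?thesis
    \<comment> \<open>The choice that crosses the threshold \<open>t\<close> cannot be charged to
      the logarithm; it costs at most 1, which is the summand 1 of the bound.\<close>
    proof (cases "card ?Q \<le> t")
      case True
      then show ?thesis using w x1 by (intro exI[of _ "{w}"]) auto
    next
      case F2: False
      have "?Q \<subset> Q" using ne by auto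
      have "\<exists>w\<in>G. real (card (U \<inter> M w)) \<ge> card U * x w" if "U \<subseteq> ?Q" "real (card U) > t" for U
        using psubset.prems[of U] that by blast
      from psubset.IH[OF \<open>?Q \<subset> Q\<close> this] obtain T where T: "T \<subseteq> G" "finite T"
        "card (?Q - \<Union>(M ` T)) \<le> t" "sum x T \<le> 1 + max 0 (ln (card ?Q / t))" by blast
      have "card ?Q / t \<le> card Q / t * exp (- x w)" using le assms(2) by (simp add: divide_right_mono)
      then have "ln (card ?Q / t) \<le> ln (card Q / t * exp (- x w))"
        using F2 assms(2) cQ by (subst ln_le_cancel_iff) (auto intro!: divide_pos_pos)
      also have "\<dots> = ln (card Q / t) - x w" using cQ assms(2) by (subst ln_mult) auto
      finally have 1: "ln (card ?Q / t) \<le> ln (card Q / t) - x w" .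
      have "ln (card ?Q / t) \<ge> 0" using F2 assms(2) by simp
      then have "sum x T + x w \<le> 1 + max 0 (ln (card Q / t))" using 1 T(4) by simp
      moreover have "sum x (insert w T) \<le> sum x T + x w"
        using T(2) xw by (simp add: sum.insert_if)
      moreover have "Q - \<Union>(M ` insert w T) = ?Q - \<Union>(M ` T)" by auto
      ultimately show ?thesis using T w by (intro exI[of _ "insert w T"]) auto
    qed
  qed
qed

context regular_bipartite
begin

text \<open>Count the \<open>d * card B\<close> edges at \<open>B\<close>: the vertex
  \<open>z\<close> receives \<open>card B\<close> of them, and every other vertex at most 2 by the
  codegree bound.\<close>

lemma card_second_nbhd:
  assumes z: "z \<in> R" and B: "B \<subseteq> N z" "d \<le> 2 * card B" and d2: "d \<ge> 2"
  shows "real d ^ 2 / 8 \<le> card (NS B)"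
proof -
  have BL: "B \<subseteq> L" using B N_R[OF z] by auto
  then have NSR: "NS B \<subseteq> R" by (rule NS_L)
  have finNS: "finite (NS B)" using NSR finite_R finite_subset by blast
  have finB: "finite B" using BL finite_L finite_subset by blast
  have "(\<Sum>b\<in>B. card (N b \<inter> NS B)) = (\<Sum>w\<in>NS B. card (N w \<inter> B))"
    using BL NSR by (intro double_count) auto
  moreover have "card (N b \<inter> NS B) = d" if "b \<in> B" for b
    using that BL card_N[of b] by (subst Int_absorb2) (auto simp: NS_def)
  ultimately have "card B * d = (\<Sum>w\<in>NS B. card (N w \<inter> B))" by simp
  also have "\<dots> \<le> (\<Sum>w\<in>NS B. 2 + (if w = z then card B else 0))"
  proof (intro sum_mono)
    fix w assume w: "w \<in> NS B"
    show "card (N w \<inter> B) \<le> 2 + (if w = z then card B else 0)"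
    proof (cases "w = z")
      case True
      have "card (N w \<inter> B) \<le> card B" using finB by (intro card_mono) auto
      then show ?thesis using True by simp
    next
      case False
      have "card (N w \<inter> B) \<le> card (N w \<inter> N z)"
        using B z finite_N[of z] by (intro card_mono) auto
      also have "\<dots> \<le> 2" using codegree[of w z] False w NSR z by auto
      finally show ?thesis by simp
    qed
  qed
  also have "\<dots> \<le> 2 * card (NS B) + card B" unfolding sum.distrib using finNS by (simp add: sum.delta')
  finally have "real (card B) * d \<le> 2 * card (NS B) + card B"
    using of_nat_mono by fastforce
  then have 1: "real (card B) * (real d - 1) \<le> 2 * card (NS B)" by (simp add: algebra_simps)
  have "(real d / 2) * (real d / 2) \<le> real (card B) * (real d - 1)"
    using B d2 by (intro mult_mono) (auto simp: field_simps)
  then show ?thesis using 1 by (simp add: power2_eq_square)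
qed

text \<open>Every edge at the closure ends in \<open>NS A\<close>, so exactly
  \<open>d * card (cl A)\<close> of the \<open>d * card (NS A)\<close> edges at \<open>NS A\<close>
  return to the closure. The remaining \<open>t * d\<close> edges are the budget against which all
  errors of the container are charged.\<close>

lemma sum_defect:
  assumes A: "A \<subseteq> L"
  shows "(\<Sum>w\<in>NS A. real (card (N w - cl A))) = (real (card (NS A)) - card (cl A)) * d"
proof -
  let ?C = "cl A" and ?G = "NS A"
  have GR: "?G \<subseteq> R" using A by (rule NS_L)
  have "(\<Sum>w\<in>?G. card (N w \<inter> ?C)) = (\<Sum>u\<in>?C. card (N u \<inter> ?G))"
    using GR cl_subset by (intro double_count) auto
  moreover have "card (N u \<inter> ?G) = d" if "u \<in> ?C" for u
    using that card_N[of u] by (subst Int_absorb2) (auto simp: cl_def)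
  ultimately have 1: "(\<Sum>w\<in>?G. card (N w \<inter> ?C)) = card ?C * d" by simp
  have "(\<Sum>w\<in>?G. card (N w - ?C)) + (\<Sum>w\<in>?G. card (N w \<inter> ?C)) = (\<Sum>w\<in>?G. d)"
    unfolding sum.distrib[symmetric]
  proof (intro sum.cong refl)
    fix w assume "w \<in> ?G"
    then have "finite (N w)" "card (N w) = d" using GR finite_N[of w] card_N[of w] by auto
    then show "card (N w - ?C) + card (N w \<inter> ?C) = d"
      by (metis add.commute card_Int_Diff)
  qed
  then have "real (\<Sum>w\<in>?G. card (N w - ?C)) + real (card ?C * d) = real (card ?G * d)"
    unfolding 1 of_nat_add[symmetric] by simp
  then show ?thesis by (simp add: algebra_simps)
qed

text \<open>A vertex \<open>w\<close> of \<open>NS A\<close> covers the vertices reachable from it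
  through the closure. Choosing \<open>w\<close> costs one element of \<open>T\<close> and puts its
  neighbours outside the closure into \<open>NS T - cl A\<close>; both costs are controlled together
  by a weighted greedy choice.\<close>

lemma stage_one:
  fixes A and t :: real defines "t \<equiv> real (card (NS A)) - card (cl A)"
  assumes A: "A \<subseteq> L" and t: "t > 0" "card (NS A) \<le> 2 * real d * t" and d2: "d \<ge> 2"
  shows "\<exists>T\<subseteq>NS A. card (NS A - NS (NS T \<inter> cl A)) \<le> 3 * t \<and>
    (card T + card (NS T - cl A)) * real d \<le> 32 * t * (1 + ln (2 * real d))"
proof -
  let ?C = "cl A" and ?G = "NS A"
  let ?g = "real (card ?G)"
  have GR: "?G \<subseteq> R" using A by (rule NS_L)
  have finG: "finite ?G" using GR finite_R finite_subset by blast
  have g: "?g > 0" using t(1) by (simp add: t_def)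
  define def where "def w = real (card (N w - ?C))" for w
  define M where "M w = NS (N w \<inter> ?C)" for w
  define Q where "Q = {w \<in> ?G. d \<le> 2 * card (N w \<inter> ?C)}"
  \<comment> \<open>The two summands price \<open>card T\<close> and the number of neighbours
    outside the closure. Each sums to \<open>d ^ 2 / 16\<close> over \<open>NS A\<close>, the second
    by \<open>sum_defect\<close>. Every \<open>z\<close> in \<open>Q\<close> is covered by at least
    \<open>d ^ 2 / 8\<close> vertices \<open>w\<close>, so by averaging some \<open>w\<close> covers
    at least its share \<open>x w\<close> of any \<open>U \<subseteq> Q\<close>.\<close>
  define x where "x w = real d ^ 2 / (16 * ?g) + d * def w / (16 * t)" for w
  have sumdef: "sum def ?G = t * d" unfolding def_def t_def by (rule sum_defect[OF A])
  have def0: "def w \<ge> 0" for w by (simp add: def_def)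
  have finQ: "finite Q" using finG by (simp add: Q_def)
  have "\<exists>T\<subseteq>?G. finite T \<and> card (Q - \<Union>(M ` T)) \<le> t \<and> sum x T \<le> 1 + max 0 (ln (card Q / t))"
  proof (rule weighted_greedy[OF finQ t(1)])
    show "x w > 0" for w unfolding x_def using g d_pos t def0[of w]
      by (intro add_pos_nonneg) auto
  next
    fix U assume U: "U \<subseteq> Q" "real (card U) > t"
    have finU: "finite U" using U finQ finite_subset by blast
    have cU: "real (card U) > 0" using U t by simp
    have MG: "M w \<subseteq> ?G" for w unfolding M_def by (auto simp: NS_def cl_def)
    have sym: "z \<in> M w \<longleftrightarrow> w \<in> M z" if "z \<in> ?G" "w \<in> ?G" for z w
    proof -
      have "z \<in> M w \<longleftrightarrow> (\<exists>u\<in>?C. u \<in> N w \<and> z \<in> N u)" by (auto simp: M_def NS_def)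
      also have "\<dots> \<longleftrightarrow> (\<exists>u\<in>?C. u \<in> N z \<and> w \<in> N u)"
        using that GR cl_subset[of A] N_sym[of z] N_sym[of w] N_sym by blast
      also have "\<dots> \<longleftrightarrow> w \<in> M z" by (auto simp: M_def NS_def)
      finally show ?thesis .
    qed
    show "\<exists>w\<in>?G. real (card (U \<inter> M w)) \<ge> card U * x w"
    proof (rule ccontr)
      assume "\<not> ?thesis"
      then have less: "real (card (U \<inter> M w)) < card U * x w" if "w \<in> ?G" for w using that by force
      have "card U * (real d ^ 2 / 8) \<le> (\<Sum>z\<in>U. real (card (M z)))"
      proof -
        have "real d ^ 2 / 8 \<le> card (M z)" if "z \<in> U" for z
          unfolding M_def using that U GR d2 by (intro card_second_nbhd[of z]) (auto simp: Q_def)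
        then have "(\<Sum>z\<in>U. real d ^ 2 / 8) \<le> (\<Sum>z\<in>U. real (card (M z)))" by (intro sum_mono)
        then show ?thesis by simp
      qed
      also have "(\<Sum>z\<in>U. real (card (M z))) = real (\<Sum>z\<in>U. card {w \<in> ?G. z \<in> M w})"
      proof -
        have "{w \<in> ?G. z \<in> M w} = M z" if "z \<in> U" for z
          using that U sym MG[of z] by (auto simp: Q_def)
        then show ?thesis by simp
      qed
      also have "\<dots> = real (\<Sum>w\<in>?G. card {z \<in> U. z \<in> M w})"
        by (subst sum_card_swap[OF finU finG]) simp
      also have "\<dots> = (\<Sum>w\<in>?G. real (card (U \<inter> M w)))" by (simp add: Int_def)
      also have "\<dots> < (\<Sum>w\<in>?G. card U * x w)"
        using finG g less by (intro sum_strict_mono) auto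
      also have "\<dots> = card U * (?g * (real d ^ 2 / (16 * ?g)) + d * (sum def ?G) / (16 * t))"
        by (simp add: sum_distrib_left[symmetric] x_def sum.distrib sum_divide_distrib[symmetric])
      also have "\<dots> = card U * (real d ^ 2 / 8)"
        using g t unfolding sumdef by (simp add: field_simps power2_eq_square)
      finally show False by simp
    qed
  qed
  then obtain T where T: "T \<subseteq> ?G" "finite T" "card (Q - \<Union>(M ` T)) \<le> t"
    "sum x T \<le> 1 + max 0 (ln (card Q / t))" by blast
  have UM: "\<Union>(M ` T) = NS (NS T \<inter> ?C)" by (auto simp: M_def NS_def)
  \<comment> \<open>A vertex outside \<open>Q\<close> spends at least \<open>d / 2\<close> of the
    budget \<open>t * d\<close>, so there are at most \<open>2 * t\<close> of them; with at most
    \<open>t\<close> uncovered vertices of \<open>Q\<close> this makes \<open>3 * t\<close>.\<close>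
  have "card (?G - Q) * (real d / 2) \<le> (\<Sum>w\<in>?G - Q. def w)"
  proof -
    have "real d / 2 \<le> def w" if "w \<in> ?G - Q" for w
    proof -
      have "card (N w) = d" "finite (N w)" using that GR card_N[of w] finite_N[of w] by auto
      then have "card (N w - ?C) + card (N w \<inter> ?C) = d" by (metis add.commute card_Int_Diff)
      moreover have "2 * card (N w \<inter> ?C) < d" using that by (auto simp: Q_def)
      ultimately have "d \<le> 2 * card (N w - ?C)" by linarith
      then show ?thesis unfolding def_def by linarith
    qed
    then have "(\<Sum>w\<in>?G - Q. real d / 2) \<le> (\<Sum>w\<in>?G - Q. def w)" by (intro sum_mono)
    then show ?thesis by simp
  qed
  also have "\<dots> \<le> sum def ?G" using finG def0 by (intro sum_mono2) auto
  also have "\<dots> = t * d" by (rule sumdef)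
  finally have GQ: "card (?G - Q) \<le> 2 * t" using d_pos by (simp add: field_simps)
  have "?G - NS (NS T \<inter> ?C) \<subseteq> (?G - Q) \<union> (Q - \<Union>(M ` T))" using UM by auto
  then have "card (?G - NS (NS T \<inter> ?C)) \<le> card ((?G - Q) \<union> (Q - \<Union>(M ` T)))"
    using finG finQ by (intro card_mono) auto
  also have "\<dots> \<le> card (?G - Q) + card (Q - \<Union>(M ` T))" by (rule card_Un_le)
  finally have "real (card (?G - NS (NS T \<inter> ?C))) \<le> card (?G - Q) + card (Q - \<Union>(M ` T))" by linarith
  then have c1: "card (?G - NS (NS T \<inter> ?C)) \<le> 3 * t" using GQ T(3) by linarith
  have d1: "real d \<ge> 2" using d2 by simp
  have "card Q \<le> card ?G" using finG by (intro card_mono) (auto simp: Q_def)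
  then have "card Q / t \<le> 2 * d" using t by (simp add: field_simps)
  then have "max 0 (ln (card Q / t)) \<le> ln (2 * real d)"
    using d1 t by (cases "card Q = 0") auto
  then have sx: "sum x T \<le> 1 + ln (2 * real d)" using T(4) by linarith
  have "card (NS T - ?C) \<le> (\<Sum>w\<in>T. card (N w - ?C))"
  proof -
    have "NS T - ?C = (\<Union>w\<in>T. N w - ?C)" by (auto simp: NS_def)
    then show ?thesis using card_UN_le[OF T(2), of "\<lambda>w. N w - ?C"] by (simp only:)
  qed
  then have Dl: "real (card (NS T - ?C)) \<le> sum def T" 
    using of_nat_mono[where 'a=real] unfolding def_def of_nat_sum[symmetric] by blast
  \<comment> \<open>The hypothesis \<open>card (NS A) \<le> 2 * d * t\<close> makes the price of an
    element of \<open>T\<close> at least \<open>d / (32 * t)\<close>, so one bound on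
    \<open>sum x T\<close> limits both sets.\<close>
  have "?g * d \<le> 2 * real d * t * d" using t(2) by (intro mult_right_mono) auto
  then have b: "real d / (32 * t) \<le> real d ^ 2 / (16 * ?g)" using g t d_pos
    by (simp add: field_simps power2_eq_square)
  have "(card T + card (NS T - ?C)) * (real d / (32 * t)) =
      card T * (real d / (32 * t)) + card (NS T - ?C) * (real d / (32 * t))"
    by (simp only: of_nat_add distrib_right)
  also have "\<dots> \<le> card T * (real d ^ 2 / (16 * ?g)) + sum def T * (real d / (16 * t))"
  proof (intro add_mono mult_mono b Dl)
    show "real d / (32 * t) \<le> real d / (16 * t)" using t by (simp add: field_simps)
  qed (use t def0 in \<open>auto intro!: sum_nonneg\<close>)
  also have "\<dots> = sum x T" unfolding x_def sum.distrib
    by (simp add: sum_distrib_left[symmetric] sum_divide_distrib[symmetric] mult.commute)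
  also note sx
  finally have "(card T + card (NS T - ?C)) * real d \<le> 32 * t * (1 + ln (2 * real d))"
    using t by (simp add: field_simps)
  then show ?thesis using T c1 by blast
qed

text \<open>
  The container is decoded from the sets \<open>T\<close>, \<open>\<Delta>\<close>, \<open>U\<close>, \<open>W\<close>. For a set \<open>A\<close> with neighbourhood \<open>G\<close>,
  \<open>F1 \<subseteq> F2 \<subseteq> G\<close> approximate \<open>G\<close> from below and \<open>S1 \<supseteq> S2 \<supseteq> cl A\<close> approximate the closure from above.
  Here \<open>\<Delta> = NS T - cl A\<close>, which turns \<open>NS T - \<Delta>\<close> into \<open>NS T \<inter> cl A\<close> without reference to \<open>A\<close>.
\<close>

definition F1 :: "'a set \<Rightarrow> 'a set \<Rightarrow> 'a set \<Rightarrow> 'a set" where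
  "F1 T \<Delta> U = NS (NS T - \<Delta>) \<union> NS U"

definition S1 :: "nat \<Rightarrow> 'a set \<Rightarrow> 'a set \<Rightarrow> 'a set \<Rightarrow> 'a set" where
  "S1 \<psi> T \<Delta> U = {u \<in> L. card (N u - F1 T \<Delta> U) \<le> \<psi>}"

definition S2 :: "nat \<Rightarrow> 'a set \<Rightarrow> 'a set \<Rightarrow> 'a set \<Rightarrow> 'a set \<Rightarrow> 'a set" where
  "S2 \<psi> T \<Delta> U W = S1 \<psi> T \<Delta> U - NS W"

definition F2 :: "nat \<Rightarrow> 'a set \<Rightarrow> 'a set \<Rightarrow> 'a set \<Rightarrow> 'a set \<Rightarrow> 'a set" where
  "F2 \<psi> T \<Delta> U W = F1 T \<Delta> U \<union> {w \<in> R. card (N w \<inter> S2 \<psi> T \<Delta> U W) > \<psi>}"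

text \<open>Vertices are added to \<open>U\<close> until every vertex of the closure has at most
  \<open>\<psi>\<close> neighbours outside \<open>F1\<close>, so the closure lies in
  \<open>S1\<close>. A vertex of \<open>S1\<close> sends at least \<open>d / 2\<close> edges into
  \<open>NS A\<close>, so by \<open>sum_defect\<close> at most \<open>2 * t\<close> of them lie
  outside the closure. Then vertices outside \<open>NS A\<close> are added to \<open>W\<close> until
  none of them has more than \<open>\<psi>\<close> neighbours in \<open>S2\<close>, so that
  \<open>F2\<close> stays inside \<open>NS A\<close>.\<close>

lemma container:
  fixes A and t :: real defines "t \<equiv> real (card (NS A)) - card (cl A)"
  assumes A: "A \<subseteq> L" and t: "t > 0" "card (NS A) \<le> 2 * real d * t" and d2: "d \<ge> 2"
    and \<psi>: "2 * \<psi> \<le> d"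
  shows "\<exists>T U W \<Delta>. T \<subseteq> NS A \<and> \<Delta> = NS T - cl A \<and> U \<subseteq> cl A \<and> W \<subseteq> R - NS A \<and>
    (\<forall>w\<in>W. N w \<inter> S1 \<psi> T \<Delta> U \<noteq> {}) \<and>
    (card T + card \<Delta>) * real d \<le> 32 * t * (1 + ln (2 * real d)) \<and>
    \<psi> * card U \<le> 3 * t \<and> \<psi> * card W \<le> 2 * t \<and>
    cl A \<subseteq> S2 \<psi> T \<Delta> U W \<and> F1 T \<Delta> U \<subseteq> NS A \<and> F2 \<psi> T \<Delta> U W \<subseteq> NS A \<and>
    d * card (S2 \<psi> T \<Delta> U W) \<le> d * card (F2 \<psi> T \<Delta> U W) + 5 * t * \<psi>"
proof -
  let ?C = "cl A" and ?G = "NS A"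
  have GR: "?G \<subseteq> R" using A by (rule NS_L)
  have finG: "finite ?G" using GR finite_R finite_subset by blast
  have NC: "N u \<subseteq> ?G" if "u \<in> ?C" for u using that by (auto simp: cl_def)
  obtain T where T: "T \<subseteq> ?G" "card (?G - NS (NS T \<inter> ?C)) \<le> 3 * t"
    "(card T + card (NS T - ?C)) * real d \<le> 32 * t * (1 + ln (2 * real d))"
    using stage_one[OF A] t d2 unfolding t_def by blast
  define \<Delta> where "\<Delta> = NS T - ?C"
  define F0 where "F0 = NS (NS T - \<Delta>)"
  have F0: "F0 = NS (NS T \<inter> ?C)" unfolding F0_def \<Delta>_def by (rule arg_cong[of _ _ NS]) auto
  have "finite (?G - F0)" using finG by auto
  from greedy_cover[OF this, of ?C N \<psi>]
  obtain U where U: "U \<subseteq> ?C" "\<forall>u\<in>?C. card (N u \<inter> (?G - F0) - \<Union>(N ` U)) \<le> \<psi>"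
    "\<psi> * card U \<le> card (?G - F0)" by blast
  let ?F1 = "F1 T \<Delta> U" and ?S1 = "S1 \<psi> T \<Delta> U"
  have F1: "?F1 = F0 \<union> NS U" by (simp add: F1_def F0_def)
  have F1G: "?F1 \<subseteq> ?G" unfolding F1 F0 NS_def[of U] NS_def[of "NS T \<inter> ?C"] using U(1) NC by blast
  have CF1: "card (N u - ?F1) \<le> \<psi>" if "u \<in> ?C" for u
  proof -
    have "N u - ?F1 = N u \<inter> (?G - F0) - \<Union>(N ` U)" using NC[OF that] unfolding F1 NS_def by auto
    then show ?thesis using U(2) that by simp
  qed
  have CS1: "?C \<subseteq> ?S1" using CF1 cl_subset by (auto simp: S1_def)
  have S1L: "?S1 \<subseteq> L" by (auto simp: S1_def)
  have finS1: "finite ?S1" using S1L finite_L finite_subset by blast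
  have "real (card (?S1 - ?C)) * (real d / 2) \<le> (\<Sum>u\<in>?S1 - ?C. real (card (N u \<inter> ?G)))"
  proof -
    have "real d / 2 \<le> card (N u \<inter> ?G)" if "u \<in> ?S1 - ?C" for u
    proof -
      have fin: "finite (N u)" and c: "card (N u) = d" and le: "card (N u - ?F1) \<le> \<psi>"
        using that finite_N[of u] card_N[of u] by (auto simp: S1_def)
      have "card (N u \<inter> ?F1) + card (N u - ?F1) = d" using fin c by (metis card_Int_Diff)
      moreover have "card (N u \<inter> ?F1) \<le> card (N u \<inter> ?G)" using fin F1G by (intro card_mono) auto
      ultimately have "d \<le> card (N u \<inter> ?G) + \<psi>" using le by linarith
      then show ?thesis using \<psi> by linarith
    qed
    then have "(\<Sum>u\<in>?S1 - ?C. real d / 2) \<le> (\<Sum>u\<in>?S1 - ?C. real (card (N u \<inter> ?G)))"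
      by (intro sum_mono)
    then show ?thesis by simp
  qed
  also have "\<dots> = real (\<Sum>u\<in>?S1 - ?C. card (N u \<inter> ?G))" by simp
  also have "(\<Sum>u\<in>?S1 - ?C. card (N u \<inter> ?G)) = (\<Sum>w\<in>?G. card (N w \<inter> (?S1 - ?C)))"
    using S1L GR by (intro double_count) auto
  also have "real \<dots> \<le> (\<Sum>w\<in>?G. real (card (N w - ?C)))"
  proof -
    have "card (N w \<inter> (?S1 - ?C)) \<le> card (N w - ?C)" if "w \<in> ?G" for w
      using that GR finite_N[of w] by (intro card_mono) auto
    then show ?thesis unfolding of_nat_sum by (intro sum_mono) auto
  qed
  also have "\<dots> = t * d" unfolding t_def by (rule sum_defect[OF A])
  finally have S1C: "card (?S1 - ?C) \<le> 2 * t" using d_pos by (simp add: field_simps)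
  have "finite (?S1 - ?C)" using finS1 by auto
  from greedy_cover[OF this, of "R - ?G" N \<psi>]
  obtain W where W: "W \<subseteq> R - ?G" "\<forall>w\<in>R - ?G. card (N w \<inter> (?S1 - ?C) - \<Union>(N ` W)) \<le> \<psi>"
    "\<psi> * card W \<le> card (?S1 - ?C)" "\<forall>w\<in>W. N w \<inter> (?S1 - ?C) \<noteq> {}" by blast
  let ?S2 = "S2 \<psi> T \<Delta> U W" and ?F2 = "F2 \<psi> T \<Delta> U W"
  have NwC: "N w \<inter> ?C = {}" if "w \<in> R - ?G" for w
  proof (rule ccontr)
    assume "\<not> ?thesis"
    then obtain u where "u \<in> N w" "u \<in> ?C" by auto
    then have "w \<in> N u" using that N_sym[of w u] by auto
    then show False using NC[OF \<open>u \<in> ?C\<close>] that by auto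
  qed
  have CS2: "?C \<subseteq> ?S2" using CS1 NwC W(1) by (auto simp: S2_def NS_def)
  have S2S1: "?S2 \<subseteq> ?S1" by (auto simp: S2_def)
  have NwS2: "card (N w \<inter> ?S2) \<le> \<psi>" if "w \<in> R - ?G" for w
  proof -
    have "N w \<inter> ?S2 = N w \<inter> (?S1 - ?C) - \<Union>(N ` W)" using NwC[OF that] unfolding S2_def NS_def by auto
    then show ?thesis using W(2) that by simp
  qed
  have F2G: "?F2 \<subseteq> ?G" using F1G NwS2 unfolding F2_def by fastforce
  have F12: "?F1 \<subseteq> ?F2" by (auto simp: F2_def)
  have finS2: "finite ?S2" using S2S1 finS1 finite_subset by blast
  have S2L: "?S2 \<subseteq> L" using S2S1 S1L by auto
  have finF2: "finite ?F2" using F2G finG finite_subset by blast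
  \<comment> \<open>Count the edges at \<open>S2\<close> by their other end. A vertex of
    \<open>F2\<close> receives at most \<open>d\<close>, each of the at most \<open>3 * t\<close>
    vertices of \<open>NS A - F2\<close> at most \<open>\<psi>\<close>. Edges leaving
    \<open>NS A\<close> start at one of the at most \<open>2 * t\<close> vertices outside the
    closure, at most \<open>\<psi>\<close> from each. This is the term
    \<open>5 * t * \<psi>\<close>.\<close>
  have "d * card ?S2 = (\<Sum>u\<in>?S2. card (N u))" using S2L card_N by (simp add: subset_iff)
  also have "\<dots> \<le> (\<Sum>u\<in>?S2. card (N u \<inter> ?F2) + card (N u \<inter> (?G - ?F2)) + card (N u - ?G))"
  proof (intro sum_mono)
    fix u assume "u \<in> ?S2"
    have "N u \<subseteq> (N u \<inter> ?F2) \<union> (N u \<inter> (?G - ?F2)) \<union> (N u - ?G)" by auto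
    then have "card (N u) \<le> card ((N u \<inter> ?F2) \<union> (N u \<inter> (?G - ?F2)) \<union> (N u - ?G))"
      using \<open>u \<in> ?S2\<close> S2L finite_N[of u] by (intro card_mono) auto
    also have "\<dots> \<le> card (N u \<inter> ?F2) + card (N u \<inter> (?G - ?F2)) + card (N u - ?G)"
      by (meson card_Un_le order_trans add_le_mono1)
    finally show "card (N u) \<le> card (N u \<inter> ?F2) + card (N u \<inter> (?G - ?F2)) + card (N u - ?G)" .
  qed
  also have "\<dots> = (\<Sum>u\<in>?S2. card (N u \<inter> ?F2)) + (\<Sum>u\<in>?S2. card (N u \<inter> (?G - ?F2)))
      + (\<Sum>u\<in>?S2. card (N u - ?G))" by (simp add: sum.distrib)
  also have "(\<Sum>u\<in>?S2. card (N u \<inter> ?F2)) = (\<Sum>w\<in>?F2. card (N w \<inter> ?S2))"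
    using S2L F2G GR by (intro double_count) auto
  also have "(\<Sum>u\<in>?S2. card (N u \<inter> (?G - ?F2))) = (\<Sum>w\<in>?G - ?F2. card (N w \<inter> ?S2))"
    using S2L F2G GR by (intro double_count) auto
  finally have "d * card ?S2 \<le> (\<Sum>w\<in>?F2. card (N w \<inter> ?S2)) + (\<Sum>w\<in>?G - ?F2. card (N w \<inter> ?S2))
      + (\<Sum>u\<in>?S2. card (N u - ?G))" .
  moreover have "(\<Sum>w\<in>?F2. card (N w \<inter> ?S2)) \<le> (\<Sum>w\<in>?F2. d)"
  proof (intro sum_mono)
    fix w assume "w \<in> ?F2"
    then have "w \<in> R" using F2G GR by auto
    then show "card (N w \<inter> ?S2) \<le> d" using card_N[of w] finite_N[of w] card_mono[of "N w" "N w \<inter> ?S2"] by auto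
  qed
  moreover have "(\<Sum>w\<in>?G - ?F2. card (N w \<inter> ?S2)) \<le> (\<Sum>w\<in>?G - ?F2. \<psi>)"
    using GR by (intro sum_mono) (auto simp: F2_def not_less)
  moreover have "(\<Sum>u\<in>?S2. card (N u - ?G)) \<le> card (?S1 - ?C) * \<psi>"
  proof -
    have "(\<Sum>u\<in>?S2. card (N u - ?G)) = (\<Sum>u\<in>?S2 - ?C. card (N u - ?G))"
    proof (intro sum.mono_neutral_right)
      show "\<forall>u\<in>?S2 - (?S2 - ?C). card (N u - ?G) = 0" using NC by (simp add: Diff_eq_empty_iff[THEN iffD2])
    qed (use finS2 in auto)
    also have "\<dots> \<le> (\<Sum>u\<in>?S1 - ?C. card (N u - ?G))"
      using finS1 S2S1 by (intro sum_mono2) auto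
    also have "\<dots> \<le> (\<Sum>u\<in>?S1 - ?C. \<psi>)"
    proof (intro sum_mono)
      fix u assume u: "u \<in> ?S1 - ?C"
      have "card (N u - ?G) \<le> card (N u - ?F1)" using u S1L finite_N[of u] F1G by (intro card_mono) auto
      then show "card (N u - ?G) \<le> \<psi>" using u by (auto simp: S1_def)
    qed
    finally show ?thesis by simp
  qed
  ultimately have "d * card ?S2 \<le> d * card ?F2 + card (?G - ?F2) * \<psi> + card (?S1 - ?C) * \<psi>"
    by (simp add: mult.commute)
  then have "real (d * card ?S2) \<le> real (d * card ?F2 + card (?G - ?F2) * \<psi> + card (?S1 - ?C) * \<psi>)"
    by (rule of_nat_mono)
  then have "d * card ?S2 \<le> d * real (card ?F2) + real (card (?G - ?F2)) * \<psi> + real (card (?S1 - ?C)) * \<psi>"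
    by simp
  also have "\<dots> \<le> d * real (card ?F2) + (3 * t) * \<psi> + (2 * t) * \<psi>"
  proof (intro add_mono mult_right_mono S1C order_refl)
    have "card (?G - ?F2) \<le> card (?G - F0)" using finG F12 F1 by (intro card_mono) auto
    then show "real (card (?G - ?F2)) \<le> 3 * t" using T(2) unfolding F0 by linarith
  qed auto
  also have "\<dots> = d * card ?F2 + 5 * t * \<psi>" by (simp add: algebra_simps)
  finally have fin: "d * card ?S2 \<le> d * card ?F2 + 5 * t * \<psi>" .
  have Uc: "\<psi> * card U \<le> 3 * t" using of_nat_mono[OF U(3), where 'a=real] T(2) unfolding F0 by linarith
  have Wc: "\<psi> * card W \<le> 2 * t" using of_nat_mono[OF W(3), where 'a=real] S1C by linarith
  have Wn: "\<forall>w\<in>W. N w \<inter> ?S1 \<noteq> {}" using W(4) by blast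
  have Tc: "(card T + card \<Delta>) * real d \<le> 32 * t * (1 + ln (2 * real d))"
    using T(3) unfolding \<Delta>_def .
  show ?thesis
    by (rule exI[of _ T], rule exI[of _ U], rule exI[of _ W], rule exI[of _ \<Delta>])
      (intro conjI T(1) \<Delta>_def U(1) W(1) Wn Tc Uc Wc CS2 F1G F2G fin)
qed

end

section \<open>Sums over linked sets\<close>

context regular_bipartite
begin

lemma near_N': "y \<in> N x \<Longrightarrow> x \<in> L \<union> R \<Longrightarrow> near 1 y x"
  using near_sym[OF near_N] by blast

lemma near_step: "y \<in> N x \<Longrightarrow> near k y z \<Longrightarrow> near (Suc k) x z"
  using near_trans[OF near_N, of y x k z] by simp

lemma near_step': "y \<in> N x \<Longrightarrow> x \<in> L \<union> R \<Longrightarrow> near k x z \<Longrightarrow> near (Suc k) y z"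
  using near_trans[OF near_N', of y x k z] by simp

text \<open>The set is its own container: the walk visits \<open>A\<close> by \<open>s - 1\<close>
  detours of \<open>2 * 8\<close> steps, and label 0 marks its elements. The cost per vertex is a
  fixed power of \<open>d\<close>, affordable only for clusters that expand by much more than a
  constant factor.\<close>

lemma connected_sum_bound:
  fixes l :: real
  assumes v: "v \<in> L" and l: "l \<ge> 0" and s: "s > 0"
    and \<A>: "\<And>A. A \<in> \<A> \<Longrightarrow> A \<subseteq> L \<and> linked A \<and> v \<in> A \<and> card A = s"
  shows "(\<Sum>A\<in>\<A>. l ^ card A) \<le> (32 * (real d + 1)) ^ (16 * (s - 1) + 1) * (1 + l) ^ s"
proof (rule decoding_bound[where v = v and D = "\<lambda>Y. {x \<in> L. (x, 0) \<in> Y}"])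
  show "v \<in> L \<union> R" using v by simp
  show "l \<ge> 0" by fact
  show "finite {x \<in> L. (x, 0) \<in> Y}" for Y :: "('a \<times> nat) set" using finite_L by simp
  fix A assume "A \<in> \<A>"
  then have A: "A \<subseteq> L" "linked A" "v \<in> A" "card A = s" using \<A> by auto
  have "\<exists>ws\<in>walks v (2 * 8 * (s - 1)). card A \<le> Suc (s - 1) \<longrightarrow> A \<subseteq> set ws"
  proof (rule covering_walk)
    fix Y assume "v \<in> Y" "Y \<subset> A"
    then show "\<exists>y\<in>Y. \<exists>x\<in>A - Y. near 8 y x"
      using A near_refl subset_cl[OF A(1)] by (intro linked_near[of A v A]) blast+
  qed (use A in auto)
  then obtain ws where ws: "ws \<in> walks v (16 * (s - 1))" "A \<subseteq> set ws" using A(4) s by auto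
  have "{x \<in> L. (x, 0::nat) \<in> A \<times> {0}} = A" using A(1) by auto
  then show "\<exists>ws\<in>walks v (16 * (s - 1)). \<exists>Y\<subseteq>set ws \<times> {..<5::nat}. A \<subseteq> {x \<in> L. (x, 0) \<in> Y} \<and>
      card {x \<in> L. (x, 0) \<in> Y} \<le> s"
    using ws A(4) by (intro bexI[OF _ ws(1)] exI[of _ "A \<times> {0}"]) auto
qed

definition label :: "nat \<Rightarrow> ('a \<times> nat) set \<Rightarrow> 'a set" where
  "label i Y = {x. (x, i) \<in> Y}"

text \<open>
  The first summand collects the sets whose approximation \<open>F2\<close> misses at least \<open>\<gamma> t\<close> vertices of the
  neighbourhood, so that the container \<open>S2\<close> is small. For the others the missing vertices are
  listed as well, under label 4, and the closure itself is the container.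
\<close>

lemma container_sum_bound:
  fixes l \<gamma> t B y :: real and a g \<psi> :: nat
  defines "t \<equiv> real g - real a" and "B \<equiv> 32 * (real d + 1)"
  defines "y \<equiv> 32 * t * (1 + ln (2 * real d)) / d + 5 * t / \<psi>"
  assumes v: "v \<in> L" and l: "l \<ge> 0" and t: "t > 0" "g \<le> 2 * real d * t" and d2: "d \<ge> 2"
    and \<psi>: "2 * \<psi> \<le> d" "\<psi> > 0" and \<gamma>: "0 \<le> \<gamma>" "\<gamma> \<le> 1"
    and \<A>: "\<And>A. A \<in> \<A> \<Longrightarrow> A \<subseteq> L \<and> linked A \<and> v \<in> A \<and> card (cl A) = a \<and> card (NS A) = g"
  shows "(\<Sum>A\<in>\<A>. l ^ card A) \<le>
    B powr (16 * y + 1) * (1 + l) powr (g - \<gamma> * t + 5 * t * \<psi> / d) +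
    B powr (16 * (y + \<gamma> * t) + 1) * (1 + l) powr a"
proof -
  define D1 where "D1 Y = S2 \<psi> (label 0 Y) (label 1 Y) (label 2 Y) (label 3 Y)" for Y
  define D2 where "D2 Y = {u \<in> L. N u \<subseteq> F2 \<psi> (label 0 Y) (label 1 Y) (label 2 Y) (label 3 Y) \<union> label 4 Y}" for Y
  define n1 where "n1 = nat \<lfloor>y\<rfloor>"
  define n2 where "n2 = nat \<lfloor>y + \<gamma> * t\<rfloor>"
  define x where "x = g - \<gamma> * t + 5 * t * \<psi> / d"
  define m1 where "m1 = nat \<lfloor>x\<rfloor>"
  define P where "P n D m A \<longleftrightarrow> (\<exists>ws\<in>walks v n. \<exists>Y. Y \<subseteq> set ws \<times> {..<5::nat} \<and> A \<subseteq> D Y \<and> card (D Y) \<le> m)"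
    for n :: nat and D and m :: nat and A :: "'a set"
  have fin1: "finite (D1 Y)" for Y
    by (rule finite_subset[OF _ finite_L]) (auto simp: D1_def S2_def S1_def)
  have fin2: "finite (D2 Y)" for Y
    by (rule finite_subset[OF _ finite_L]) (auto simp: D2_def)
  have y0: "y \<ge> 0" unfolding y_def using t d2 by (intro add_nonneg_nonneg divide_nonneg_nonneg mult_nonneg_nonneg) auto
  have gt0: "\<gamma> * t \<ge> 0" using \<gamma> t by simp
  have "\<gamma> * t \<le> 1 * t" using \<gamma> t by (intro mult_right_mono) auto
  then have "real g - \<gamma> * t \<ge> 0" by (simp add: t_def)
  then have x0: "x \<ge> 0" unfolding x_def using t by simp
  have B1: "B \<ge> 1" by (simp add: B_def)
  have main: "P (16 * n1) D1 m1 A \<or> P (16 * n2) D2 a A" if "A \<in> \<A>" for A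
  proof -
    have A: "A \<subseteq> L" "linked A" "v \<in> A" and ca: "card (cl A) = a" and cg: "card (NS A) = g"
      using \<A>[OF that] by auto
    let ?C = "cl A" and ?G = "NS A"
    have GR: "?G \<subseteq> R" using A(1) by (rule NS_L)
    have finG: "finite ?G" using GR finite_R finite_subset by blast
    have "real (card ?G) - card ?C > 0" "card ?G \<le> 2 * real d * (real (card ?G) - card ?C)"
      using t unfolding t_def ca cg by auto
    from container[OF A(1) this d2 \<psi>(1)] obtain T U W \<Delta> where
      T: "T \<subseteq> ?G" and \<Delta>: "\<Delta> = NS T - ?C" and U: "U \<subseteq> ?C" and W: "W \<subseteq> R - ?G"
      "\<forall>w\<in>W. N w \<inter> S1 \<psi> T \<Delta> U \<noteq> {}" and cT: "(card T + card \<Delta>) * real d \<le> 32 * t * (1 + ln (2 * real d))"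
      and cU: "\<psi> * card U \<le> 3 * t" and cW: "\<psi> * card W \<le> 2 * t"
      and CS2: "?C \<subseteq> S2 \<psi> T \<Delta> U W" and F1G: "F1 T \<Delta> U \<subseteq> ?G" and F2G: "F2 \<psi> T \<Delta> U W \<subseteq> ?G"
      and size: "d * card (S2 \<psi> T \<Delta> U W) \<le> d * card (F2 \<psi> T \<Delta> U W) + 5 * t * \<psi>"
      unfolding ca cg t_def[symmetric] by blast
    let ?F1 = "F1 T \<Delta> U" and ?S1 = "S1 \<psi> T \<Delta> U" and ?S2 = "S2 \<psi> T \<Delta> U W" and ?F2 = "F2 \<psi> T \<Delta> U W"
    define X where "X = insert v (T \<union> \<Delta> \<union> U \<union> W)"
    have TR: "T \<subseteq> R" using T GR by auto
    have \<Delta>L: "\<Delta> \<subseteq> L" using NS_R[OF TR] \<Delta> by auto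
    have XV: "X \<subseteq> L \<union> R" using v TR \<Delta>L U cl_subset W(1) unfolding X_def by blast
    have vC: "v \<in> ?C" using A subset_cl by blast
    \<comment> \<open>A vertex of \<open>S1\<close> misses at most
      \<open>\<psi> \<le> d / 2 < d\<close> neighbours, so it touches \<open>F1\<close>. All
      distance bounds below rest on this.\<close>
    have S1F1: "\<exists>z\<in>N u. z \<in> ?F1" if "u \<in> ?S1" for u
    proof (rule ccontr)
      assume "\<not> ?thesis"
      then have "N u - ?F1 = N u" by auto
      then have "card (N u) \<le> \<psi>" using that by (auto simp: S1_def)
      then show False using that card_N[of u] \<psi> d2 by (auto simp: S1_def)
    qed
    \<comment> \<open>A neighbour of \<open>u\<close> in \<open>F1\<close> is a neighbour of some
      vertex of \<open>U\<close>, at distance 2 from \<open>u\<close>, or comes from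
      \<open>T\<close> through the closure, at distance 3.\<close>
    have cov: "\<exists>x\<in>X. near 3 u x" if "u \<in> A" for u
    proof -
      have uC: "u \<in> ?C" using that A subset_cl by blast
      then obtain z where z: "z \<in> N u" "z \<in> ?F1" using S1F1 CS2 by (auto simp: S2_def)
      from z(2) consider p where "p \<in> U" "z \<in> N p"
        | u' \<tau> where "z \<in> N u'" "u' \<in> N \<tau>" "\<tau> \<in> T"
        unfolding F1_def NS_def by blast
      then show ?thesis
      proof cases
        case 1
        have "near (Suc (Suc 1)) u p"
          using 1 U cl_subset by (intro near_step[OF z(1)] near_step'[OF 1(2)] near_refl) auto
        then show ?thesis using 1 by (intro bexI[of _ p]) (auto simp: X_def numeral_3_eq_3)
      next
        case 2
        have "u' \<in> L \<union> R" "\<tau> \<in> L \<union> R" using 2 TR N_R by auto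
        then have "near (Suc (Suc (Suc 0))) u \<tau>"
          by (intro near_step[OF z(1)] near_step'[OF 2(1)] near_step'[OF 2(2)] near_refl)
        then show ?thesis using 2 by (intro bexI[of _ \<tau>]) (auto simp: X_def numeral_3_eq_3)
      qed
    qed
    have nearG: "\<exists>u\<in>?C. near 1 x u" if "x \<in> ?G" for x
    proof -
      obtain c where "c \<in> A" "x \<in> N c" using \<open>x \<in> ?G\<close> by (auto simp: NS_def)
      then show ?thesis using near_N'[of x c] A subset_cl by blast
    qed
    \<comment> \<open>Vertices of \<open>\<Delta>\<close> reach the closure through \<open>T\<close>
      in two steps; vertices of \<open>W\<close> reach it through \<open>S1\<close> and
      \<open>F1\<close> in three, which is why \<open>W\<close> was chosen adjacent to
      \<open>S1\<close>.\<close>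
    have cls: "\<exists>u\<in>?C. near 3 x u" if x: "x \<in> X \<union> ?G" for x
    proof -
      from x consider "x \<in> ?G" | "x \<in> ?C" | "x \<in> \<Delta>" | "x \<in> W"
        using T U vC unfolding X_def by blast
      then show ?thesis
      proof cases
        case 1 then show ?thesis using nearG near_mono[of 1 _ _ 3] by fastforce
      next
        case 2 then show ?thesis using near_refl by blast
      next
        case 3
        then obtain \<tau> where \<tau>: "\<tau> \<in> T" "x \<in> N \<tau>" unfolding \<Delta> NS_def by auto
        then obtain u where "u \<in> ?C" "near 1 \<tau> u" using nearG T by blast
        then have "near (Suc 1) x u" using \<tau> TR by (intro near_step'[OF \<tau>(2)]) auto
        then show ?thesis using \<open>u \<in> ?C\<close> near_mono[of "Suc 1" x u 3] by auto
      next
        case 4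
        then obtain s where s: "s \<in> N x" "s \<in> ?S1" using W(2) by blast
        then obtain z where z: "z \<in> N s" "z \<in> ?F1" using S1F1 by blast
        then obtain u where "u \<in> ?C" "near 1 z u" using nearG F1G by blast
        then have "near (Suc (Suc 1)) x u" by (intro near_step[OF s(1)] near_step[OF z(1)])
        then show ?thesis using \<open>u \<in> ?C\<close> by (auto simp: numeral_3_eq_3)
      qed
    qed
    have walk_ex: "\<exists>ws\<in>walks v (16 * n). X' \<subseteq> set ws"
      if X': "X \<subseteq> X'" "X' \<subseteq> X \<union> ?G" "card X' \<le> Suc n" for X' n
    proof -
      have "\<exists>ws\<in>walks v (2 * 8 * n). card X' \<le> Suc n \<longrightarrow> X' \<subseteq> set ws"
      proof (rule covering_walk)
        show vX: "v \<in> X'" using X'(1) by (auto simp: X_def)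
        show XV': "X' \<subseteq> L \<union> R" using X' XV GR by blast
        fix Z assume Z: "v \<in> Z" "Z \<subset> X'"
        have "\<exists>x\<in>X'. near 3 u x" if "u \<in> A" for u using cov[OF that] X'(1) by blast
        moreover have "\<exists>u\<in>?C. near 3 x u" if "x \<in> X'" for x using cls[of x] that X'(2) by blast
        ultimately show "\<exists>y\<in>Z. \<exists>x\<in>X' - Z. near 8 y x"
          by (intro linked_near[OF A vX XV' _ _ Z])
      qed
      then show ?thesis using X'(3) by auto
    qed
    have finV: "finite Z" if "Z \<subseteq> L \<union> R" for Z using that finite_L finite_R finite_subset by blast
    have "card X \<le> Suc (card (T \<union> \<Delta> \<union> U \<union> W))" unfolding X_def by (rule card_insert_le_m1) auto
    also have "card (T \<union> \<Delta> \<union> U \<union> W) \<le> card T + card \<Delta> + card U + card W"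
      by (meson card_Un_le order_trans add_le_mono1)
    finally have cX: "card X \<le> Suc (card T + card \<Delta> + card U + card W)" by simp
    have "real (card T + card \<Delta> + card U + card W) \<le> y"
    proof -
      have "real (card T + card \<Delta>) \<le> 32 * t * (1 + ln (2 * real d)) / d" using cT d_pos by (simp add: field_simps)
      moreover have "real (card U) + card W \<le> 5 * t / \<psi>" using cU cW \<psi>(2) by (simp add: field_simps)
      ultimately show ?thesis unfolding y_def by simp
    qed
    \<comment> \<open>The extra 1 is the base point \<open>v\<close>; it is free, since
      \<open>n\<close> detours visit \<open>n + 1\<close> vertices.\<close>
    then have cXy: "real (card X) \<le> 1 + y" using cX by linarith
    define R5 where "R5 = ?G - ?F2"
    define Y where "Y = T \<times> {0} \<union> \<Delta> \<times> {1} \<union> U \<times> {2} \<union> W \<times> {3::nat}"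
    have labY: "label 0 Y = T" "label 1 Y = \<Delta>" "label 2 Y = U" "label 3 Y = W"
      by (auto simp: label_def Y_def)
    define Y' where "Y' = Y \<union> R5 \<times> {4}"
    have labY': "label 0 Y' = T" "label 1 Y' = \<Delta>" "label 2 Y' = U" "label 3 Y' = W" "label 4 Y' = R5"
      by (auto simp: label_def Y_def Y'_def)
    show ?thesis
    proof (cases "real (card ?F2) \<le> g - \<gamma> * t")
      case True
      have "card X \<le> Suc n1" using cXy unfolding n1_def by linarith
      then obtain ws where ws: "ws \<in> walks v (16 * n1)" "X \<subseteq> set ws" using walk_ex[of X n1] by auto
      have D1Y: "D1 Y = ?S2" by (simp only: D1_def labY)
      have "d * real (card ?S2) \<le> d * (g - \<gamma> * t) + 5 * t * \<psi>"
        using size mult_left_mono[OF True, of d] by simp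
      then have "card ?S2 \<le> x" unfolding x_def using d_pos by (simp add: field_simps)
      then have "card (D1 Y) \<le> m1" unfolding D1Y m1_def by linarith
      moreover have "A \<subseteq> D1 Y" unfolding D1Y using CS2 subset_cl[OF A(1)] by blast
      moreover have "Y \<subseteq> set ws \<times> {..<5}" using ws(2) unfolding Y_def X_def by auto
      ultimately have "P (16 * n1) D1 m1 A" unfolding P_def using ws(1) by blast
      then show ?thesis ..
    next
      case False
      have finF2: "finite ?F2" using F2G finG finite_subset by blast
      have "card R5 = g - card ?F2" unfolding R5_def cg[symmetric] using F2G finF2 by (rule card_Diff_subset[rotated])
      then have "card R5 \<le> \<gamma> * t" using False gt0 by linarith
      moreover have "card (X \<union> R5) \<le> card X + card R5" by (rule card_Un_le)
      ultimately have "real (card (X \<union> R5)) \<le> 1 + y + \<gamma> * t" using cXy by linarith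
      then have "card (X \<union> R5) \<le> Suc n2" unfolding n2_def by linarith
      then obtain ws where ws: "ws \<in> walks v (16 * n2)" "X \<union> R5 \<subseteq> set ws"
        using walk_ex[of "X \<union> R5" n2] R5_def by auto
      have "?F2 \<union> R5 = ?G" using F2G R5_def by auto
      then have D2Y: "D2 Y' = ?C" by (simp only: D2_def labY' cl_def)
      have "A \<subseteq> D2 Y'" unfolding D2Y using subset_cl[OF A(1)] .
      moreover have "card (D2 Y') \<le> a" unfolding D2Y ca ..
      moreover have "Y' \<subseteq> set ws \<times> {..<5}" using ws(2) unfolding Y'_def Y_def X_def by auto
      ultimately have "P (16 * n2) D2 a A" unfolding P_def using ws(1) by blast
      then show ?thesis ..
    qed
  qed
  have AL: "\<A> \<subseteq> Pow L" using \<A> by auto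
  have fin\<A>: "finite \<A>" using AL finite_L finite_subset by blast
  let ?A1 = "{A \<in> \<A>. P (16 * n1) D1 m1 A}" and ?A2 = "{A \<in> \<A>. P (16 * n2) D2 a A}"
  have "(\<Sum>A\<in>\<A>. l ^ card A) = (\<Sum>A\<in>?A1 \<union> ?A2. l ^ card A)" using main by (intro sum.cong) auto
  also have "\<dots> \<le> (\<Sum>A\<in>?A1. l ^ card A) + (\<Sum>A\<in>?A2. l ^ card A)"
    using fin\<A> l by (subst sum_Un) (auto intro!: sum_nonneg)
  also have "(\<Sum>A\<in>?A1. l ^ card A) \<le> B ^ (16 * n1 + 1) * (1 + l) ^ m1"
    unfolding B_def using v l fin1
    by (intro decoding_bound[where v = v and D = D1]) (auto simp: P_def)
  also have "(\<Sum>A\<in>?A2. l ^ card A) \<le> B ^ (16 * n2 + 1) * (1 + l) ^ a"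
    unfolding B_def using v l fin2
    by (intro decoding_bound[where v = v and D = D2]) (auto simp: P_def)
  also have "B ^ (16 * n1 + 1) \<le> B powr (16 * y + 1)"
    using B1 y0 by (subst powr_realpow[symmetric]) (auto intro!: powr_mono simp: n1_def)
  also have "B ^ (16 * n2 + 1) \<le> B powr (16 * (y + \<gamma> * t) + 1)"
  proof -
    have "real n2 \<le> y + \<gamma> * t" unfolding n2_def using y0 gt0 by (intro of_nat_floor) simp
    then show ?thesis using B1 by (subst powr_realpow[symmetric]) (auto intro!: powr_mono)
  qed
  also have "(1 + l) ^ m1 \<le> (1 + l) powr x"
    using l x0 by (subst powr_realpow[symmetric]) (auto intro!: powr_mono simp: m1_def)
  also have "(1 + l) ^ a = (1 + l) powr a" using l by (subst powr_realpow) auto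
  finally show ?thesis using l B1 unfolding x_def by (simp add: mult_right_mono)
qed

end

section \<open>Clusters and weights of independent sets\<close>

context regular_bipartite
begin

text \<open>The 2-linked component of \<open>v\<close>, obtained without paths as the least part of
  \<open>A\<close> that contains \<open>v\<close> and shares no neighbour with the rest; this fits
  the cut form of \<open>linked\<close>.\<close>

definition comp :: "'a \<Rightarrow> 'a set \<Rightarrow> 'a set" where
  "comp v A = \<Inter>{C. v \<in> C \<and> C \<subseteq> A \<and> (\<forall>x\<in>C. \<forall>y\<in>A - C. N x \<inter> N y = {})}"

lemma comp:
  assumes "v \<in> A"
  shows comp_self: "v \<in> comp v A" and comp_subset: "comp v A \<subseteq> A"
    and comp_separated: "x \<in> comp v A \<Longrightarrow> y \<in> A - comp v A \<Longrightarrow> N x \<inter> N y = {}"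
    and comp_linked: "linked (comp v A)"
proof -
  show "v \<in> comp v A" by (auto simp: comp_def)
  show sub: "comp v A \<subseteq> A" unfolding comp_def using assms by (intro Inter_lower) auto
  show sep: "N x \<inter> N y = {}" if "x \<in> comp v A" "y \<in> A - comp v A" for x y
  proof -
    from that obtain C where "C \<subseteq> A" "\<forall>x\<in>C. \<forall>y\<in>A - C. N x \<inter> N y = {}" "y \<notin> C" "x \<in> C"
      unfolding comp_def by blast
    then show ?thesis using that by blast
  qed
  have min: "comp v A \<subseteq> C" if "v \<in> C" "C \<subseteq> A" "\<forall>x\<in>C. \<forall>y\<in>A - C. N x \<inter> N y = {}" for C
    unfolding comp_def using that by (intro Inter_lower) auto
  show "linked (comp v A)" unfolding linked_def
  proof (intro allI impI)
    fix B assume B: "B \<subseteq> comp v A" "B \<noteq> {}" "B \<noteq> comp v A"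
    show "\<exists>x\<in>B. \<exists>y\<in>comp v A - B. N x \<inter> N y \<noteq> {}"
    proof (rule ccontr)
      assume no: "\<not> ?thesis"
      \<comment> \<open>Without an edge across the cut, the one of \<open>B\<close> and
        \<open>comp v A - B\<close> that contains \<open>v\<close> is separated from the rest of
        \<open>A\<close>, against minimality of the component.\<close>
      show False
      proof (cases "v \<in> B")
        case True
        have "\<forall>x\<in>B. \<forall>y\<in>A - B. N x \<inter> N y = {}" using no sep B(1) by blast
        then have "comp v A \<subseteq> B" using min[of B] True B sub by blast
        then show False using B by blast
      next
        case False
        have "N x \<inter> N y = {}" if "x \<in> comp v A - B" "y \<in> A - (comp v A - B)" for x y
        proof (cases "y \<in> B")
          case True then show ?thesis using no that by blast
        next
          case False then show ?thesis using sep that by blast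
        qed
        then have "comp v A \<subseteq> comp v A - B" using min[of "comp v A - B"] False sub \<open>v \<in> comp v A\<close> by blast
        then show False using B by blast
      qed
    qed
  qed
qed

section \<open>Weights of independent sets\<close>

definition indeps :: "'a set set" where
  "indeps = {I. I \<subseteq> L \<union> R \<and> (\<forall>x\<in>I. \<forall>y\<in>I. y \<notin> N x)}"

definition weight :: "real \<Rightarrow> ('a set \<Rightarrow> bool) \<Rightarrow> real" where
  "weight l P = (\<Sum>I\<in>{I \<in> indeps. P I}. l ^ card I)"

abbreviation "small_R \<equiv> regular_bipartite.small R N"

lemma finite_indeps: "finite indeps"
  by (rule finite_subset[of _ "Pow (L \<union> R)"]) (auto simp: indeps_def finite_L finite_R)

lemma indep_finite: "I \<in> indeps \<Longrightarrow> finite I"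
  using finite_L finite_R finite_subset by (auto simp: indeps_def)

lemma weight_mono: "l \<ge> 0 \<Longrightarrow> (\<And>I. I \<in> indeps \<Longrightarrow> P I \<Longrightarrow> Q I) \<Longrightarrow> weight l P \<le> weight l Q"
  unfolding weight_def using finite_indeps by (intro sum_mono2) auto

lemma weight_cong: "(\<And>I. I \<in> indeps \<Longrightarrow> P I = Q I) \<Longrightarrow> weight l P = weight l Q"
  unfolding weight_def by (intro sum.cong) auto

lemma weight_nonneg: "l \<ge> 0 \<Longrightarrow> weight l P \<ge> 0"
  unfolding weight_def by (intro sum_nonneg) auto

lemma weight_disj: "l \<ge> 0 \<Longrightarrow> weight l (\<lambda>I. P I \<or> Q I) \<le> weight l P + weight l Q"
proof -
  assume l: "l \<ge> 0"
  have "{I \<in> indeps. P I \<or> Q I} = {I \<in> indeps. P I} \<union> {I \<in> indeps. Q I}" by auto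
  then show ?thesis unfolding weight_def using finite_indeps l
    by (simp add: sum_Un sum_nonneg)
qed

lemma weight_split: "weight l P = weight l (\<lambda>I. P I \<and> Q I) + weight l (\<lambda>I. P I \<and> \<not> Q I)"
proof -
  have "{I \<in> indeps. P I} = {I \<in> indeps. P I \<and> Q I} \<union> {I \<in> indeps. P I \<and> \<not> Q I}" by auto
  then show ?thesis unfolding weight_def using finite_indeps
    by (simp only:) (intro sum.union_disjoint, auto)
qed

lemma weight_Bex:
  assumes "l \<ge> 0" "finite S"
  shows "weight l (\<lambda>I. \<exists>s\<in>S. P s I) \<le> (\<Sum>s\<in>S. weight l (P s))"
  using assms(2)
proof (induction S rule: finite_induct)
  case empty then show ?case by (simp add: weight_def)
next
  case (insert s S)
  have "weight l (\<lambda>I. \<exists>s\<in>insert s S. P s I) \<le> weight l (P s) + weight l (\<lambda>I. \<exists>s\<in>S. P s I)"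
    using weight_disj[OF assms(1), of "P s" "\<lambda>I. \<exists>s\<in>S. P s I"] by simp
  then show ?case using insert by simp
qed

lemma weight_True_pos: "l > 0 \<Longrightarrow> weight l (\<lambda>_. True) > 0"
  unfolding weight_def using finite_indeps by (intro sum_pos) (auto simp: indeps_def)

text \<open>Replace \<open>C\<close> in \<open>I\<close> by an arbitrary
  \<open>D \<subseteq> NS C\<close>. The result is independent because the other vertices of
  \<open>I \<inter> L\<close> share no neighbour with \<open>C\<close>. The map is injective because
  \<open>C\<close> is fixed and \<open>I\<close> avoids \<open>NS C\<close>, so \<open>D\<close> can
  be read off. Summing over \<open>D\<close> gives the factor
  \<open>(1 + l) ^ card (NS C)\<close>.\<close>

lemma comp_weight:
  assumes l: "l > 0" and C: "C \<subseteq> L" and v: "v \<in> L"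
  shows "weight l (\<lambda>I. v \<in> I \<and> comp v (I \<inter> L) = C) * (1 + l) ^ card (NS C) \<le> l ^ card C * weight l (\<lambda>_. True)"
proof -
  define J where "J = {I \<in> indeps. v \<in> I \<and> comp v (I \<inter> L) = C}"
  define h where "h = (\<lambda>(I, D). (I - C) \<union> D :: 'a set)"
  have NR: "NS C \<subseteq> R" using C by (rule NS_L)
  have finN: "finite (NS C)" using NR finite_R finite_subset by blast
  have finJ: "finite J" using finite_indeps by (auto simp: J_def)
  have J: "I \<in> indeps" "C \<subseteq> I" "I \<inter> NS C = {}" if "I \<in> J" for I
  proof -
    have I: "I \<in> indeps" "v \<in> I \<inter> L" "comp v (I \<inter> L) = C" using that v by (auto simp: J_def)
    show "I \<in> indeps" by fact
    show CI: "C \<subseteq> I" using comp_subset[OF I(2)] I(3) by auto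
    show "I \<inter> NS C = {}" using I(1) CI by (auto simp: NS_def indeps_def)
  qed
  have inj: "inj_on h (J \<times> Pow (NS C))"
  proof (rule inj_onI, clarsimp simp: h_def)
    fix I D I' D'
    assume a: "I \<in> J" "D \<subseteq> NS C" "I' \<in> J" "D' \<subseteq> NS C" "I - C \<union> D = I' - C \<union> D'"
    have CN: "C \<inter> NS C = {}" using C NR disjoint by blast
    have "D = (I - C \<union> D) \<inter> NS C" using a J(3)[of I] by blast
    moreover have "D' = (I' - C \<union> D') \<inter> NS C" using a J(3)[of I'] by blast
    ultimately have "D = D'" using a(5) by metis
    have "I = ((I - C \<union> D) - NS C) \<union> C" using a J(2,3)[of I] by blast
    moreover have "I' = ((I' - C \<union> D') - NS C) \<union> C" using a J(2,3)[of I'] by blast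
    ultimately have "I = I'" using a(5) by metis
    with \<open>D = D'\<close> show "I = I' \<and> D = D'" by simp
  qed
  have img: "h ` (J \<times> Pow (NS C)) \<subseteq> indeps"
  proof clarify
    fix I D assume I: "I \<in> J" and D: "D \<subseteq> NS C"
    have II: "I \<in> indeps" "v \<in> I \<inter> L" "comp v (I \<inter> L) = C" using I v by (auto simp: J_def)
    have no: "y \<notin> N x" if "x \<in> I - C" "y \<in> D" for x y
    proof
      assume y: "y \<in> N x"
      have "y \<in> R" using that D NR by blast
      have "x \<in> L" using that y \<open>y \<in> R\<close> II(1) N_R[of x] disjoint by (auto simp: indeps_def)
      moreover obtain c where "c \<in> C" "y \<in> N c"
        using \<open>y \<in> D\<close> D unfolding NS_def by blast
      ultimately show False using comp_separated[OF II(2), of c x] II(3) that y by auto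
    qed
    have "h (I, D) \<subseteq> L \<union> R" using II(1) D NR by (auto simp: h_def indeps_def)
    moreover have "y \<notin> N x" if "x \<in> h (I, D)" "y \<in> h (I, D)" for x y
    proof -
      have D2: "y \<notin> N x" if "x \<in> D" "y \<in> D" for x y
        using that D NR N_R[of x] disjoint by blast
      have D3: "y \<notin> N x" if "x \<in> D" "y \<in> I - C" for x y
      proof
        assume "y \<in> N x"
        then have "x \<in> N y" using that D NR N_sym[of x y] by auto
        then show False using no[of y x] that by auto
      qed
      have "y \<notin> N x" if "x \<in> I" "y \<in> I" for x y using that II(1) by (auto simp: indeps_def)
      then show ?thesis using that no D2 D3 by (auto simp: h_def)
    qed
    ultimately show "h (I, D) \<in> indeps" by (auto simp: indeps_def)
  qed
  have pt: "l ^ card I * l ^ card D = l ^ card C * l ^ card (h (I, D))" if "I \<in> J" "D \<in> Pow (NS C)" for I D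
  proof -
    have fI: "finite I" using J that indep_finite by blast
    have fD: "finite D" using that finN finite_subset by auto
    have "card (h (I, D)) = card (I - C) + card D"
      unfolding h_def using fI fD that J(3)[of I] by (auto intro!: card_Un_disjoint)
    moreover have "card (I - C) + card C = card I" using fI J(2)[OF that(1)]
      by (metis card_Diff_subset card_mono finite_subset le_add_diff_inverse2)
    ultimately have "card I + card D = card C + card (h (I, D))" by linarith
    then show ?thesis by (simp only: power_add[symmetric])
  qed
  have "weight l (\<lambda>I. v \<in> I \<and> comp v (I \<inter> L) = C) * (1 + l) ^ card (NS C) =
      (\<Sum>I\<in>J. l ^ card I) * (\<Sum>D\<in>Pow (NS C). l ^ card D)"
    unfolding weight_def J_def[symmetric] sum_Pow_power_card[OF finN] ..
  also have "\<dots> = (\<Sum>(I, D)\<in>J \<times> Pow (NS C). l ^ card I * l ^ card D)"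
    by (simp add: sum_product sum.cartesian_product)
  also have "\<dots> = (\<Sum>p\<in>J \<times> Pow (NS C). l ^ card C * l ^ card (h p))"
    using pt by (intro sum.cong) auto
  also have "\<dots> = l ^ card C * (\<Sum>I\<in>h ` (J \<times> Pow (NS C)). l ^ card I)"
    by (simp add: sum.reindex[OF inj] sum_distrib_left)
  also have "(\<Sum>I\<in>h ` (J \<times> Pow (NS C)). l ^ card I) \<le> weight l (\<lambda>_. True)"
    unfolding weight_def using img finite_indeps l by (intro sum_mono2) auto
  finally show ?thesis using l by (simp add: mult_left_mono)
qed

definition clusters :: "'a \<Rightarrow> 'a set set" where
  "clusters v = {C. C \<subseteq> L \<and> v \<in> C \<and> linked C \<and> small C}"

lemma finite_clusters: "finite (clusters v)"
  by (rule finite_subset[of _ "Pow L"]) (auto simp: clusters_def finite_L)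

text \<open>Union bound over the possible components of \<open>v\<close>; a component inherits
  smallness because the closure is monotone.\<close>

lemma small_weight_le:
  assumes l: "l > 0" and v: "v \<in> L"
  shows "weight l (\<lambda>I. v \<in> I \<and> small (I \<inter> L)) \<le>
    (\<Sum>C\<in>clusters v. l ^ card C / (1 + l) ^ card (NS C)) * weight l (\<lambda>_. True)"
proof -
  have "weight l (\<lambda>I. v \<in> I \<and> small (I \<inter> L)) \<le>
      weight l (\<lambda>I. \<exists>C\<in>clusters v. v \<in> I \<and> comp v (I \<inter> L) = C)"
  proof (rule weight_mono)
    fix I assume I: "I \<in> indeps" "v \<in> I \<and> small (I \<inter> L)"
    then have vI: "v \<in> I \<inter> L" using v by auto
    have "cl (comp v (I \<inter> L)) \<subseteq> cl (I \<inter> L)" using comp_subset[OF vI] by (rule cl_mono)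
    then have "card (cl (comp v (I \<inter> L))) \<le> card (cl (I \<inter> L))" using finite_cl by (intro card_mono) auto
    then have "small (comp v (I \<inter> L))" using I by (auto simp: small_def)
    then have "comp v (I \<inter> L) \<in> clusters v"
      using comp_self[OF vI] comp_subset[OF vI] comp_linked[OF vI] by (auto simp: clusters_def)
    then show "\<exists>C\<in>clusters v. v \<in> I \<and> comp v (I \<inter> L) = C" using I by auto
  qed (use l in simp)
  also have "\<dots> \<le> (\<Sum>C\<in>clusters v. weight l (\<lambda>I. v \<in> I \<and> comp v (I \<inter> L) = C))"
    using l finite_clusters by (intro weight_Bex) auto
  also have "\<dots> \<le> (\<Sum>C\<in>clusters v. l ^ card C / (1 + l) ^ card (NS C) * weight l (\<lambda>_. True))"
  proof (intro sum_mono)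
    fix C assume "C \<in> clusters v"
    then have "C \<subseteq> L" by (auto simp: clusters_def)
    from comp_weight[OF l this v] show "weight l (\<lambda>I. v \<in> I \<and> comp v (I \<inter> L) = C) \<le>
        l ^ card C / (1 + l) ^ card (NS C) * weight l (\<lambda>_. True)"
      using l by (simp add: pos_le_divide_eq)
  qed
  finally show ?thesis by (simp add: sum_distrib_right)
qed

lemma card_cl_le: "A \<subseteq> L \<Longrightarrow> card (cl A) \<le> card (NS A)"
proof -
  assume A: "A \<subseteq> L"
  have "(real (card (NS A)) - card (cl A)) * d \<ge> 0"
    using sum_defect[OF A] by (metis of_nat_0_le_iff sum_nonneg)
  then show ?thesis using d_pos by (simp add: zero_le_mult_iff)
qed

text \<open>The closure of the \<open>R\<close>-part of \<open>I\<close> is disjoint from the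
  neighbourhood of the \<open>L\<close>-part, and that neighbourhood is at least as large as the
  closure of the \<open>L\<close>-part. So the two closures together have at most
  \<open>card R = card L\<close> elements and cannot both exceed half of it.\<close>

lemma one_side_small:
  assumes I: "I \<in> indeps"
  shows "small (I \<inter> L) \<or> small_R (I \<inter> R)"
proof -
  interpret sw: regular_bipartite R L N d by (rule swap)
  let ?A = "I \<inter> L" and ?B = "I \<inter> R"
  have disj: "sw.cl ?B \<inter> NS ?A = {}"
  proof (rule ccontr)
    assume "\<not> ?thesis"
    then obtain w where w: "w \<in> sw.cl ?B" "w \<in> NS ?A" by auto
    then obtain a where a: "a \<in> ?A" "w \<in> N a" by (auto simp: NS_def)
    then have "a \<in> N w" using N_sym[of a w] by auto
    then have "a \<in> NS ?B" using w(1) by (auto simp: sw.cl_def)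
    then obtain b where b: "b \<in> ?B" "a \<in> N b" by (auto simp: NS_def)
    then show False using I a by (auto simp: indeps_def)
  qed
  have NR: "NS ?A \<subseteq> R" by (rule NS_L) auto
  have "card (cl ?A) + card (sw.cl ?B) \<le> card (NS ?A) + card (sw.cl ?B)" using card_cl_le[of ?A] by simp
  also have "\<dots> = card (NS ?A \<union> sw.cl ?B)"
    using disj NR finite_R finite_subset sw.finite_cl by (intro card_Un_disjoint[symmetric]) auto
  also have "\<dots> \<le> card R" using NR sw.cl_subset finite_R by (intro card_mono) auto
  finally have "card (cl ?A) + card (sw.cl ?B) \<le> card R" .
  then show ?thesis using card_L_eq_R by (auto simp: small_def sw.small_def)
qed

text \<open>Given an empty neighbourhood, \<open>v\<close> is occupied with probability
  \<open>l / (1 + l)\<close>, independently of any event that ignores \<open>v\<close>: inserting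
  \<open>v\<close> is a bijection from the sets that avoid \<open>v\<close> and its
  neighbours.\<close>

lemma weight_occupied:
  assumes l: "l > 0" and v: "v \<in> L \<union> R" and P: "\<And>I. P (insert v I) = P I"
  shows "weight l (\<lambda>I. v \<in> I \<and> P I) = l / (1 + l) * weight l (\<lambda>I. N v \<inter> I = {} \<and> P I)"
proof -
  have vN: "v \<notin> N v" using v N_L[of v] N_R[of v] disjoint by blast
  let ?S = "{I \<in> indeps. (N v \<inter> I = {} \<and> P I) \<and> v \<notin> I}"
  have inj: "inj_on (insert v) ?S" by (rule inj_onI) (simp add: insert_ident)
  have img: "{I \<in> indeps. v \<in> I \<and> P I} = insert v ` ?S"
  proof (intro equalityI subsetI)
    fix I assume I: "I \<in> {I \<in> indeps. v \<in> I \<and> P I}"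
    then have e: "I = insert v (I - {v})" by auto
    have "P (I - {v})" using I P[of "I - {v}"] e by simp
    moreover have "I - {v} \<in> indeps" "N v \<inter> (I - {v}) = {}" using I by (auto simp: indeps_def)
    ultimately show "I \<in> insert v ` ?S" using e by blast
  next
    fix I assume "I \<in> insert v ` ?S"
    then obtain I' where I': "I = insert v I'" "I' \<in> indeps" "N v \<inter> I' = {}" "P I'" by auto
    have "v \<notin> N x" if "x \<in> I'" for x
      using that I' N_sym[of x v] by (auto simp: indeps_def)
    then show "I \<in> {I \<in> indeps. v \<in> I \<and> P I}" using I' v vN P by (auto simp: indeps_def)
  qed
  have 1: "weight l (\<lambda>I. v \<in> I \<and> P I) = l * weight l (\<lambda>I. (N v \<inter> I = {} \<and> P I) \<and> v \<notin> I)"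
  proof -
    have "weight l (\<lambda>I. v \<in> I \<and> P I) = (\<Sum>I\<in>?S. l ^ card (insert v I))"
      unfolding weight_def img by (subst sum.reindex[OF inj]) simp
    also have "\<dots> = (\<Sum>I\<in>?S. l * l ^ card I)" using indep_finite by (intro sum.cong) auto
    finally show ?thesis by (simp add: weight_def sum_distrib_left)
  qed
  have "weight l (\<lambda>I. N v \<inter> I = {} \<and> P I) =
      weight l (\<lambda>I. (N v \<inter> I = {} \<and> P I) \<and> v \<in> I) + weight l (\<lambda>I. (N v \<inter> I = {} \<and> P I) \<and> v \<notin> I)"
    by (rule weight_split)
  also have "weight l (\<lambda>I. (N v \<inter> I = {} \<and> P I) \<and> v \<in> I) = weight l (\<lambda>I. v \<in> I \<and> P I)"
    by (rule weight_cong) (auto simp: indeps_def)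
  finally show ?thesis using 1 l by (simp add: field_simps)
qed

lemma weight_swap: "regular_bipartite.weight R L N = weight"
proof -
  interpret sw: regular_bipartite R L N d by (rule swap)
  show ?thesis by (intro ext) (simp add: weight_def sw.weight_def indeps_def sw.indeps_def Un_commute)
qed

section \<open>From a bound on occupation of the small side to the correlations\<close>

context
  fixes l \<eta> :: real
  assumes l: "l > 0"
    and sym: "weight l (\<lambda>I. small (I \<inter> L)) = weight l (\<lambda>I. small_R (I \<inter> R))"
    and \<eta>_L: "\<And>v. v \<in> L \<Longrightarrow> weight l (\<lambda>I. v \<in> I \<and> small (I \<inter> L)) \<le> \<eta> * weight l (\<lambda>_. True)"
    and \<eta>_R: "\<And>w. w \<in> R \<Longrightarrow> weight l (\<lambda>I. w \<in> I \<and> small_R (I \<inter> R)) \<le> \<eta> * weight l (\<lambda>_. True)"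
    and \<eta>: "d * \<eta> \<le> 1 / 4"
begin

text \<open>By symmetry the \<open>L\<close>-part is small with probability at least 1/2. On that
  event each of the \<open>d\<close> neighbours of \<open>w\<close> is occupied with probability at
  most \<open>\<eta>\<close>, which removes at most 1/4.\<close>

lemma occupied_lower:
  assumes w: "w \<in> R"
  shows "weight l (\<lambda>_. True) / 4 \<le> weight l (\<lambda>I. N w \<inter> I = {})"
    and "weight l (\<lambda>I. w \<in> I) = l / (1 + l) * weight l (\<lambda>I. N w \<inter> I = {})"
proof -
  let ?Z = "weight l (\<lambda>_. True)"
  have NwL: "N w \<subseteq> L" using w by (rule N_R)
  have "?Z \<le> weight l (\<lambda>I. small (I \<inter> L) \<or> small_R (I \<inter> R))"
    using l one_side_small by (intro weight_mono) auto
  also have "\<dots> \<le> 2 * weight l (\<lambda>I. small (I \<inter> L))" 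
    using weight_disj[of l "\<lambda>I. small (I \<inter> L)" "\<lambda>I. small_R (I \<inter> R)"] l sym by simp
  finally have 1: "?Z / 2 \<le> weight l (\<lambda>I. small (I \<inter> L))" by simp
  have "weight l (\<lambda>I. small (I \<inter> L)) \<le> weight l (\<lambda>I. N w \<inter> I = {} \<or> (\<exists>u\<in>N w. u \<in> I \<and> small (I \<inter> L)))"
    using l by (intro weight_mono) auto
  also have "\<dots> \<le> weight l (\<lambda>I. N w \<inter> I = {}) + weight l (\<lambda>I. \<exists>u\<in>N w. u \<in> I \<and> small (I \<inter> L))"
    using l by (intro weight_disj) simp
  also have "weight l (\<lambda>I. \<exists>u\<in>N w. u \<in> I \<and> small (I \<inter> L)) \<le> (\<Sum>u\<in>N w. weight l (\<lambda>I. u \<in> I \<and> small (I \<inter> L)))"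
    using l w finite_N[of w] by (intro weight_Bex) auto
  also have "\<dots> \<le> (\<Sum>u\<in>N w. \<eta> * ?Z)" using NwL \<eta>_L by (intro sum_mono) auto
  also have "\<dots> = d * \<eta> * ?Z" using w card_N[of w] by simp
  also have "\<dots> \<le> 1 / 4 * ?Z" using \<eta> weight_nonneg l by (intro mult_right_mono) auto
  finally show "?Z / 4 \<le> weight l (\<lambda>I. N w \<inter> I = {})" using 1 by simp
  show "weight l (\<lambda>I. w \<in> I) = l / (1 + l) * weight l (\<lambda>I. N w \<inter> I = {})"
    using weight_occupied[OF l, of w "\<lambda>_. True"] w by simp
qed

text \<open>If both are occupied, one of them is an occupied vertex on a small side: probability at
  most \<open>2 * \<eta>\<close>. Dividing by the lower bound \<open>l / (4 * (1 + l))\<close> for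
  an occupied \<open>w\<close> gives the constant 8.\<close>

lemma opposite_sides:
  assumes u: "u \<in> L" and w: "w \<in> R"
  shows "weight l (\<lambda>I. u \<in> I \<and> w \<in> I) \<le> 8 * \<eta> * (1 + l) / l * weight l (\<lambda>I. w \<in> I)"
proof -
  let ?Z = "weight l (\<lambda>_. True)"
  have Z: "?Z > 0" using l by (rule weight_True_pos)
  have "weight l (\<lambda>I. u \<in> I \<and> w \<in> I) \<le>
      weight l (\<lambda>I. (u \<in> I \<and> small (I \<inter> L)) \<or> (w \<in> I \<and> small_R (I \<inter> R)))"
    using l one_side_small by (intro weight_mono) auto
  also have "\<dots> \<le> weight l (\<lambda>I. u \<in> I \<and> small (I \<inter> L)) + weight l (\<lambda>I. w \<in> I \<and> small_R (I \<inter> R))"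
    using l by (intro weight_disj) simp
  also have "\<dots> \<le> \<eta> * ?Z + \<eta> * ?Z" by (intro add_mono \<eta>_L \<eta>_R u w)
  finally have 1: "weight l (\<lambda>I. u \<in> I \<and> w \<in> I) \<le> 8 * \<eta> * (?Z / 4)" by simp
  have "0 \<le> weight l (\<lambda>I. u \<in> I \<and> small (I \<inter> L))" using l by (intro weight_nonneg) simp
  also have "\<dots> \<le> \<eta> * ?Z" by (rule \<eta>_L[OF u])
  finally have \<eta>0: "\<eta> \<ge> 0" using Z by (simp add: zero_le_mult_iff)
  have "?Z / 4 \<le> (1 + l) / l * weight l (\<lambda>I. w \<in> I)" using occupied_lower[OF w] l by simp
  then have "8 * \<eta> * (?Z / 4) \<le> 8 * \<eta> * ((1 + l) / l * weight l (\<lambda>I. w \<in> I))"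
    using \<eta>0 by (intro mult_left_mono) auto
  then show ?thesis using 1 by simp
qed

text \<open>Both vertices are occupied with weight \<open>(l / (1 + l)) ^ 2\<close> times that of
  both neighbourhoods being empty. So it suffices that \<open>N u\<close> is rarely occupied when
  \<open>N v\<close> is empty. If the \<open>L\<close>-part is small, this costs
  \<open>d * \<eta>\<close>; the other case is reduced to an occupied \<open>v\<close> on a small
  side. The factor 4 comes from dividing by the probability that \<open>N v\<close> is
  empty.\<close>

lemma same_side:
  assumes u: "u \<in> R" and v: "v \<in> R" and "u \<noteq> v"
  shows "l / (1 + l) * (1 - 4 * (d * \<eta> + (1 + l) / l * \<eta>)) * weight l (\<lambda>I. v \<in> I)
    \<le> weight l (\<lambda>I. u \<in> I \<and> v \<in> I)"
proof -
  let ?Z = "weight l (\<lambda>_. True)"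
  let ?p = "l / (1 + l)"
  have Z: "?Z > 0" using l by (rule weight_True_pos)
  have NuL: "N u \<subseteq> L" "N v \<subseteq> L" using u v N_R by auto
  have nadj: "u \<notin> N v" "v \<notin> N u" using NuL u v disjoint by blast+
  have both: "weight l (\<lambda>I. u \<in> I \<and> v \<in> I) = ?p * (?p * weight l (\<lambda>I. N v \<inter> I = {} \<and> N u \<inter> I = {}))"
  proof -
    have "weight l (\<lambda>I. u \<in> I \<and> v \<in> I) = ?p * weight l (\<lambda>I. N u \<inter> I = {} \<and> v \<in> I)"
      using u \<open>u \<noteq> v\<close> by (intro weight_occupied[OF l]) auto
    also have "weight l (\<lambda>I. N u \<inter> I = {} \<and> v \<in> I) = weight l (\<lambda>I. v \<in> I \<and> N u \<inter> I = {})"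
      by (rule weight_cong) auto
    also have "\<dots> = ?p * weight l (\<lambda>I. N v \<inter> I = {} \<and> N u \<inter> I = {})"
      using v nadj by (intro weight_occupied[OF l]) auto
    finally show ?thesis .
  qed
  have "weight l (\<lambda>I. N v \<inter> I = {}) \<le> weight l (\<lambda>I. (N v \<inter> I = {} \<and> N u \<inter> I = {}) \<or>
      ((N v \<inter> I = {} \<and> \<not> small (I \<inter> L)) \<or> (\<exists>x\<in>N u. x \<in> I \<and> small (I \<inter> L))))"
    using l by (intro weight_mono) auto
  also have "\<dots> \<le> weight l (\<lambda>I. N v \<inter> I = {} \<and> N u \<inter> I = {}) +
      (weight l (\<lambda>I. N v \<inter> I = {} \<and> \<not> small (I \<inter> L)) + weight l (\<lambda>I. \<exists>x\<in>N u. x \<in> I \<and> small (I \<inter> L)))"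
    using l by (intro order_trans[OF weight_disj] add_left_mono weight_disj) auto
  also have "weight l (\<lambda>I. \<exists>x\<in>N u. x \<in> I \<and> small (I \<inter> L)) \<le> (\<Sum>x\<in>N u. weight l (\<lambda>I. x \<in> I \<and> small (I \<inter> L)))"
    using l u finite_N[of u] by (intro weight_Bex) auto
  also have "\<dots> \<le> (\<Sum>x\<in>N u. \<eta> * ?Z)" using NuL \<eta>_L by (intro sum_mono) auto
  also have "\<dots> = d * \<eta> * ?Z" using u card_N[of u] by simp
  \<comment> \<open>Smallness of \<open>I \<inter> L\<close> ignores the vertex \<open>v\<close> of
    the other side, so the empty neighbourhood can be traded for an occupied \<open>v\<close> at the
    price \<open>(1 + l) / l\<close>.\<close>
  also have "weight l (\<lambda>I. N v \<inter> I = {} \<and> \<not> small (I \<inter> L)) = (1 + l) / l * weight l (\<lambda>I. v \<in> I \<and> \<not> small (I \<inter> L))"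
  proof -
    have "weight l (\<lambda>I. v \<in> I \<and> \<not> small (I \<inter> L)) = ?p * weight l (\<lambda>I. N v \<inter> I = {} \<and> \<not> small (I \<inter> L))"
      using v disjoint by (intro weight_occupied[OF l]) (auto simp: Int_insert_left)
    then show ?thesis using l by simp
  qed
  also have "(1 + l) / l * weight l (\<lambda>I. v \<in> I \<and> \<not> small (I \<inter> L)) \<le> (1 + l) / l * (\<eta> * ?Z)"
  proof (intro mult_left_mono)
    have "weight l (\<lambda>I. v \<in> I \<and> \<not> small (I \<inter> L)) \<le> weight l (\<lambda>I. v \<in> I \<and> small_R (I \<inter> R))"
      using l one_side_small by (intro weight_mono) auto
    also have "\<dots> \<le> \<eta> * ?Z" by (rule \<eta>_R[OF v])
    finally show "weight l (\<lambda>I. v \<in> I \<and> \<not> small (I \<inter> L)) \<le> \<eta> * ?Z" .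
  qed (use l in auto)
  finally have 1: "weight l (\<lambda>I. N v \<inter> I = {}) \<le> weight l (\<lambda>I. N v \<inter> I = {} \<and> N u \<inter> I = {}) +
      4 * (d * \<eta> + (1 + l) / l * \<eta>) * (?Z / 4)" by (simp add: algebra_simps)
  have "0 \<le> weight l (\<lambda>I. v \<in> I \<and> small_R (I \<inter> R))" using l by (intro weight_nonneg) simp
  also have "\<dots> \<le> \<eta> * ?Z" by (rule \<eta>_R[OF v])
  finally have \<eta>0: "\<eta> \<ge> 0" using Z by (simp add: zero_le_mult_iff)
  have "4 * (d * \<eta> + (1 + l) / l * \<eta>) * (?Z / 4) \<le>
      4 * (d * \<eta> + (1 + l) / l * \<eta>) * weight l (\<lambda>I. N v \<inter> I = {})"
    using \<eta>0 l occupied_lower(1)[OF v] by (intro mult_left_mono) auto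
  then have "(1 - 4 * (d * \<eta> + (1 + l) / l * \<eta>)) * weight l (\<lambda>I. N v \<inter> I = {}) \<le>
      weight l (\<lambda>I. N v \<inter> I = {} \<and> N u \<inter> I = {})" using 1 by (simp add: algebra_simps)
  then have "?p * (?p * ((1 - 4 * (d * \<eta> + (1 + l) / l * \<eta>)) * weight l (\<lambda>I. N v \<inter> I = {}))) \<le>
      ?p * (?p * weight l (\<lambda>I. N v \<inter> I = {} \<and> N u \<inter> I = {}))"
    using l by (intro mult_left_mono) auto
  then show ?thesis unfolding both occupied_lower(2)[OF v] by (simp add: mult.assoc mult.left_commute)
qed

end

end

section \<open>Numerical estimates\<close>

lemma sum_by_key:
  fixes f :: "'b \<Rightarrow> real" and M :: real
  assumes "finite F" "finite K" "key ` F \<subseteq> K"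
    and "\<And>k. k \<in> K \<Longrightarrow> (\<Sum>C\<in>{C \<in> F. key C = k}. f C) \<le> M"
  shows "sum f F \<le> card K * M"
proof -
  have "sum f F = (\<Sum>k\<in>K. \<Sum>C\<in>{C \<in> F. key C = k}. f C)"
    using assms by (intro sum.group[symmetric]) auto
  also have "\<dots> \<le> (\<Sum>k\<in>K. M)" using assms by (intro sum_mono) auto
  finally show ?thesis by simp
qed

text \<open>The dimensions that are large enough for the numerical estimates below.\<close>

definition good :: "nat \<Rightarrow> bool" where
  "good d \<longleftrightarrow> (let q = real d powr (1/3) in q \<ge> 100 \<and> 6000 * ln (real d) \<le> q \<and>
     32 * (1 + ln (2 * real d)) \<le> q \<and> 8 * ln (real d) * (1 + q) + 2 * q \<le> q ^ 2 \<and> ln (real d) \<ge> 1)"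

lemma eventually_good: "eventually good sequentially"
proof -
  have "eventually (\<lambda>d::nat. real d powr (1/3) \<ge> 100) sequentially" by real_asymp
  moreover have "eventually (\<lambda>d::nat. 6000 * ln (real d) \<le> real d powr (1/3)) sequentially" by real_asymp
  moreover have "eventually (\<lambda>d::nat. 32 * (1 + ln (2 * real d)) \<le> real d powr (1/3)) sequentially" by real_asymp
  moreover have "eventually (\<lambda>d::nat. 8 * ln (real d) * (1 + real d powr (1/3)) + 2 * real d powr (1/3)
      \<le> (real d powr (1/3)) ^ 2) sequentially" by real_asymp
  moreover have "eventually (\<lambda>d::nat. ln (real d) \<ge> 1) sequentially" by real_asymp
  ultimately show ?thesis by eventually_elim (simp add: good_def Let_def)
qed

text \<open>In units of \<open>\<beta> * t / q\<close>: the smaller container saves 20, its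
  inaccuracy gives back at most 10, and naming it costs at most 1, leaving 9. Here
  \<open>\<beta>\<close> stands for \<open>ln (1 + l)\<close> and \<open>b\<close> for the logarithm
  of the code base.\<close>

lemma container_term_1:
  fixes q \<beta> t \<Lambda> y b \<psi> :: real
  assumes q: "q \<ge> 100" and \<beta>: "\<beta> * q \<ge> 1500 * \<Lambda>" and \<Lambda>: "\<Lambda> \<ge> 1" and t: "t \<ge> q ^ 6 / 2"
    and y: "y \<le> 6 * t / q\<^sup>2" and b: "0 \<le> b" "b \<le> 2 * \<Lambda>" and \<psi>: "\<psi> \<le> 2 * q\<^sup>2"
  shows "(16 * y + 1) * b + \<beta> * (- (20 / q * t) + 5 * t * \<psi> / q ^ 3) \<le> - (9 * \<beta> * t / q)"
proof -
  have q0: "q > 0" using q by simp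
  have b0: "\<beta> > 0" using \<beta> \<Lambda> q0 by (smt (verit) mult_nonneg_nonneg mult_nonpos_nonneg)
  have "q ^ 4 \<ge> 100 ^ 4" using q by (intro power_mono) auto
  then have "2 * q\<^sup>2 \<le> q ^ 4 * q\<^sup>2" using q0 by (intro mult_right_mono) auto
  then have tq: "q\<^sup>2 \<le> t" using t by (simp add: power_add[symmetric])
  have t0: "t > 0" using tq q0 by (smt (verit) zero_less_power)
  have 1: "16 * y + 1 \<le> 97 * t / q\<^sup>2"
  proof -
    have "1 \<le> t / q\<^sup>2" using tq q0 by simp
    then show ?thesis using y by simp
  qed
  have "(16 * y + 1) * b \<le> (97 * t / q\<^sup>2) * b" using 1 b by (intro mult_right_mono) auto
  also have "\<dots> \<le> (97 * t / q\<^sup>2) * (2 * \<Lambda>)" using b t0 by (intro mult_left_mono) auto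
  also have "\<dots> = 194 * t / q\<^sup>2 * \<Lambda>" by simp
  also have "\<dots> \<le> 194 * t / q\<^sup>2 * (\<beta> * q / 1500)" using \<beta> t0 by (intro mult_left_mono) auto
  also have "\<dots> = 194 / 1500 * (\<beta> * t / q)" using q0 by (simp add: field_simps power2_eq_square)
  also have "\<dots> \<le> 1 * (\<beta> * t / q)" using b0 t0 q0 by (intro mult_right_mono) auto
  finally have A: "(16 * y + 1) * b \<le> \<beta> * t / q" by simp
  have "5 * t * \<psi> / q ^ 3 \<le> 5 * t * (2 * q\<^sup>2) / q ^ 3"
    using \<psi> t0 q0 by (intro divide_right_mono mult_left_mono) auto
  also have "\<dots> = 10 * t / q" using q0 by (simp add: field_simps power2_eq_square power3_eq_cube)
  finally have "\<beta> * (- (20 / q * t) + 5 * t * \<psi> / q ^ 3) \<le> \<beta> * (- (20 / q * t) + 10 * t / q)"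
    using b0 by (intro mult_left_mono) auto
  also have "\<dots> = - (10 * \<beta> * t / q)" using q0 by (simp add: field_simps)
  finally have "\<beta> * (- (20 / q * t) + 5 * t * \<psi> / q ^ 3) \<le> - (10 * (\<beta> * t / q))" by (simp add: mult.assoc)
  moreover have "9 * \<beta> * t / q = 9 * (\<beta> * t / q)" by simp
  ultimately show ?thesis using A by linarith
qed

text \<open>Here the code costs a constant fraction of \<open>\<beta> * t\<close>, and this is what
  requires a large constant in the hypothesis on \<open>l\<close>:
  \<open>16 * (6 + 20) + 1 = 417\<close>, doubled by \<open>b \<le> 2 * \<Lambda>\<close>, gives
  \<open>834 / 1500\<close>, which together with \<open>9 / q \<le> 9 / 100\<close> stays below
  1.\<close>

lemma container_term_2:
  fixes q \<beta> t \<Lambda> y b :: real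
  assumes q: "q \<ge> 100" and \<beta>: "\<beta> * q \<ge> 1500 * \<Lambda>" and \<Lambda>: "\<Lambda> \<ge> 1" and t: "t \<ge> q ^ 6 / 2"
    and y: "y \<le> 6 * t / q\<^sup>2" and b: "0 \<le> b" "b \<le> 2 * \<Lambda>"
  shows "(16 * (y + 20 / q * t) + 1) * b - \<beta> * t \<le> - (9 * \<beta> * t / q)"
proof -
  have q0: "q > 0" using q by simp
  have b0: "\<beta> > 0" using \<beta> \<Lambda> q0 by (smt (verit) mult_nonneg_nonneg mult_nonpos_nonneg)
  have "q ^ 4 \<ge> 100 ^ 4" using q by (intro power_mono) auto
  then have "2 * q\<^sup>2 \<le> q ^ 4 * q\<^sup>2" using q0 by (intro mult_right_mono) auto
  then have tq: "q\<^sup>2 \<le> t" using t by (simp add: power_add[symmetric])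
  have t0: "t > 0" using tq q0 by (smt (verit) zero_less_power)
  have "t / q\<^sup>2 \<le> t / q" using q t0 by (intro divide_left_mono) (auto simp: power2_eq_square)
  moreover have "1 \<le> t / q\<^sup>2" using tq q0 by simp
  moreover have "y \<le> 6 * (t / q\<^sup>2)" using y by simp
  ultimately have "16 * (y + 20 * (t / q)) + 1 \<le> 417 * (t / q)" by argo
  then have 1: "16 * (y + 20 / q * t) + 1 \<le> 417 * (t / q)" by simp
  have "(16 * (y + 20 / q * t) + 1) * b \<le> 417 * (t / q) * b" using 1 b by (intro mult_right_mono) auto
  also have "\<dots> \<le> 417 * (t / q) * (2 * \<Lambda>)" using b t0 q0 by (intro mult_left_mono) auto
  also have "\<dots> = 834 * (t / q) * \<Lambda>" by simp
  also have "\<dots> \<le> 834 * (t / q) * (\<beta> * q / 1500)" using \<beta> t0 q0 by (intro mult_left_mono) auto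
  also have "\<dots> = 834 / 1500 * (\<beta> * t)" using q0 by (simp add: field_simps)
  finally have A: "(16 * (y + 20 / q * t) + 1) * b \<le> 834 / 1500 * (\<beta> * t)" .
  have "9 * \<beta> * t / q \<le> 9 * \<beta> * t / 100" using q b0 t0 by (intro divide_left_mono) auto
  then have "9 * \<beta> * t / q \<le> 9 / 100 * (\<beta> * t)" by simp
  moreover have "\<beta> * t > 0" using b0 t0 by simp
  ultimately show ?thesis using A by linarith
qed

context regular_bipartite
begin

definition q :: real where "q = real d powr (1/3)"

section \<open>The sum over clusters under edge isoperimetry\<close>

context
  fixes l :: real
  assumes iso: "\<And>A. A \<subseteq> L \<Longrightarrow> 2 * real d * card A \<le> (real (card A) + card (NS A)) * log 2 (real (card A) + card (NS A))"
    and card_L: "card L = 2 ^ (d - 1)"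
    and good: "good d"
    and l: "l > 3000 * ln (real d) / real d powr (1/3)"
begin

definition \<Lambda> where "\<Lambda> = ln (real d)"
definition \<beta> where "\<beta> = ln (1 + l)"

lemma q: "q \<ge> 100" "6000 * \<Lambda> \<le> q" "32 * (1 + ln (2 * real d)) \<le> q"
  "8 * \<Lambda> * (1 + q) + 2 * q \<le> q\<^sup>2" "\<Lambda> \<ge> 1"
  using good by (auto simp: good_def Let_def q_def \<Lambda>_def)

lemma q3: "real d = q ^ 3"
  using d_pos by (simp add: q_def powr_powr flip: powr_realpow)

lemma d_ge: "real d \<ge> 1000000"
proof -
  have "q ^ 3 \<ge> 100 ^ 3" using q(1) by (intro power_mono) auto
  then show ?thesis by (simp add: q3)
qed

lemma l_pos: "l > 0"
proof -
  have "3000 * ln (real d) / real d powr (1/3) > 0"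
    using q(1,5) unfolding q_def[symmetric] \<Lambda>_def[symmetric] by (intro divide_pos_pos) auto
  then show ?thesis using l by linarith
qed

text \<open>Half of the constant 3000 is lost in \<open>ln (1 + x) \<ge> x / 2\<close>. As
  \<open>l\<close> has no upper bound, this is applied to the threshold value \<open>x\<close>,
  which is at most 1/2, and transferred to \<open>l\<close> by monotonicity.\<close>

lemma \<beta>_q: "1500 * \<Lambda> \<le> \<beta> * q"
proof -
  define x where "x = 3000 * \<Lambda> / q"
  have q0: "q > 0" using q(1) by simp
  have x: "0 \<le> x" "x \<le> 1 / 2" using q(2,5) q0 by (auto simp: x_def field_simps)
  have "x * x \<le> 1 / 2 * x" using x by (intro mult_right_mono) auto
  then have "x / 2 \<le> x - x\<^sup>2" by (simp add: power2_eq_square)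
  also have "\<dots> \<le> ln (1 + x)" using x by (intro ln_one_plus_pos_lower_bound) auto
  also have "\<dots> \<le> \<beta>" unfolding \<beta>_def using l x l_pos by (simp add: x_def q_def \<Lambda>_def)
  finally have "x / 2 * q \<le> \<beta> * q" using q0 by (intro mult_right_mono) auto
  then show ?thesis using q0 by (simp add: x_def)
qed

lemma \<beta>_pos: "\<beta> > 0" using l_pos by (simp add: \<beta>_def)

lemma exp_\<beta>: "exp (\<beta> * x) = (1 + l) powr x"
  using l_pos by (simp add: powr_def \<beta>_def mult.commute)

lemma ln_base: "0 \<le> ln (32 * (real d + 1))" "ln (32 * (real d + 1)) \<le> 2 * \<Lambda>"
proof -
  show "0 \<le> ln (32 * (real d + 1))" by simp
  have "32 * (real d + 1) \<le> 1000000 * real d" using d_ge by simp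
  also have "\<dots> \<le> real d * real d" using d_ge by (intro mult_right_mono) auto
  finally have "ln (32 * (real d + 1)) \<le> ln (real d * real d)" using d_ge by (subst ln_le_cancel_iff) auto
  also have "\<dots> = 2 * \<Lambda>" using d_ge by (simp add: ln_mult \<Lambda>_def)
  finally show "ln (32 * (real d + 1)) \<le> 2 * \<Lambda>" .
qed

lemma cluster_facts:
  assumes "C \<in> clusters v"
  shows "C \<subseteq> L" "linked C" "v \<in> C" "0 < card C" "card C \<le> card (cl C)" "card (cl C) \<le> card (NS C)"
    "d \<le> card (NS C)"
    "2 * real d * card (cl C) \<le> (real (card (cl C)) + card (NS C)) * log 2 (real (card (cl C)) + card (NS C))"
    "2 * card (cl C) \<le> 2 ^ (d - 1)" "card (NS C) \<le> 2 ^ (d - 1)"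
proof -
  show C: "C \<subseteq> L" "linked C" "v \<in> C" using assms by (auto simp: clusters_def)
  have fC: "finite C" using C finite_L finite_subset by blast
  show "0 < card C" using C fC card_gt_0_iff by blast
  show "card C \<le> card (cl C)" using subset_cl[OF C(1)] finite_cl by (intro card_mono)
  show "card (cl C) \<le> card (NS C)" using C by (intro card_cl_le)
  have fN: "finite (NS C)" using NS_L[OF C(1)] finite_R finite_subset by blast
  have "card (N v) \<le> card (NS C)" using C fN by (intro card_mono) (auto simp: NS_def)
  then show "d \<le> card (NS C)" using C card_N[of v] by auto
  show "2 * real d * card (cl C) \<le> (real (card (cl C)) + card (NS C)) * log 2 (real (card (cl C)) + card (NS C))"
    using iso[OF cl_subset, of C] by (simp add: NS_cl[OF C(1)])
  show "2 * card (cl C) \<le> 2 ^ (d - 1)" using assms by (simp add: clusters_def small_def card_L)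
  show "card (NS C) \<le> 2 ^ (d - 1)"
    using card_mono[OF finite_R NS_L[OF C(1)]] card_L card_L_eq_R by simp
qed

text \<open>If \<open>g < a + a / d\<close>, smallness gives
  \<open>log 2 (a + g) \<le> d - 1 + 1 / d\<close>; the \<open>- 1\<close> is the whole gain. Then
  isoperimetry would need \<open>2 * d < (2 + 1 / d) * (d - 1 + 1 / d)\<close>, whose right side is
  \<open>2 * d - 1 + 1 / d + 1 / d ^ 2\<close>.\<close>

lemma cluster_expansion:
  assumes C: "C \<in> clusters v"
  defines "a \<equiv> real (card (cl C))" and "g \<equiv> real (card (NS C))"
  shows "g - a > 0" "g \<le> 2 * real d * (g - a)"
proof -
  let ?D = "real d"
  have a: "a > 0" using cluster_facts(4,5)[OF C] by (simp add: a_def)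
  have ag: "a \<le> g" using cluster_facts(6)[OF C] by (simp add: a_def g_def)
  have iso: "2 * ?D * a \<le> (a + g) * log 2 (a + g)" using cluster_facts(8)[OF C] by (simp add: a_def g_def)
  have "real (2 * card (cl C)) \<le> real (2 ^ (d - 1))" using cluster_facts(9)[OF C] of_nat_mono by blast
  then have sm: "2 * a \<le> 2 ^ (d - 1)" by (simp add: a_def)
  have D: "?D \<ge> 2" using d_ge by simp
  have "g \<ge> a + a / ?D"
  proof (rule ccontr)
    assume "\<not> ?thesis"
    then have "a + g < a * (2 + 1 / ?D)" by (simp add: algebra_simps)
    then have lt: "a + g < a * (2 + 1 / ?D)" .
    also have "\<dots> = (2 * a) * (1 + 1 / (2 * ?D))" using D by (simp add: field_simps)
    also have "\<dots> \<le> 2 ^ (d - 1) * (1 + 1 / (2 * ?D))" using sm D by (intro mult_right_mono) auto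
    finally have "log 2 (a + g) \<le> log 2 (2 ^ (d - 1) * (1 + 1 / (2 * ?D)))"
      using a ag D by (subst log_le_cancel_iff) (auto intro!: mult_pos_pos add_pos_nonneg)
    also have "\<dots> = (?D - 1) + log 2 (1 + 1 / (2 * ?D))"
    proof -
      have "1 + 1 / (2 * ?D) > 0" using D by (simp add: add_pos_nonneg)
      then show ?thesis using d_pos by (subst log_mult) (auto simp: log_nat_power of_nat_diff)
    qed
    also have "log 2 (1 + 1 / (2 * ?D)) \<le> 1 / ?D"
    proof -
      have "ln (1 + 1 / (2 * ?D)) \<le> 1 / (2 * ?D)" using D by (intro ln_add_one_self_le_self) auto
      moreover have "ln 2 \<ge> (1 / 2 :: real)" using ln2_ge_two_thirds by simp
      ultimately have "ln (1 + 1 / (2 * ?D)) / ln 2 \<le> (1 / (2 * ?D)) / (1 / 2)"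
        using D by (intro frac_le) auto
      then show ?thesis by (simp add: log_def)
    qed
    finally have lg: "log 2 (a + g) \<le> ?D - 1 + 1 / ?D" by simp
    have "2 * ?D * a \<le> (a + g) * (?D - 1 + 1 / ?D)"
      using a ag by (intro order_trans[OF iso] mult_left_mono lg) simp
    also have "\<dots> < a * (2 + 1 / ?D) * (?D - 1 + 1 / ?D)"
      using lt D by (intro mult_strict_right_mono) (auto simp: add_pos_nonneg)
    also have "\<dots> = a * (2 * ?D - 1 + 1 / ?D + 1 / ?D * (1 / ?D))" using D by (simp add: field_simps)
    also have "\<dots> \<le> a * (2 * ?D)"
    proof (intro mult_left_mono)
      have "1 / ?D \<le> 1 / 2" using D by (intro frac_le) auto
      moreover have "1 / ?D * (1 / ?D) \<le> 1 / 2 * 1" using D calculation by (intro mult_mono) auto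
      ultimately show "2 * ?D - 1 + 1 / ?D + 1 / ?D * (1 / ?D) \<le> 2 * ?D" by linarith
    qed (use a in simp)
    finally show False by simp
  qed
  then have t: "a / ?D \<le> g - a" by simp
  moreover have "a / ?D > 0" using a D by simp
  ultimately show t0: "g - a > 0" by linarith
  have "a \<le> ?D * (g - a)" using t D by (simp add: field_simps)
  moreover have "1 * (g - a) \<le> ?D * (g - a)" using D t0 by (intro mult_right_mono) auto
  ultimately show "g \<le> 2 * ?D * (g - a)" by simp
qed

text \<open>For a polynomially small neighbourhood \<open>a + g \<le> d ^ 4\<close>, so the
  logarithm in the isoperimetric inequality is at most
  \<open>4 * \<Lambda> / ln 2 \<le> 8 * \<Lambda>\<close>.\<close>

lemma small_cluster_expansion:
  assumes C: "C \<in> clusters v" and g: "card (NS C) < d ^ 3"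
  shows "real (card C) \<le> 8 * \<Lambda> / real d * card (NS C)"
proof -
  let ?a = "real (card (cl C))" and ?g = "real (card (NS C))" and ?D = "real d"
  have a: "?a > 0" using cluster_facts(4,5)[OF C] by simp
  have ag: "?a \<le> ?g" using cluster_facts(6)[OF C] by simp
  have "real (card (NS C)) \<le> real (d ^ 3)" using g by (intro of_nat_mono) simp
  then have "?g \<le> ?D ^ 3" by simp
  then have "?a + ?g \<le> 2 * ?D ^ 3" using ag by linarith
  also have "\<dots> \<le> ?D * ?D ^ 3" using d_ge by (intro mult_right_mono) auto
  finally have "?a + ?g \<le> ?D ^ 4" by (simp add: power_add[symmetric] eval_nat_numeral)
  then have "log 2 (?a + ?g) \<le> log 2 (?D ^ 4)" using a ag d_ge by (subst log_le_cancel_iff) auto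
  also have "\<dots> = 4 * \<Lambda> / ln 2" using d_ge by (simp add: log_def ln_realpow \<Lambda>_def)
  also have "\<dots> \<le> 4 * \<Lambda> / (1 / 2)"
    using ln2_ge_two_thirds q(5) by (intro divide_left_mono) auto
  finally have lg: "log 2 (?a + ?g) \<le> 8 * \<Lambda>" by simp
  have "2 * ?D * ?a \<le> (?a + ?g) * (8 * \<Lambda>)"
    by (intro order_trans[OF cluster_facts(8)[OF C]] mult_left_mono lg) simp
  also have "\<dots> \<le> (2 * ?g) * (8 * \<Lambda>)" using ag q(5) by (intro mult_right_mono) auto
  finally have "?D * ?a \<le> 8 * \<Lambda> * ?g" by simp
  moreover have "?D * real (card C) \<le> ?D * ?a" using cluster_facts(5)[OF C] by (intro mult_left_mono) auto
  ultimately have "?D * real (card C) \<le> 8 * \<Lambda> * ?g" by linarith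
  then show ?thesis using d_ge by (simp add: field_simps)
qed

text \<open>Counting the clusters costs at most \<open>q\<close> further factors
  \<open>1 + l\<close> per vertex. Since \<open>s \<le> 8 * \<Lambda> * g / d\<close>, the total
  \<open>s * (1 + q)\<close> is only a small part of \<open>g\<close>, so the exponent is worst at
  \<open>g = d\<close>.\<close>

lemma small_clusters_sum:
  assumes v: "v \<in> L"
  shows "(\<Sum>C\<in>{C \<in> clusters v. card (NS C) < d ^ 3}. l ^ card C / (1 + l) ^ card (NS C)) \<le>
    exp (- \<beta> * (real d - q\<^sup>2)) / 2"
proof -
  let ?F = "{C \<in> clusters v. card (NS C) < d ^ 3}" and ?D = "real d"
  let ?M = "exp (- \<beta> * (?D - 8 * \<Lambda> * (1 + q)))"
  have q0: "q > 0" using q(1) by simp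
  have b0: "\<beta> > 0" by (rule \<beta>_pos)
  have "sum (\<lambda>C. l ^ card C / (1 + l) ^ card (NS C)) ?F \<le> card ({..<d ^ 3} \<times> {..<d ^ 3}) * ?M"
  proof (rule sum_by_key[where key = "\<lambda>C. (card C, card (NS C))"])
    show "finite ?F" using finite_clusters by simp
    show "(\<lambda>C. (card C, card (NS C))) ` ?F \<subseteq> {..<d ^ 3} \<times> {..<d ^ 3}"
      using cluster_facts(5,6) by fastforce
    fix k :: "nat \<times> nat"
    obtain s g where k: "k = (s, g)" by (cases k)
    let ?G = "{C \<in> ?F. (card C, card (NS C)) = k}"
    show "(\<Sum>C\<in>?G. l ^ card C / (1 + l) ^ card (NS C)) \<le> ?M"
    proof (cases "?G = {}")
      case False
      then obtain C where C: "C \<in> clusters v" "card (NS C) < d ^ 3" "card C = s" "card (NS C) = g"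
        using k by auto
      have s: "s > 0" using cluster_facts(4)[OF C(1)] C by simp
      have sg: "real s \<le> 8 * \<Lambda> / ?D * g" using small_cluster_expansion[OF C(1,2)] C by simp
      have gd: "?D \<le> g" using cluster_facts(7)[OF C(1)] C by simp
      have "(\<Sum>C\<in>?G. l ^ card C / (1 + l) ^ card (NS C)) = (\<Sum>C\<in>?G. l ^ card C) / (1 + l) ^ g"
        unfolding sum_divide_distrib using k by (intro sum.cong) auto
      also have "(\<Sum>C\<in>?G. l ^ card C) \<le> (32 * (?D + 1)) ^ (16 * (s - 1) + 1) * (1 + l) ^ s"
        using cluster_facts(1-3) k l_pos s by (intro connected_sum_bound[OF v]) auto
      also have "(32 * (?D + 1)) ^ (16 * (s - 1) + 1) \<le> (32 * (?D + 1)) ^ (16 * s)"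
        using s by (intro power_increasing) auto
      also have "\<dots> = exp (real (16 * s) * ln (32 * (?D + 1)))"
        unfolding exp_of_nat_mult by simp
      also have "\<dots> \<le> exp (\<beta> * q * s)"
      proof -
        have "real (16 * s) * ln (32 * (?D + 1)) \<le> real (16 * s) * (2 * \<Lambda>)"
          using ln_base by (intro mult_left_mono) auto
        also have "\<dots> \<le> s * (1500 * \<Lambda>)" using q(5) s by simp
        also have "\<dots> \<le> s * (\<beta> * q)" using \<beta>_q by (intro mult_left_mono) auto
        finally show ?thesis by (simp add: mult_ac)
      qed
      also have "(1 + l) ^ s = exp (\<beta> * s)" using l_pos by (simp add: exp_\<beta> powr_realpow)
      also have "exp (\<beta> * q * s) * exp (\<beta> * s) / (1 + l) ^ g = exp (\<beta> * (s * (1 + q) - g))"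
      proof -
        have "(1 + l) ^ g = exp (\<beta> * g)" using l_pos by (simp add: exp_\<beta> powr_realpow)
        then show ?thesis by (simp add: exp_add[symmetric] exp_diff[symmetric] algebra_simps)
      qed
      also have "\<dots> \<le> ?M"
      proof -
        let ?c = "8 * \<Lambda> * (1 + q) / ?D"
        have "8 * \<Lambda> * (1 + q) \<le> q\<^sup>2" using q by linarith
        also have "\<dots> \<le> q ^ 3" using q by (intro power_increasing) auto
        finally have c1: "?c \<le> 1" unfolding q3 using q0 by simp
        have "s * (1 + q) \<le> 8 * \<Lambda> / ?D * g * (1 + q)" using sg q0 by (intro mult_right_mono) auto
        then have "s * (1 + q) - g \<le> - (g * (1 - ?c))" by (simp add: algebra_simps)
        also have "\<dots> \<le> - (?D * (1 - ?c))" using gd c1 by (simp add: mult_right_mono)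
        also have "\<dots> = - (?D - 8 * \<Lambda> * (1 + q))" using d_ge by (simp add: field_simps)
        finally have "\<beta> * (s * (1 + q) - g) \<le> \<beta> * (- (?D - 8 * \<Lambda> * (1 + q)))"
          using b0 by (intro mult_left_mono) auto
        then show ?thesis by (simp only: exp_le_cancel_iff mult_minus_left mult_minus_right)
      qed
      finally show ?thesis using l_pos by (simp add: divide_right_mono mult_right_mono)
    next
      case True
      then show ?thesis by (simp only: sum.empty exp_ge_zero)
    qed
  qed simp
  \<comment> \<open>The number of keys is \<open>d ^ 6\<close>. It is absorbed by the slack
    \<open>2 * q\<close> in the fourth condition of \<open>good\<close>, and so is the factor
    \<open>exp (- 1)\<close>, which supplies the 1/2 needed to share the bound with the large
    clusters.\<close>
  also have "real (card ({..<d ^ 3} \<times> {..<d ^ 3})) = exp (6 * \<Lambda>)"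
  proof -
    have "real (card ({..<d ^ 3} \<times> {..<d ^ 3})) = ?D ^ 6" by (simp add: power_add[symmetric])
    also have "\<dots> = exp \<Lambda> ^ 6" using d_ge by (simp add: \<Lambda>_def)
    finally show ?thesis by (simp add: exp_of_nat_mult[symmetric])
  qed
  also have "exp (6 * \<Lambda>) * ?M \<le> exp (- \<beta> * (?D - q\<^sup>2)) * exp (- 1)"
    unfolding exp_add[symmetric] exp_le_cancel_iff
  proof -
    have "\<beta> * (8 * \<Lambda> * (1 + q) + 2 * q) \<le> \<beta> * q\<^sup>2" using q(4) b0 by (intro mult_left_mono) auto
    moreover have "6 * \<Lambda> + 1 \<le> 2 * (\<beta> * q)" using \<beta>_q q(5) by linarith
    ultimately show "6 * \<Lambda> + - \<beta> * (?D - 8 * \<Lambda> * (1 + q)) \<le> - \<beta> * (?D - q\<^sup>2) + - 1"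
      by (simp add: algebra_simps)
  qed
  also have "\<dots> \<le> exp (- \<beta> * (?D - q\<^sup>2)) * (1 / 2)"
  proof (intro mult_left_mono)
    have "exp (1::real) \<ge> 2" using exp_ge_add_one_self[of 1] by simp
    then show "exp (- 1) \<le> 1 / (2::real)" by (simp add: exp_minus field_simps)
  qed simp
  finally show ?thesis by simp
qed

text \<open>A neighbourhood of size at least \<open>d ^ 3\<close> forces
  \<open>t \<ge> d ^ 2 / 2 = q ^ 6 / 2\<close>. Each pair of sizes then contributes at most
  \<open>exp (- 9 / 2 * \<beta> * q ^ 5)\<close> up to a factor 2, and
  \<open>\<beta> * q ^ 5 \<ge> 1500 * q ^ 4\<close> beats the \<open>4 ^ d\<close> pairs.\<close>

lemma large_clusters_sum:
  assumes v: "v \<in> L"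
  shows "(\<Sum>C\<in>{C \<in> clusters v. card (NS C) \<ge> d ^ 3}. l ^ card C / (1 + l) ^ card (NS C)) \<le>
    exp (- \<beta> * (real d - q\<^sup>2)) / 2"
proof -
  let ?F = "{C \<in> clusters v. card (NS C) \<ge> d ^ 3}" and ?D = "real d"
  let ?M = "2 * exp (- (9 / 2 * \<beta> * q ^ 5))"
  let ?K = "{..<2 ^ d} \<times> {..<2 ^ d} :: (nat \<times> nat) set"
  have q0: "q > 0" using q(1) by simp
  have b0: "\<beta> > 0" by (rule \<beta>_pos)
  \<comment> \<open>A larger threshold makes \<open>U\<close> and \<open>W\<close> cheaper but the
    container less accurate; \<open>q ^ 2\<close> balances the cost
    \<open>t * \<Lambda> / \<psi>\<close> against the loss
    \<open>\<beta> * t * \<psi> / d\<close>.\<close>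
  define \<psi> where "\<psi> = nat \<lceil>q\<^sup>2\<rceil>"
  have "q * q \<ge> 100 * 100" using q by (intro mult_mono) auto
  then have qq: "q\<^sup>2 \<ge> 10000" by (simp add: power2_eq_square)
  have \<psi>: "q\<^sup>2 \<le> \<psi>" "\<psi> \<le> 2 * q\<^sup>2" using qq unfolding \<psi>_def by linarith+
  have "4 * q\<^sup>2 \<le> q * q\<^sup>2" using q by (intro mult_right_mono) auto
  then have "real (2 * \<psi>) \<le> ?D" using \<psi> by (simp add: q3 power3_eq_cube power2_eq_square)
  then have \<psi>d: "2 * \<psi> \<le> d" by (simp only: of_nat_le_iff)
  have "real \<psi> > 0" using \<psi> qq by linarith
  then have \<psi>0: "\<psi> > 0" by simp
  have "sum (\<lambda>C. l ^ card C / (1 + l) ^ card (NS C)) ?F \<le> card ?K * ?M"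
  proof (rule sum_by_key[where key = "\<lambda>C. (card (cl C), card (NS C))"])
    show "finite ?F" using finite_clusters by simp
    have "(2::nat) ^ (d - 1) < 2 ^ d" using d_pos by (intro power_strict_increasing) auto
    then have "card (cl C) < 2 ^ d \<and> card (NS C) < 2 ^ d" if "C \<in> clusters v" for C
      using cluster_facts(6,10)[OF that] by linarith
    then show "(\<lambda>C. (card (cl C), card (NS C))) ` ?F \<subseteq> ?K" by auto
    fix k :: "nat \<times> nat"
    obtain a g where k: "k = (a, g)" by (cases k)
    let ?G = "{C \<in> ?F. (card (cl C), card (NS C)) = k}"
    show "(\<Sum>C\<in>?G. l ^ card C / (1 + l) ^ card (NS C)) \<le> ?M"
    proof (cases "?G = {}")
      case False
      then obtain C where C: "C \<in> clusters v" "card (NS C) \<ge> d ^ 3" "card (cl C) = a" "card (NS C) = g"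
        using k by auto
      define t where "t = real g - real a"
      have t: "t > 0" "g \<le> 2 * ?D * t" using cluster_expansion[OF C(1)] C unfolding t_def by auto
      have "?D ^ 3 \<le> g" using C by (metis of_nat_le_iff of_nat_power)
      then have "?D ^ 3 \<le> 2 * ?D * t" using t by linarith
      then have "?D ^ 2 / 2 \<le> t" using d_ge by (simp add: power3_eq_cube power2_eq_square)
      then have tq: "q ^ 6 / 2 \<le> t" by (simp add: q3 power_mult[symmetric])
      define y where "y = 32 * t * (1 + ln (2 * ?D)) / d + 5 * t / \<psi>"
      have y: "y \<le> 6 * t / q\<^sup>2"
      proof -
        have "32 * t * (1 + ln (2 * ?D)) / d \<le> t * q / q ^ 3"
          using mult_left_mono[OF q(3), of t] t q0 unfolding q3[symmetric]
          by (intro divide_right_mono) (auto simp: mult_ac)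
        also have "\<dots> = t / q\<^sup>2" using q0 by (simp add: power3_eq_cube power2_eq_square)
        finally have "32 * t * (1 + ln (2 * ?D)) / d \<le> t / q\<^sup>2" .
        moreover have "5 * t / \<psi> \<le> 5 * t / q\<^sup>2" using \<psi> q0 t \<psi>0 by (intro divide_left_mono) auto
        moreover have "6 * t / q\<^sup>2 = t / q\<^sup>2 + 5 * t / q\<^sup>2" by (simp add: add_divide_distrib[symmetric])
        ultimately show ?thesis unfolding y_def by linarith
      qed
      let ?B = "32 * (?D + 1)"
      have "(\<Sum>C\<in>?G. l ^ card C / (1 + l) ^ card (NS C)) = (\<Sum>C\<in>?G. l ^ card C) / (1 + l) ^ g"
        unfolding sum_divide_distrib using k by (intro sum.cong) auto
      \<comment> \<open>The fraction \<open>\<gamma> = 20 / q\<close> is twice the inaccuracy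
        \<open>5 * \<psi> / d \<le> 10 / q\<close> of the container.\<close>
      also have "(\<Sum>C\<in>?G. l ^ card C) \<le>
          ?B powr (16 * y + 1) * (1 + l) powr (g - 20 / q * t + 5 * t * \<psi> / d) +
          ?B powr (16 * (y + 20 / q * t) + 1) * (1 + l) powr a"
        unfolding y_def t_def
      proof (rule container_sum_bound[OF v])
        show "real g - real a > 0" "real g \<le> 2 * ?D * (real g - real a)" using t by (auto simp: t_def)
        show "A \<subseteq> L \<and> linked A \<and> v \<in> A \<and> card (cl A) = a \<and> card (NS A) = g" if "A \<in> ?G" for A
          using that cluster_facts(1-3) k by auto
      qed (use l_pos d_ge \<psi>d \<psi>0 q in auto)
      also have "\<dots> / (1 + l) ^ g = exp ((16 * y + 1) * ln ?B + \<beta> * (- (20 / q * t) + 5 * t * \<psi> / q ^ 3)) +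
          exp ((16 * (y + 20 / q * t) + 1) * ln ?B - \<beta> * t)"
      proof -
        have B: "?B powr x = exp (x * ln ?B)" for x using d_ge by (simp add: powr_def)
        have g: "(1 + l) ^ g = exp (\<beta> * g)" using l_pos by (simp add: exp_\<beta> powr_realpow)
        show ?thesis unfolding B exp_\<beta>[symmetric] g add_divide_distrib exp_add[symmetric] exp_diff[symmetric] q3[symmetric]
          by (simp add: algebra_simps t_def)
      qed
      also have "\<dots> \<le> exp (- (9 * \<beta> * t / q)) + exp (- (9 * \<beta> * t / q))"
        using container_term_1[OF q(1) \<beta>_q q(5) tq y ln_base \<psi>(2)]
          container_term_2[OF q(1) \<beta>_q q(5) tq y ln_base]
        by (intro add_mono) simp_all
      also have "\<dots> \<le> ?M"
      proof -
        have "9 * \<beta> * (q ^ 6 / 2) / q \<le> 9 * \<beta> * t / q"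
          using tq b0 q0 by (intro divide_right_mono mult_left_mono) auto
        also have "9 * \<beta> * (q ^ 6 / 2) / q = 9 / 2 * \<beta> * q ^ 5"
          using q0 by (simp add: eval_nat_numeral)
        finally show ?thesis by simp
      qed
      finally show ?thesis using l_pos by (simp add: divide_right_mono)
    next
      case True
      have "0 \<le> ?M" by simp
      then show ?thesis unfolding True sum.empty .
    qed
  qed simp
  also have "card ?K * ?M \<le> exp (2 * ?D) * (exp 1 * exp (- (9 / 2 * \<beta> * q ^ 5)))"
  proof (intro mult_mono)
    have "real (card ?K) = (2 ^ d) ^ 2" by (simp add: power2_eq_square)
    also have "\<dots> \<le> (exp 1 ^ d) ^ 2" using exp_ge_add_one_self[of 1] by (intro power_mono) auto
    also have "\<dots> = exp (2 * ?D)" by (simp add: exp_of_nat_mult[symmetric] power_mult[symmetric] mult.commute)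
    finally show "real (card ?K) \<le> exp (2 * ?D)" .
    show "2 \<le> exp (1::real)" using exp_ge_add_one_self[of 1] by simp
  qed auto
  also have "\<dots> = exp (2 * ?D + 1 - 9 / 2 * \<beta> * q ^ 5)" by (simp add: exp_add[symmetric])
  also have "\<dots> \<le> exp (- \<beta> * (?D - q\<^sup>2) - 1)" unfolding exp_le_cancel_iff
  proof -
    have "\<beta> * q ^ 5 = \<beta> * q * q ^ 4" by (simp add: eval_nat_numeral)
    also have "\<dots> \<ge> 1500 * q ^ 4" using \<beta>_q q(5) q0 by (intro mult_right_mono) auto
    finally have 1: "1500 * q ^ 4 \<le> \<beta> * q ^ 5" .
    have "q ^ 3 \<le> q ^ 4" "1 \<le> q ^ 4" using q by (auto intro: power_increasing one_le_power)
    then have "2 * ?D + 2 \<le> \<beta> * q ^ 5" using 1 unfolding q3 by linarith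
    moreover have "\<beta> * (?D - q\<^sup>2) \<le> \<beta> * q ^ 5"
    proof (intro mult_left_mono)
      have "q ^ 3 \<le> q ^ 5" using q by (intro power_increasing) auto
      then show "?D - q\<^sup>2 \<le> q ^ 5" unfolding q3 using qq by linarith
    qed (use b0 in simp)
    moreover have "0 \<le> \<beta> * q ^ 5" using b0 q0 by simp
    moreover have "9 / 2 * \<beta> * q ^ 5 = 9 / 2 * (\<beta> * q ^ 5)" "- \<beta> * (?D - q\<^sup>2) = - (\<beta> * (?D - q\<^sup>2))" by auto
    ultimately show "2 * ?D + 1 - 9 / 2 * \<beta> * q ^ 5 \<le> - \<beta> * (?D - q\<^sup>2) - 1" by linarith
  qed
  also have "\<dots> = exp (- \<beta> * (?D - q\<^sup>2)) / exp 1" by (rule exp_diff)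
  also have "\<dots> \<le> exp (- \<beta> * (?D - q\<^sup>2)) / 2"
    using exp_ge_add_one_self[of 1] by (intro divide_left_mono) auto
  finally show ?thesis .
qed

lemma clusters_sum:
  assumes v: "v \<in> L"
  shows "(\<Sum>C\<in>clusters v. l ^ card C / (1 + l) ^ card (NS C)) \<le> (1 + l) powr (- (real d - q\<^sup>2))"
proof -
  let ?f = "\<lambda>C. l ^ card C / (1 + l) ^ card (NS C)"
  have "clusters v = {C \<in> clusters v. card (NS C) < d ^ 3} \<union> {C \<in> clusters v. card (NS C) \<ge> d ^ 3}" by auto
  then have "sum ?f (clusters v) = sum ?f \<dots>" by simp
  also have "\<dots> = sum ?f {C \<in> clusters v. card (NS C) < d ^ 3} + sum ?f {C \<in> clusters v. card (NS C) \<ge> d ^ 3}"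
    using finite_clusters by (intro sum.union_disjoint) auto
  also have "\<dots> \<le> exp (- \<beta> * (real d - q\<^sup>2))"
    using small_clusters_sum[OF v] large_clusters_sum[OF v] by simp
  also have "\<dots> = (1 + l) powr (- (real d - q\<^sup>2))" using exp_\<beta>[of "- (real d - q\<^sup>2)"]
    by (simp only: mult_minus_left mult_minus_right)
  finally show ?thesis .
qed

lemma cluster_weight:
  assumes v: "v \<in> L"
  shows "weight l (\<lambda>I. v \<in> I \<and> small (I \<inter> L)) \<le> (1 + l) powr (- (real d - q\<^sup>2)) * weight l (\<lambda>_. True)"
  using l_pos
  by (intro order_trans[OF small_weight_le[OF l_pos v]] mult_right_mono clusters_sum[OF v] weight_nonneg) simp

text \<open>Two facts suffice: \<open>\<beta> * q ^ 2 \<ge> 2 * \<Lambda>\<close>, so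
  \<open>q ^ 2\<close> units of the exponent are worth a factor \<open>d ^ 2\<close>, and
  \<open>(1 + l) / l \<le> d\<close>, because \<open>l > 1 / q\<close>. In the third bound the
  prefactor is paid with another \<open>q ^ 2\<close> units, leaving
  \<open>d - 2 * q ^ 2 = d * (1 - 2 / q)\<close>.\<close>

lemma error_bounds:
  fixes \<eta> :: real
  defines "\<eta> \<equiv> (1 + l) powr (- (real d - q\<^sup>2))"
  shows "d * \<eta> \<le> 1 / 4" "4 * (d * \<eta> + (1 + l) / l * \<eta>) \<le> 8 / d"
    "8 * \<eta> * (1 + l) / l \<le> (1 + l) powr (- (real d * (1 - 2 / q)))"
proof -
  let ?D = "real d"
  have q0: "q > 0" using q(1) by simp
  have \<eta>: "\<eta> = exp (- (\<beta> * (?D - q\<^sup>2)))" unfolding \<eta>_def exp_\<beta>[symmetric] by (simp add: algebra_simps)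
  have \<eta>0: "\<eta> > 0" by (simp add: \<eta>)
  have "q * 100 \<le> q * q" using q(1) q0 by (intro mult_left_mono) auto
  then have q1: "q \<le> q\<^sup>2" using q0 unfolding power2_eq_square by linarith
  have "2 * q\<^sup>2 \<le> q * q\<^sup>2" using q(1) by (intro mult_right_mono) auto
  then have q2: "q\<^sup>2 \<le> ?D - q\<^sup>2" by (simp add: q3 power3_eq_cube power2_eq_square)
  have "\<beta> * q \<le> \<beta> * q\<^sup>2" using q1 \<beta>_pos by (intro mult_left_mono) auto
  then have bq: "2 * \<Lambda> \<le> \<beta> * q\<^sup>2" using \<beta>_q q(5) by linarith
  have D2: "exp (2 * \<Lambda>) = ?D * ?D"
    using d_ge exp_of_nat_mult[of 2 \<Lambda>] by (simp add: \<Lambda>_def power2_eq_square)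
  have "\<beta> * q\<^sup>2 \<le> \<beta> * (?D - q\<^sup>2)" using q2 \<beta>_pos by (intro mult_left_mono) auto
  then have "\<eta> \<le> exp (- (2 * \<Lambda>))" unfolding \<eta> using bq by simp
  then have \<eta>D: "\<eta> \<le> 1 / (?D * ?D)" by (simp add: exp_minus D2 inverse_eq_divide)
  have dn: "?D * \<eta> \<le> ?D * (1 / (?D * ?D))" using \<eta>D by (intro mult_left_mono) auto
  then have dn: "?D * \<eta> \<le> 1 / ?D" using d_ge by simp
  also have "\<dots> \<le> 1 / 4" using d_ge by (intro frac_le) auto
  finally show "d * \<eta> \<le> 1 / 4" .
  have ll: "(1 + l) / l \<le> ?D"
  proof -
    have "1 / q \<le> 3000 * \<Lambda> / q" using q(5) q0 by (intro divide_right_mono) auto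
    also have "\<dots> < l" using l by (simp add: q_def \<Lambda>_def)
    finally have "1 / l \<le> q" using q0 l_pos by (simp add: field_simps)
    also have "\<dots> \<le> ?D - 1" using q1 q2 d_ge q(1) by (smt (verit) q3)
    finally show ?thesis using l_pos by (simp add: add_divide_distrib)
  qed
  have "(1 + l) / l * \<eta> \<le> ?D * \<eta>" using ll \<eta>0 by (intro mult_right_mono) auto
  then show "4 * (d * \<eta> + (1 + l) / l * \<eta>) \<le> 8 / d" using dn by simp
  have "8 * \<eta> * (1 + l) / l = 8 * ((1 + l) / l * \<eta>)" by simp
  also have "\<dots> \<le> 8 * (?D * \<eta>)" using ll \<eta>0 by (intro mult_left_mono mult_right_mono) auto
  also have "\<dots> = (8 * ?D) * \<eta>" by simp
  also have "\<dots> \<le> (?D * ?D) * \<eta>" using d_ge \<eta>0 by (intro mult_right_mono) auto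
  also have "\<dots> \<le> exp (\<beta> * q\<^sup>2) * \<eta>" unfolding D2[symmetric] using bq \<eta>0 by (intro mult_right_mono) auto
  also have "\<dots> = exp (\<beta> * (- (?D * (1 - 2 / q))))"
    unfolding \<eta> exp_add[symmetric] using q0
    by (simp add: q3 algebra_simps power3_eq_cube power2_eq_square)
  also have "\<dots> = (1 + l) powr (- (?D * (1 - 2 / q)))" by (rule exp_\<beta>)
  finally show "8 * \<eta> * (1 + l) / l \<le> (1 + l) powr (- (?D * (1 - 2 / q)))" .
qed

end

end

section \<open>The discrete hypercube\<close>

context regular_bipartite
begin

text \<open>Images under a side-exchanging automorphism. As \<open>f\<close> is an involution, the
  same map serves as both directions of the bijection.\<close>

lemma side_symmetry:
  assumes inv: "\<And>x. x \<in> L \<union> R \<Longrightarrow> f (f x) = x" and fL: "f ` L \<subseteq> R" and fR: "f ` R \<subseteq> L"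
    and fN: "\<And>x. x \<in> L \<union> R \<Longrightarrow> N (f x) = f ` N x"
  shows "weight l (\<lambda>I. small (I \<inter> L)) = weight l (\<lambda>I. small_R (I \<inter> R))"
proof -
  interpret sw: regular_bipartite R L N d by (rule swap)
  have fV: "f x \<in> L \<union> R" if "x \<in> L \<union> R" for x using that fL fR by blast
  have inj: "inj_on f (L \<union> R)" by (rule inj_on_inverseI[of _ f]) (rule inv)
  have ff: "f ` f ` A = A" if "A \<subseteq> L \<union> R" for A
    using that inv by (force simp: image_iff)
  have fLR: "f x \<in> R \<longleftrightarrow> x \<in> L" if "x \<in> L \<union> R" for x
    using that fL fR disjoint by blast
  have NSf: "NS (f ` A) = f ` NS A" if "A \<subseteq> L \<union> R" for A
    using that fN unfolding NS_def by (auto simp: subset_iff)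
  have indep: "f ` I \<in> indeps" if "I \<in> indeps" for I
  proof -
    have I: "I \<subseteq> L \<union> R" "\<And>x y. x \<in> I \<Longrightarrow> y \<in> I \<Longrightarrow> y \<notin> N x" using that by (auto simp: indeps_def)
    have "f y \<notin> N (f x)" if xy: "x \<in> I" "y \<in> I" for x y
    proof
      assume "f y \<in> N (f x)"
      moreover have xV: "x \<in> L \<union> R" using xy(1) I(1) by blast
      ultimately obtain z where z: "z \<in> N x" "f y = f z" using fN[of x] by auto
      have "y \<in> L \<union> R" "z \<in> L \<union> R" using xy(2) I(1) z(1) N_subset[OF xV] by blast+
      then have "y = z" using inj_onD[OF inj z(2)] by blast
      then show False using I(2) xy z by blast
    qed
    then show ?thesis using I(1) fV by (auto simp: indeps_def)
  qed
  have small: "small_R (f ` I \<inter> R) \<longleftrightarrow> small (I \<inter> L)" if "I \<in> indeps" for I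
  proof -
    have IV: "I \<subseteq> L \<union> R" using that by (auto simp: indeps_def)
    let ?A = "I \<inter> L"
    have eq: "f ` I \<inter> R = f ` ?A" using IV fLR by auto
    have "sw.cl (f ` ?A) = f ` cl ?A"
    proof (intro equalityI subsetI)
      fix w assume "w \<in> sw.cl (f ` ?A)"
      then have w: "w \<in> R" "N w \<subseteq> f ` NS ?A" using NSf[of ?A] by (auto simp: sw.cl_def)
      have "N (f w) = f ` N w" using fN w by auto
      also have "\<dots> \<subseteq> f ` f ` NS ?A" using w(2) by (rule image_mono)
      also have "\<dots> = NS ?A" using NS_L[of ?A] by (intro ff) auto
      finally have "f w \<in> cl ?A" using w fR by (auto simp: cl_def)
      then show "w \<in> f ` cl ?A" using inv[of w] w by (metis UnI2 imageI)
    next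
      fix w assume "w \<in> f ` cl ?A"
      then obtain u where u: "u \<in> L" "N u \<subseteq> NS ?A" "w = f u" by (auto simp: cl_def)
      have "N w = f ` N u" using fN[of u] u by auto
      also have "\<dots> \<subseteq> NS (f ` ?A)" using NSf[of ?A] u(2) by auto
      finally show "w \<in> sw.cl (f ` ?A)" using u fL by (auto simp: sw.cl_def)
    qed
    moreover have "inj_on f (cl ?A)" by (rule inj_on_subset[OF inj]) (use cl_subset in blast)
    ultimately have "card (sw.cl (f ` ?A)) = card (cl ?A)" by (simp add: card_image)
    then show ?thesis unfolding eq sw.small_def small_def card_L_eq_R by simp
  qed
  show ?thesis unfolding weight_def
  proof (rule sum.reindex_bij_witness[of _ "(`) f" "(`) f"])
    fix I assume I: "I \<in> {I \<in> indeps. small (I \<inter> L)}"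
    then show "f ` f ` I = I" by (intro ff) (auto simp: indeps_def)
    show "f ` I \<in> {I \<in> indeps. small_R (I \<inter> R)}" using I indep small by auto
    have "I \<subseteq> L \<union> R" using I by (auto simp: indeps_def)
    then show "l ^ card (f ` I) = l ^ card I" using inj by (metis card_image inj_on_subset)
  next
    fix I assume I: "I \<in> {I \<in> indeps. small_R (I \<inter> R)}"
    then show fI: "f ` f ` I = I" by (intro ff) (auto simp: indeps_def)
    have "small (f ` I \<inter> L) \<longleftrightarrow> small_R (f ` f ` I \<inter> R)" using small[of "f ` I"] indep I by auto
    then show "f ` I \<in> {I \<in> indeps. small (I \<inter> L)}" using I indep fI by auto
  qed
qed

end

section \<open>The cube as a regular bipartite graph, by induction on the first coordinate\<close>

definition cube_nbrs :: "nat \<Rightarrow> bool list \<Rightarrow> bool list set" where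
  "cube_nbrs d x = {y. cube_adj d x y}"

lemma card_less_Suc_split:
  "card {i. i < Suc d \<and> P i} = of_bool (P 0) + card {i. i < d \<and> P (Suc i)}"
proof -
  have "{i. i < Suc d \<and> P i} = (if P 0 then {0} else {}) \<union> Suc ` {i. i < d \<and> P (Suc i)}"
    by (auto simp: less_Suc_eq_0_disj)
  also have "card \<dots> = card (if P 0 then {0::nat} else {}) + card (Suc ` {i. i < d \<and> P (Suc i)})"
    by (rule card_Un_disjoint) auto
  finally show ?thesis by (simp add: card_image)
qed

lemma cube_verts_Suc: "cube_verts (Suc d) = (\<Union>b. (#) b ` cube_verts d)"
  by (auto simp: cube_verts_def length_Suc_conv)

lemma cube_adj_Cons:
  "cube_adj (Suc d) (b # x) (c # y) \<longleftrightarrow>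
    (b = c \<and> cube_adj d x y) \<or> (b \<noteq> c \<and> x = y \<and> x \<in> cube_verts d)"
proof -
  have "card {i. i < d \<and> x ! i \<noteq> y ! i} = 0 \<longleftrightarrow> x = y" if "length x = d" "length y = d"
    using that by (auto intro: nth_equalityI)
  then show ?thesis unfolding cube_adj_def
    by (auto simp: card_less_Suc_split cube_verts_def)
qed

lemma cube_nbrs_Cons:
  assumes "x \<in> cube_verts d"
  shows "cube_nbrs (Suc d) (b # x) = insert ((\<not> b) # x) ((#) b ` cube_nbrs d x)"
proof -
  have "y \<in> cube_nbrs (Suc d) (b # x) \<longleftrightarrow> y \<in> insert ((\<not> b) # x) ((#) b ` cube_nbrs d x)" for y
  proof (cases y)
    case Nil
    then show ?thesis by (auto simp: cube_nbrs_def cube_adj_def cube_verts_def)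
  next
    case (Cons c z)
    then show ?thesis using assms by (auto simp: cube_nbrs_def cube_adj_Cons)
  qed
  then show ?thesis by blast
qed

lemma cube_nbrs_subset: "cube_nbrs d x \<subseteq> cube_verts d"
  by (auto simp: cube_nbrs_def cube_adj_def)

lemma cube_nbrs_sym: "y \<in> cube_nbrs d x \<Longrightarrow> x \<in> cube_nbrs d y"
proof -
  have "{i. i < d \<and> y ! i \<noteq> x ! i} = {i. i < d \<and> x ! i \<noteq> y ! i}" by auto
  then show "y \<in> cube_nbrs d x \<Longrightarrow> x \<in> cube_nbrs d y" by (simp add: cube_nbrs_def cube_adj_def)
qed

lemma finite_cube_nbrs: "finite (cube_nbrs d x)"
  using cube_nbrs_subset finite_cube_verts finite_subset by blast

lemma card_cube_nbrs: "x \<in> cube_verts d \<Longrightarrow> card (cube_nbrs d x) = d"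
proof (induction d arbitrary: x)
  case 0
  then show ?case by (auto simp: cube_nbrs_def cube_adj_def)
next
  case (Suc d)
  then obtain b z where x: "x = b # z" "z \<in> cube_verts d" by (auto simp: cube_verts_Suc)
  then show ?case using Suc.IH[OF x(2)]
    by (simp add: cube_nbrs_Cons card_insert_if finite_cube_nbrs card_image image_iff)
qed

lemma cube_codegree:
  "x \<in> cube_verts d \<Longrightarrow> y \<in> cube_verts d \<Longrightarrow> x \<noteq> y \<Longrightarrow> card (cube_nbrs d x \<inter> cube_nbrs d y) \<le> 2"
proof (induction d arbitrary: x y)
  case 0
  then show ?case by (auto simp: cube_verts_def)
next
  case (Suc d)
  then obtain b x' c y' where xy: "x = b # x'" "x' \<in> cube_verts d" "y = c # y'" "y' \<in> cube_verts d"
    by (auto simp: cube_verts_Suc)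
  show ?case
  proof (cases "b = c")
    case True
    then have "cube_nbrs (Suc d) x \<inter> cube_nbrs (Suc d) y = (#) b ` (cube_nbrs d x' \<inter> cube_nbrs d y')"
      using xy Suc.prems by (auto simp: cube_nbrs_Cons)
    moreover have "card (cube_nbrs d x' \<inter> cube_nbrs d y') \<le> 2"
      using Suc.IH[of x' y'] xy True Suc.prems by auto
    ultimately show ?thesis by (simp add: card_image)
  next
    case False
    then have "cube_nbrs (Suc d) x \<inter> cube_nbrs (Suc d) y \<subseteq> {b # y', c # x'}"
      using xy by (auto simp: cube_nbrs_Cons)
    then have "card (cube_nbrs (Suc d) x \<inter> cube_nbrs (Suc d) y) \<le> card {b # y', c # x'}"
      by (intro card_mono) auto
    also have "\<dots> \<le> 2" by (simp add: card_insert_if)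
    finally show ?thesis .
  qed
qed

lemma even_verts_Cons: "b # x \<in> even_verts (Suc d) \<longleftrightarrow> (if b then x \<in> odd_verts d else x \<in> even_verts d)"
  by (auto simp: even_verts_def odd_verts_def cube_verts_def card_less_Suc_split)

lemma odd_verts_Cons: "b # x \<in> odd_verts (Suc d) \<longleftrightarrow> (if b then x \<in> even_verts d else x \<in> odd_verts d)"
  by (auto simp: even_verts_def odd_verts_def cube_verts_def card_less_Suc_split)

lemma cube_verts_even_odd: "cube_verts d = even_verts d \<union> odd_verts d" "even_verts d \<inter> odd_verts d = {}"
  by (auto simp: even_verts_def odd_verts_def)

lemma cube_nbrs_parity:
  "(x \<in> even_verts d \<longrightarrow> cube_nbrs d x \<subseteq> odd_verts d) \<and> (x \<in> odd_verts d \<longrightarrow> cube_nbrs d x \<subseteq> even_verts d)"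
proof (induction d arbitrary: x)
  case 0
  then show ?case by (auto simp: cube_nbrs_def cube_adj_def)
next
  case (Suc d)
  show ?case
  proof (cases "x \<in> cube_verts (Suc d)")
    case True
    then obtain b z where x: "x = b # z" "z \<in> cube_verts d" by (auto simp: cube_verts_Suc)
    then show ?thesis using Suc.IH[of z] by (auto simp: cube_nbrs_Cons even_verts_Cons odd_verts_Cons)
  qed (auto simp: cube_verts_even_odd)
qed

lemma cube_regular_bipartite:
  assumes "d > 0"
  shows "regular_bipartite (even_verts d) (odd_verts d) (cube_nbrs d) d"
proof
  show "finite (even_verts d)" "finite (odd_verts d)"
    using finite_cube_verts[of d] by (auto simp: even_verts_def odd_verts_def)
  show "even_verts d \<inter> odd_verts d = {}" by (rule cube_verts_even_odd)
  show "x \<in> even_verts d \<Longrightarrow> cube_nbrs d x \<subseteq> odd_verts d"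
    "x \<in> odd_verts d \<Longrightarrow> cube_nbrs d x \<subseteq> even_verts d" for x
    using cube_nbrs_parity[of x d] by auto
qed (use assms card_cube_nbrs cube_nbrs_sym cube_codegree in \<open>auto simp: cube_verts_even_odd(1)[symmetric]\<close>)

section \<open>Edge isoperimetry in the cube\<close>

lemma log_sum_ineq:
  fixes a b :: real
  assumes "0 \<le> b" "b \<le> a"
  shows "a * log 2 a + b * log 2 b + 2 * b \<le> (a + b) * log 2 (a + b)"
proof (cases "b = 0")
  case False
  then have b: "b > 0" and a: "a > 0" using assms by auto
  define x where "x = b / a"
  have x: "0 \<le> x" "x \<le> 1" using a b assms by (auto simp: x_def)
  \<comment> \<open>By convexity, with equality at 0 and 1. This yields one \<open>b\<close> of the
    term \<open>2 * b\<close>; the other comes from \<open>(a + b) / b \<ge> 2\<close>.\<close>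
  have "2 powr x \<le> 1 + x"
  proof -
    have "convex_on UNIV (\<lambda>x::real. exp x)" by (rule exp_convex)
    from convex_onD[OF this x, of 0 "ln 2"]
    have "exp (x * ln 2) \<le> (1 - x) * exp 0 + x * exp (ln 2)" by simp
    then show ?thesis by (simp add: powr_def)
  qed
  then have "x \<le> log 2 (1 + x)" using x by (subst le_log_iff) auto
  then have "b / a \<le> log 2 ((a + b) / a)" using a by (simp add: x_def add_divide_distrib)
  then have 1: "b \<le> a * (log 2 (a + b) - log 2 a)" using a b by (simp add: log_divide field_simps)
  have "log 2 2 \<le> log 2 ((a + b) / b)" using a b assms by (subst log_le_cancel_iff) (auto simp: field_simps)
  then have "1 \<le> log 2 (a + b) - log 2 b" using a b by (simp add: log_divide)
  then have 2: "b * 1 \<le> b * (log 2 (a + b) - log 2 b)" using b by (intro mult_left_mono) auto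
  show ?thesis using 1 2 by (simp add: algebra_simps)
qed simp

text \<open>Split \<open>S\<close> by the first coordinate. The edges between the halves form a
  matching with at most as many edges as the smaller half has vertices, and each is counted from
  both ends; \<open>log_sum_ineq\<close> is exactly the induction step.\<close>

lemma cube_edge_isoperimetry:
  "S \<subseteq> cube_verts d \<Longrightarrow> (\<Sum>x\<in>S. real (card (cube_nbrs d x \<inter> S))) \<le> card S * log 2 (card S)"
proof (induction d arbitrary: S)
  case 0
  have "cube_nbrs 0 x = {}" for x by (auto simp: cube_nbrs_def cube_adj_def)
  moreover have "S = {} \<or> S = {[]}" using 0 by (auto simp: cube_verts_def)
  ultimately show ?case by auto
next
  case (Suc d)
  define T where "T b = {x. b # x \<in> S}" for b
  have TV: "T b \<subseteq> cube_verts d" for b using Suc.prems by (auto simp: T_def cube_verts_def)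
  have fin: "finite (T b)" for b using TV finite_cube_verts finite_subset by blast
  have S: "S = (#) True ` T True \<union> (#) False ` T False"
  proof -
    have "\<exists>b z. x = b # z" if "x \<in> S" for x using Suc.prems that by (auto simp: cube_verts_Suc)
    then show ?thesis unfolding T_def by (auto simp: image_iff) (metis (full_types))
  qed
  have cS: "card S = card (T True) + card (T False)"
    unfolding S using fin by (subst card_Un_disjoint) (auto simp: card_image)
  have nb: "card (cube_nbrs (Suc d) (b # x) \<inter> S) = card (cube_nbrs d x \<inter> T b) + of_bool (x \<in> T (\<not> b))"
    if "x \<in> T b" for b x
  proof -
    have "cube_nbrs (Suc d) (b # x) \<inter> S =
        (#) b ` (cube_nbrs d x \<inter> T b) \<union> (if x \<in> T (\<not> b) then {(\<not> b) # x} else {})"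
      using TV that by (subst cube_nbrs_Cons) (auto simp: T_def)
    also have "card \<dots> = card ((#) b ` (cube_nbrs d x \<inter> T b)) + card (if x \<in> T (\<not> b) then {(\<not> b) # x} else {})"
      using finite_cube_nbrs by (intro card_Un_disjoint) auto
    finally show ?thesis by (simp add: card_image)
  qed
  have sumb: "(\<Sum>x\<in>(#) b ` T b. real (card (cube_nbrs (Suc d) x \<inter> S))) =
      (\<Sum>x\<in>T b. real (card (cube_nbrs d x \<inter> T b))) + card (T True \<inter> T False)" for b
  proof -
    have "(\<Sum>x\<in>T b. of_bool (x \<in> T (\<not> b)) :: real) = card (T b \<inter> T (\<not> b))"
      using fin[of b] by (simp add: of_bool_def sum.If_cases Int_def)
    also have "T b \<inter> T (\<not> b) = T True \<inter> T False" by (cases b) auto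
    finally show ?thesis by (simp add: sum.reindex nb sum.distrib)
  qed
  have "(\<Sum>x\<in>S. real (card (cube_nbrs (Suc d) x \<inter> S))) =
      (\<Sum>b\<in>UNIV. \<Sum>x\<in>(#) b ` T b. real (card (cube_nbrs (Suc d) x \<inter> S)))"
    unfolding UNIV_bool by (subst (1) S, subst sum.union_disjoint) (use fin in auto)
  also have "\<dots> = (\<Sum>x\<in>T True. real (card (cube_nbrs d x \<inter> T True))) +
      (\<Sum>x\<in>T False. real (card (cube_nbrs d x \<inter> T False))) + 2 * card (T True \<inter> T False)"
    unfolding sumb UNIV_bool by simp
  also have "\<dots> \<le> card (T True) * log 2 (card (T True)) + card (T False) * log 2 (card (T False)) +
      2 * card (T True \<inter> T False)"
    using Suc.IH[OF TV] by (intro add_mono) auto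
  also have "\<dots> \<le> (real (card (T True)) + card (T False)) * log 2 (real (card (T True)) + card (T False))"
  proof (cases "card (T False) \<le> card (T True)")
    case True
    have "card (T True \<inter> T False) \<le> card (T False)" using fin by (intro card_mono) auto
    then show ?thesis using log_sum_ineq[of "card (T False)" "card (T True)"] True by simp
  next
    case False
    have "card (T True \<inter> T False) \<le> card (T True)" using fin by (intro card_mono) auto
    then show ?thesis using log_sum_ineq[of "card (T True)" "card (T False)"] False by (simp add: add.commute)
  qed
  finally show ?case by (simp add: cS)
qed

text \<open>Edge isoperimetry for \<open>A\<close> together with its neighbourhood: this set induces
  all \<open>d * card A\<close> edges at \<open>A\<close>, each counted twice.\<close>

lemma cube_iso:
  assumes d: "d > 0" and A: "A \<subseteq> even_verts d \<or> A \<subseteq> odd_verts d"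
  shows "2 * real d * card A \<le>
    (real (card A) + card (regular_bipartite.NS (cube_nbrs d) A)) *
      log 2 (real (card A) + card (regular_bipartite.NS (cube_nbrs d) A))"
proof -
  interpret regular_bipartite "even_verts d" "odd_verts d" "cube_nbrs d" d
    by (rule cube_regular_bipartite[OF d])
  let ?B = "NS A"
  let ?S = "A \<union> ?B"
  have AV: "A \<subseteq> cube_verts d" using A by (auto simp: cube_verts_even_odd)
  have BV: "?B \<subseteq> cube_verts d" using cube_nbrs_subset by (auto simp: NS_def)
  have fin: "finite A" "finite ?B" using AV BV finite_cube_verts finite_subset by blast+
  have disj: "A \<inter> ?B = {}" using A NS_L[of A] NS_R[of A] cube_verts_even_odd(2) by blast
  have cS: "card ?S = card A + card ?B" using fin disj by (rule card_Un_disjoint)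
  have nbA: "card (cube_nbrs d x \<inter> ?B) = d" if "x \<in> A" for x
    using that AV card_cube_nbrs[of x d] by (subst Int_absorb2) (auto simp: NS_def)
  have dc: "(\<Sum>x\<in>A. card (cube_nbrs d x \<inter> ?B)) = (\<Sum>y\<in>?B. card (cube_nbrs d y \<inter> A))"
    using AV BV unfolding cube_verts_even_odd(1) by (rule double_count)
  have "2 * (d * card A) = (\<Sum>x\<in>A. card (cube_nbrs d x \<inter> ?B)) + (\<Sum>y\<in>?B. card (cube_nbrs d y \<inter> A))"
    unfolding dc[symmetric] using nbA by simp
  also have "\<dots> \<le> (\<Sum>x\<in>A. card (cube_nbrs d x \<inter> ?S)) + (\<Sum>y\<in>?B. card (cube_nbrs d y \<inter> ?S))"
    using finite_cube_nbrs by (intro add_mono sum_mono card_mono) auto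
  also have "\<dots> = (\<Sum>x\<in>?S. card (cube_nbrs d x \<inter> ?S))" using fin disj by (rule sum.union_disjoint[symmetric])
  finally have "real (2 * (d * card A)) \<le> (\<Sum>x\<in>?S. real (card (cube_nbrs d x \<inter> ?S)))"
    unfolding of_nat_sum[symmetric] by (rule of_nat_mono)
  also have "\<dots> \<le> card ?S * log 2 (card ?S)" using AV BV by (intro cube_edge_isoperimetry) auto
  finally show ?thesis by (simp add: cS)
qed

definition flip_first :: "bool list \<Rightarrow> bool list" where
  "flip_first x = (\<not> hd x) # tl x"

lemma cube_flip_first:
  assumes "d > 0"
  shows "x \<in> cube_verts d \<Longrightarrow> flip_first (flip_first x) = x"
    and "flip_first ` even_verts d \<subseteq> odd_verts d" and "flip_first ` odd_verts d \<subseteq> even_verts d"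
    and "x \<in> cube_verts d \<Longrightarrow> cube_nbrs d (flip_first x) = flip_first ` cube_nbrs d x"
proof -
  obtain n where n: "d = Suc n" using assms by (cases d) auto
  have cons: "\<exists>b z. y = b # z \<and> z \<in> cube_verts n" if "y \<in> cube_verts d" for y
    using that n by (auto simp: cube_verts_Suc)
  show "x \<in> cube_verts d \<Longrightarrow> flip_first (flip_first x) = x"
    using cons[of x] by (auto simp: flip_first_def)
  show "flip_first ` even_verts d \<subseteq> odd_verts d"
  proof clarify
    fix y assume y: "y \<in> even_verts d"
    then obtain b z where "y = b # z" using cons[of y] by (auto simp: cube_verts_even_odd)
    then show "flip_first y \<in> odd_verts d" using y n by (auto simp: flip_first_def even_verts_Cons odd_verts_Cons split: if_splits)
  qed
  show "flip_first ` odd_verts d \<subseteq> even_verts d"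
  proof clarify
    fix y assume y: "y \<in> odd_verts d"
    then obtain b z where "y = b # z" using cons[of y] by (auto simp: cube_verts_even_odd)
    then show "flip_first y \<in> even_verts d" using y n by (auto simp: flip_first_def even_verts_Cons odd_verts_Cons split: if_splits)
  qed
  assume "x \<in> cube_verts d"
  then obtain b z where "x = b # z" "z \<in> cube_verts n" using cons by blast
  then show "cube_nbrs d (flip_first x) = flip_first ` cube_nbrs d x"
    by (simp add: n flip_first_def cube_nbrs_Cons image_image)
qed

lemma card_cube_sides:
  assumes d: "d > 0"
  shows "card (even_verts d) = 2 ^ (d - 1)" "card (odd_verts d) = 2 ^ (d - 1)"
proof -
  interpret regular_bipartite "even_verts d" "odd_verts d" "cube_nbrs d" d
    by (rule cube_regular_bipartite[OF d])
  have "card (cube_verts d) = 2 ^ d"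
    using card_lists_length_eq[of "UNIV :: bool set" d] by (simp add: cube_verts_def)
  also have "card (cube_verts d) = card (even_verts d) + card (odd_verts d)"
    unfolding cube_verts_even_odd(1) using finite_L finite_R disjoint by (rule card_Un_disjoint)
  finally have "2 * card (even_verts d) = 2 ^ d" using card_L_eq_R by simp
  also have "(2::nat) ^ d = 2 * 2 ^ (d - 1)" using d by (cases d) auto
  finally show "card (even_verts d) = 2 ^ (d - 1)" by simp
  then show "card (odd_verts d) = 2 ^ (d - 1)" using card_L_eq_R by simp
qed

section \<open>The hard-core distribution\<close>

lemma hc_cond_prob:
  assumes d: "d > 0" and l: "l > 0"
  shows "\<P>(I in measure_pmf (hc d l). P I \<bar> Q I) =
    regular_bipartite.weight (even_verts d) (odd_verts d) (cube_nbrs d) l (\<lambda>I. P I \<and> Q I) /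
    regular_bipartite.weight (even_verts d) (odd_verts d) (cube_nbrs d) l Q"
proof -
  interpret regular_bipartite "even_verts d" "odd_verts d" "cube_nbrs d" d
    by (rule cube_regular_bipartite[OF d])
  have indeps: "indeps = indep_sets_cube d"
    by (simp add: indeps_def indep_sets_cube_def cube_verts_even_odd(1)[symmetric] cube_nbrs_def)
  have Z: "hc_partition d l > 0" using l by (rule hc_partition_pos)
  have prob: "measure (measure_pmf (hc d l)) {I. S I} = weight l S / hc_partition d l" for S
  proof -
    have "set_pmf (hc d l) \<subseteq> indeps" using l by (auto simp: set_pmf_iff pmf_hc indeps split: if_splits)
    then have "{I. S I} \<inter> set_pmf (hc d l) = {I \<in> indeps. S I} \<inter> set_pmf (hc d l)" by auto
    then have "measure (measure_pmf (hc d l)) {I. S I} = measure (measure_pmf (hc d l)) {I \<in> indeps. S I}"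
      by (metis measure_Int_set_pmf)
    also have "\<dots> = (\<Sum>I\<in>{I \<in> indeps. S I}. pmf (hc d l) I)"
      using finite_indeps by (intro measure_measure_pmf_finite) auto
    also have "\<dots> = (\<Sum>I\<in>{I \<in> indeps. S I}. l ^ card I / hc_partition d l)"
      using l by (intro sum.cong) (auto simp: pmf_hc indeps)
    finally show ?thesis by (simp add: weight_def sum_divide_distrib)
  qed
  show ?thesis using Z by (simp add: cond_prob_def prob)
qed

lemma hc_correlations:
  assumes good: "good d" and l: "l > 3000 * ln (real d) / real d powr (1/3)" and d: "d > 0"
    and uvw: "u \<in> even_verts d" "v \<in> even_verts d" "w \<in> odd_verts d"
  shows "\<P>(I in measure_pmf (hc d l). u \<in> I \<bar> w \<in> I)
      \<le> (1 + l) powr (- (real d * (1 - 2 / real d powr (1/3))))"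
    and "\<P>(I in measure_pmf (hc d l). u \<in> I \<bar> v \<in> I) \<ge> l / (1 + l) * (1 - 8 / real d)"
proof -
  interpret E: regular_bipartite "even_verts d" "odd_verts d" "cube_nbrs d" d
    by (rule cube_regular_bipartite[OF d])
  interpret F: regular_bipartite "odd_verts d" "even_verts d" "cube_nbrs d" d
    by (rule E.swap)
  note E = cube_iso[OF d] card_cube_sides(1)[OF d] good l
  note F = cube_iso[OF d] card_cube_sides(2)[OF d] good l
  define \<eta> where "\<eta> = (1 + l) powr (- (real d - (real d powr (1/3))\<^sup>2))"
  have l0: "l > 0" by (rule E.l_pos[OF E]) auto
  have W: "F.weight = E.weight" by (rule E.weight_swap)
  have wE: "E.weight l (\<lambda>I. x \<in> I \<and> E.small (I \<inter> even_verts d)) \<le> \<eta> * E.weight l (\<lambda>_. True)"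
    if "x \<in> even_verts d" for x
    unfolding \<eta>_def E.q_def[symmetric] using that by (intro E.cluster_weight[OF E]) auto
  have wO: "E.weight l (\<lambda>I. x \<in> I \<and> F.small (I \<inter> odd_verts d)) \<le> \<eta> * E.weight l (\<lambda>_. True)"
    if "x \<in> odd_verts d" for x
    unfolding \<eta>_def E.q_def[symmetric] W[symmetric] using that by (intro F.cluster_weight[OF F]) auto
  have sym: "E.weight l (\<lambda>I. E.small (I \<inter> even_verts d)) = E.weight l (\<lambda>I. F.small (I \<inter> odd_verts d))"
    using cube_flip_first[OF d] unfolding cube_verts_even_odd(1) by (intro E.side_symmetry) auto
  have err: "d * \<eta> \<le> 1 / 4" "4 * (d * \<eta> + (1 + l) / l * \<eta>) \<le> 8 / d"
    "8 * \<eta> * (1 + l) / l \<le> (1 + l) powr (- (real d * (1 - 2 / real d powr (1/3))))"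
    unfolding \<eta>_def E.q_def[symmetric] by (intro E.error_bounds[OF E]; simp)+
  have Zw: "E.weight l (\<lambda>_. True) > 0" using l0 by (rule E.weight_True_pos)
  have "E.weight l (\<lambda>I. w \<in> I) > 0"
    using E.occupied_lower[OF l0 sym wE wO err(1) uvw(3)] l0 Zw by (simp add: zero_less_mult_iff)
  moreover have "E.weight l (\<lambda>I. u \<in> I \<and> w \<in> I) \<le> 8 * \<eta> * (1 + l) / l * E.weight l (\<lambda>I. w \<in> I)"
    by (rule E.opposite_sides[OF l0 sym wE wO err(1) uvw(1,3)])
  ultimately have "\<P>(I in measure_pmf (hc d l). u \<in> I \<bar> w \<in> I) \<le> 8 * \<eta> * (1 + l) / l"
    unfolding hc_cond_prob[OF d l0] by (simp add: pos_divide_le_eq)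
  also note err(3)
  finally show "\<P>(I in measure_pmf (hc d l). u \<in> I \<bar> w \<in> I)
      \<le> (1 + l) powr (- (real d * (1 - 2 / real d powr (1/3))))" .
  \<comment> \<open>The estimate for two vertices on one side speaks about the second side of the
    locale, so for even vertices the hypotheses are restated with the sides exchanged.\<close>
  note hyps = l0 sym[symmetric, folded W] wO[folded W] wE[folded W] err(1)
  have pos: "E.weight l (\<lambda>I. v \<in> I) > 0"
    using F.occupied_lower[OF hyps uvw(2)] l0 Zw unfolding W by (simp add: zero_less_mult_iff)
  have "l / (1 + l) * (1 - 8 / real d) * E.weight l (\<lambda>I. v \<in> I) \<le> E.weight l (\<lambda>I. u \<in> I \<and> v \<in> I)"
  proof (cases "u = v")
    \<comment> \<open>The vertices may coincide; then the conditional probability is 1 and the bound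
      holds because its factors are at most 1.\<close>
    case True
    have "l / (1 + l) * (1 - 8 / real d) \<le> 1 * 1"
    proof (rule mult_mono')
      show "0 \<le> 1 - 8 / real d" using E.d_ge[OF E] by simp
    qed (use l0 in auto)
    then have "l / (1 + l) * (1 - 8 / real d) * E.weight l (\<lambda>I. v \<in> I) \<le> 1 * E.weight l (\<lambda>I. v \<in> I)"
      using pos by (intro mult_right_mono) auto
    then show ?thesis using True by simp
  next
    case False
    have "l / (1 + l) * (1 - 8 / real d) * E.weight l (\<lambda>I. v \<in> I) \<le>
        l / (1 + l) * (1 - 4 * (d * \<eta> + (1 + l) / l * \<eta>)) * E.weight l (\<lambda>I. v \<in> I)"
      using err(2) l0 pos by (intro mult_right_mono mult_left_mono) auto
    also have "\<dots> \<le> E.weight l (\<lambda>I. u \<in> I \<and> v \<in> I)"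
      using F.same_side[OF hyps uvw(1,2) False] unfolding W .
    finally show ?thesis .
  qed
  then show "\<P>(I in measure_pmf (hc d l). u \<in> I \<bar> v \<in> I) \<ge> l / (1 + l) * (1 - 8 / real d)"
    unfolding hc_cond_prob[OF d l0] using pos by (simp add: pos_le_divide_eq)
qed

theorem theorem1p7:
  shows "\<exists>c0 :: real. c0 > 0 \<and>
    (\<forall>(l :: nat \<Rightarrow> real) (u :: nat \<Rightarrow> bool list) (v :: nat \<Rightarrow> bool list) (w :: nat \<Rightarrow> bool list).
      (\<forall>d\<ge>1. l d > c0 * ln (real d) / real d powr (1/3)) \<longrightarrow>
      (\<forall>d\<ge>1. u d \<in> even_verts d \<and> v d \<in> even_verts d \<and> w d \<in> odd_verts d) \<longrightarrow>
      (\<exists>\<delta> \<epsilon> :: nat \<Rightarrow> real. \<delta> \<longlonglongrightarrow> 0 \<and> \<epsilon> \<longlonglongrightarrow> 0 \<and>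
        (\<forall>d\<ge>1.
          \<P>(I in measure_pmf (hc d (l d)). u d \<in> I \<bar> w d \<in> I)
            \<le> (1 + l d) powr (- (real d * (1 - \<delta> d))) \<and>
          \<P>(I in measure_pmf (hc d (l d)). u d \<in> I \<bar> v d \<in> I)
            \<ge> l d / (1 + l d) * (1 - \<epsilon> d))))"
proof (intro exI[of _ "3000 :: real"] conjI allI impI)
  fix l :: "nat \<Rightarrow> real" and u v w :: "nat \<Rightarrow> bool list"
  assume l: "\<forall>d\<ge>1. l d > 3000 * ln (real d) / real d powr (1/3)"
    and uvw: "\<forall>d\<ge>1. u d \<in> even_verts d \<and> v d \<in> even_verts d \<and> w d \<in> odd_verts d"
  \<comment> \<open>In the finitely many dimensions that are not good, the value 1 turns the two
    bounds into the trivial ones, 1 from above and 0 from below.\<close>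
  define \<delta> :: "nat \<Rightarrow> real" where "\<delta> d = (if good d then 2 / real d powr (1/3) else 1)" for d
  define \<epsilon> :: "nat \<Rightarrow> real" where "\<epsilon> d = (if good d then 8 / real d else 1)" for d
  have "(\<lambda>d. 2 / real d powr (1/3)) \<longlonglongrightarrow> 0" by real_asymp
  then have lim_\<delta>: "\<delta> \<longlonglongrightarrow> 0"
    by (rule Lim_transform_eventually) (rule eventually_mono[OF eventually_good], simp add: \<delta>_def)
  have "(\<lambda>d. 8 / real d) \<longlonglongrightarrow> 0" by real_asymp
  then have lim_\<epsilon>: "\<epsilon> \<longlonglongrightarrow> 0"
    by (rule Lim_transform_eventually) (rule eventually_mono[OF eventually_good], simp add: \<epsilon>_def)
  have "\<P>(I in measure_pmf (hc d (l d)). u d \<in> I \<bar> w d \<in> I) \<le> (1 + l d) powr (- (real d * (1 - \<delta> d))) \<and>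
      \<P>(I in measure_pmf (hc d (l d)). u d \<in> I \<bar> v d \<in> I) \<ge> l d / (1 + l d) * (1 - \<epsilon> d)"
    if "d \<ge> 1" for d
  proof (cases "good d")
    case True
    then show ?thesis using hc_correlations[of d "l d" "u d" "v d" "w d"] l uvw that by (simp add: \<delta>_def \<epsilon>_def)
  next
    case False
    have "0 \<le> 3000 * ln (real d) / real d powr (1/3)" using that by simp
    then have l0: "l d > 0" using l that by (meson le_less_trans)
    have "0 \<le> \<P>(I in measure_pmf (hc d (l d)). P I \<bar> Q I)" "\<P>(I in measure_pmf (hc d (l d)). P I \<bar> Q I) \<le> 1" for P Q
      unfolding cond_prob_def
      by (auto intro!: divide_le_eq_1[THEN iffD2] measure_pmf.finite_measure_mono simp: zero_less_measure_iff)
    then show ?thesis using False l0 by (simp add: \<delta>_def \<epsilon>_def)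
  qed
  then show "\<exists>\<delta> \<epsilon> :: nat \<Rightarrow> real. \<delta> \<longlonglongrightarrow> 0 \<and> \<epsilon> \<longlonglongrightarrow> 0 \<and>
      (\<forall>d\<ge>1. \<P>(I in measure_pmf (hc d (l d)). u d \<in> I \<bar> w d \<in> I) \<le> (1 + l d) powr (- (real d * (1 - \<delta> d))) \<and>
        \<P>(I in measure_pmf (hc d (l d)). u d \<in> I \<bar> v d \<in> I) \<ge> l d / (1 + l d) * (1 - \<epsilon> d))"
    using lim_\<delta> lim_\<epsilon> by blast
qed simp

end
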